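(* Let $\Omega\subset\mathbb{R}^d$ be a bounded domain with Lipschitz boundary, let $V=H^1_0(\Omega)$, and let $u\in V\cap H^2(\Omega)$. Let $B_1,\dots,B_m\subset\Omega$ be open nonempty sets, $K_i\supset B_i$ convex sets with Lipschitz boundary with $\Omega\subset\bigcup_i\overline{K_i}$, $M=\max_{x\in\Omega}|\{i:x\in K_i\}|$, $R=\max_i\operatorname{diam}K_i$, $\eta=1$ if all $B_i=K_i$ and $\eta=3\max_i|K_i|/|B_i|$ otherwise. Let $b_1,\dots,b_m\in\mathbb{R}$, $\delta>0$, and let $\tilde u\in V$ be the solution of $$\int_\Omega\nabla\tilde u\cdot\nabla v\,dx+\delta^{-1}b(\tilde u,v)=\delta^{-1}\widetilde{b(u,v)}\qquad\forall v\in V,$$ where $b(w,v)=\sum_i|B_i|\mathrm{avg}_{B_i}(w)\mathrm{avg}_{B_i}(v)$ and $\widetilde{b(u,v)}=\sum_ib_i|B_i|\mathrm{avg}_{B_i}(v)$. Let $\theta\in(0,1]$ be such that $\delta\in[\theta R^2M/\pi^2,\theta^{-1}R^2M/\pi^2]$. Then $$\|\tilde u-u\|_{L^2(\Omega)}\le\eta\theta^{-1}\frac{R^2M}{\pi^2}\|\Delta u\|_{L^2(\Omega)}+\eta\theta^{-1}\sup_{0\ne v\in L^2(\Omega)}\frac{|\widetilde{b(u,v)}-b(u,v)|}{\|v\|_{L^2(\Omega)}}.$$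
   Context: $\mathrm{avg}_U(v)=|U|^{-1}\int_Uv\,dx$. The problem for $\tilde u$ is the PDE-regularized learning problem with auxiliary coefficients $\tilde\alpha=1$, $\tilde\sigma=0$, $\tilde f=0$. *)

theory Defs
  imports "HOL-Analysis.Analysis"
begin

definition cpartial :: "'n::finite \<Rightarrow> (real^'n \<Rightarrow> real) \<Rightarrow> real^'n \<Rightarrow> real" where
  "cpartial j f x = frechet_derivative f (at x) (axis j 1)"

definition smooth_fun :: "(real^'n::finite \<Rightarrow> real) \<Rightarrow> bool" where
  "smooth_fun f \<longleftrightarrow> (\<forall>js. \<forall>x. (fold cpartial js f) differentiable (at x))"

definition test_fun :: "(real^'n::finite) set \<Rightarrow> (real^'n \<Rightarrow> real) \<Rightarrow> bool" where
  "test_fun \<Omega> \<phi> \<longleftrightarrow> smooth_fun \<phi> \<and> compact (closure {x. \<phi> x \<noteq> 0})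
      \<and> closure {x. \<phi> x \<noteq> 0} \<subseteq> \<Omega>"

definition L2 :: "(real^'n::finite) set \<Rightarrow> (real^'n \<Rightarrow> real) \<Rightarrow> bool" where
  "L2 \<Omega> f \<longleftrightarrow> f \<in> borel_measurable (lebesgue_on \<Omega>) \<and> integrable (lebesgue_on \<Omega>) (\<lambda>x. (f x)^2)"

definition L2norm :: "(real^'n::finite) set \<Rightarrow> (real^'n \<Rightarrow> real) \<Rightarrow> real" where
  "L2norm \<Omega> f = sqrt (integral\<^sup>L (lebesgue_on \<Omega>) (\<lambda>x. (f x)^2))"

definition weak_partial :: "(real^'n::finite) set \<Rightarrow> (real^'n \<Rightarrow> real) \<Rightarrow> 'n \<Rightarrow> (real^'n \<Rightarrow> real) \<Rightarrow> bool" where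
  "weak_partial \<Omega> u j g \<longleftrightarrow>
     (\<forall>\<phi>. test_fun \<Omega> \<phi> \<longrightarrow>
        integrable (lebesgue_on \<Omega>) (\<lambda>x. u x * cpartial j \<phi> x) \<and>
        integrable (lebesgue_on \<Omega>) (\<lambda>x. g x * \<phi> x) \<and>
        integral\<^sup>L (lebesgue_on \<Omega>) (\<lambda>x. u x * cpartial j \<phi> x)
          = - integral\<^sup>L (lebesgue_on \<Omega>) (\<lambda>x. g x * \<phi> x))"

text \<open>The (a.e. unique) weak partial derivative in L2, chosen.\<close>
definition wpartial :: "(real^'n::finite) set \<Rightarrow> (real^'n \<Rightarrow> real) \<Rightarrow> 'n \<Rightarrow> real^'n \<Rightarrow> real" where
  "wpartial \<Omega> u j = (SOME g. L2 \<Omega> g \<and> weak_partial \<Omega> u j g)"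

definition H1 :: "(real^'n::finite) set \<Rightarrow> (real^'n \<Rightarrow> real) \<Rightarrow> bool" where
  "H1 \<Omega> u \<longleftrightarrow> L2 \<Omega> u \<and> (\<forall>j. \<exists>g. L2 \<Omega> g \<and> weak_partial \<Omega> u j g)"

definition H1_0 :: "(real^'n::finite) set \<Rightarrow> (real^'n \<Rightarrow> real) \<Rightarrow> bool" where
  "H1_0 \<Omega> u \<longleftrightarrow> H1 \<Omega> u \<and>
     (\<exists>\<phi>. (\<forall>k. test_fun \<Omega> (\<phi> k)) \<and>
        (\<lambda>k. L2norm \<Omega> (\<lambda>x. \<phi> k x - u x) +
             (\<Sum>j\<in>UNIV. L2norm \<Omega> (\<lambda>x. cpartial j (\<phi> k) x - wpartial \<Omega> u j x)))
        \<longlonglongrightarrow> 0)"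

definition H2 :: "(real^'n::finite) set \<Rightarrow> (real^'n \<Rightarrow> real) \<Rightarrow> bool" where
  "H2 \<Omega> u \<longleftrightarrow> H1 \<Omega> u \<and> (\<forall>j. H1 \<Omega> (wpartial \<Omega> u j))"

definition wlaplacian :: "(real^'n::finite) set \<Rightarrow> (real^'n \<Rightarrow> real) \<Rightarrow> real^'n \<Rightarrow> real" where
  "wlaplacian \<Omega> u x = (\<Sum>j\<in>UNIV. wpartial \<Omega> (wpartial \<Omega> u j) j x)"

definition lipschitz_boundary :: "(real^'n::finite) set \<Rightarrow> bool" where
  "lipschitz_boundary S \<longleftrightarrow>
     (\<forall>x\<in>frontier S. \<exists>r>0. \<exists>e. norm e = 1 \<and> (\<exists>\<gamma> L. L-lipschitz_on {z. z \<bullet> e = 0} \<gamma> \<and>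
        interior S \<inter> ball x r = {y\<in>ball x r. y \<bullet> e < \<gamma> (y - (y \<bullet> e) *\<^sub>R e)} \<and>
        closure S \<inter> ball x r = {y\<in>ball x r. y \<bullet> e \<le> \<gamma> (y - (y \<bullet> e) *\<^sub>R e)}))"

definition lipschitz_domain :: "(real^'n::finite) set \<Rightarrow> bool" where
  "lipschitz_domain \<Omega> \<longleftrightarrow> open \<Omega> \<and> connected \<Omega> \<and> \<Omega> \<noteq> {} \<and> bounded \<Omega> \<and> lipschitz_boundary \<Omega>"

definition avg :: "(real^'n::finite) set \<Rightarrow> (real^'n \<Rightarrow> real) \<Rightarrow> real" where
  "avg U v = integral\<^sup>L (lebesgue_on U) v / measure lebesgue U"

definition bform :: "nat \<Rightarrow> (nat \<Rightarrow> (real^'n::finite) set) \<Rightarrow> (real^'n \<Rightarrow> real) \<Rightarrow> (real^'n \<Rightarrow> real) \<Rightarrow> real" where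
  "bform m B w v = (\<Sum>i<m. measure lebesgue (B i) * avg (B i) w * avg (B i) v)"

definition bdata :: "nat \<Rightarrow> (nat \<Rightarrow> (real^'n::finite) set) \<Rightarrow> (nat \<Rightarrow> real) \<Rightarrow> (real^'n \<Rightarrow> real) \<Rightarrow> real" where
  "bdata m B b v = (\<Sum>i<m. b i * measure lebesgue (B i) * avg (B i) v)"

definition dirichlet :: "(real^'n::finite) set \<Rightarrow> (real^'n \<Rightarrow> real) \<Rightarrow> (real^'n \<Rightarrow> real) \<Rightarrow> real" where
  "dirichlet \<Omega> w v = integral\<^sup>L (lebesgue_on \<Omega>) (\<lambda>x. \<Sum>j\<in>UNIV. wpartial \<Omega> w j x * wpartial \<Omega> v j x)"

end

theory Submission
  imports Defs
begin

text \<open>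
  Testing the equation with \<open>ut\<close> and with \<open>u\<close> yields, for the error \<open>e = ut - u\<close>, the energy identity
  \<open>\<parallel>\<nabla>e\<parallel>\<^sup>2 + \<delta>\<^sup>-\<^sup>1 b(e,e) = \<integral> \<Delta>u e + \<delta>\<^sup>-\<^sup>1 (data misfit of e)\<close>, and a Poincare inequality on each \<open>K i\<close>,
  summed over the cover, bounds \<open>\<parallel>e\<parallel>\<^sup>2\<close> by the left-hand side. The sharp constant
  \<open>diameter / \<pi>\<close> on convex sets is the Payne--Weinberger inequality. It is proved by bisection: a
  counterexample can be cut by hyperplanes, keeping the mean zero, until it is close to a segment.
  Such a thin body is divided into slabs of equal width, whose volumes form a log-concave sequence by
  the Brunn--Minkowski inequality, and a discrete weighted Wirtinger inequality for log-concave
  weights concludes.\<close>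

section \<open>A discrete Wirtinger inequality with log-concave weights\<close>

text \<open>The obstacle is sharpness: on the way to \<open>diameter / \<pi>\<close> no step may
  lose a fixed factor. Slabs and sample values replace a one-dimensional limit density, so that no
  differential equation with an irregular weight has to be solved. The discrete constant 4 sin^2 (pi
  / (2 N)) is the first nonzero eigenvalue of the Laplacian of the path with N vertices, and (D /
  N)^2 divided by it tends to (D / pi)^2. The remaining errors of the discretization need only
  vanish as N grows, relative to the volume of the thin body. Payne--Weinberger is proved for C^1
  functions; \<open>H1_0\<close> is reached through test functions. These vanish outside \<Omega>,
  so sets \<open>K i\<close> that stick out of \<Omega> do no harm. The constants of the final
  estimate have separate origins: M counts how often a point is used when the gradient integrals
  over the \<open>K i\<close> are added; the 3 in \<eta> is the price of replacing the mean over
  \<open>K i\<close> by the mean over \<open>B i\<close>; and 1 / \<theta> comes from comparing R^2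
  M / pi^2 with \<delta>, because the energy and the Poincare bound weigh the gradient against
  \<open>bform\<close> differently.\<close>

lemma weighted_sum_squares_ge:
  fixes x y a b c :: real
  assumes "a > 0" "b > 0" "c \<ge> 0" "c\<^sup>2 \<le> a * b"
  shows "2 * x * y * c \<le> a * x\<^sup>2 + b * y\<^sup>2"
proof -
  have "c \<le> sqrt (a * b)" using assms by (simp add: real_le_rsqrt)
  have "2 * x * y * c \<le> 2 * \<bar>x\<bar> * \<bar>y\<bar> * c"
    using assms(3) by (metis abs_ge_self abs_mult abs_numeral mult_right_mono)
  also have "\<dots> \<le> 2 * \<bar>x\<bar> * \<bar>y\<bar> * sqrt (a * b)"
    using \<open>c \<le> sqrt (a * b)\<close> by (intro mult_left_mono) auto
  also have "\<dots> \<le> a * x\<^sup>2 + b * y\<^sup>2"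
    using sum_squares_bound[of "sqrt a * \<bar>x\<bar>" "sqrt b * \<bar>y\<bar>"] assms
    by (simp add: power_mult_distrib real_sqrt_mult mult_ac)
  finally show ?thesis .
qed

text \<open>Picone's argument with the positive supersolution \<open>sqrt (p k) * sin (pi k / N)\<close>: log-concavity of \<open>p\<close>
  absorbs the factor \<open>sqrt (p k)\<close>, leaving the eigenvalue of the unweighted path.\<close>
lemma discrete_dirichlet_wirtinger:
  fixes p F :: "nat \<Rightarrow> real"
  assumes N: "N \<ge> 2" and pos: "\<And>k. k < N \<Longrightarrow> p k > 0"
    and lc: "\<And>k. k + 2 < N \<Longrightarrow> p k * p (k + 2) \<le> (p (k + 1))\<^sup>2"
    and F0: "F 0 = 0" and FN: "F N = 0"
  shows "4 * (sin (pi / (2 * N)))\<^sup>2 * (\<Sum>k=1..<N. (F k)\<^sup>2 / sqrt (p (k - 1) * p k))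
     \<le> (\<Sum>k<N. (F (Suc k) - F k)\<^sup>2 / p k)"
proof -
  define s where "s k = sin (pi * real k / N)" for k
  define q where "q k = sqrt (p (k - 1) * p k)" for k
  \<comment> \<open>\<alpha> k and \<beta> k are what the edges from k to k + 1 and from k - 1 to k
    leave on (F k)^2 once their cross terms are absorbed by the inequality of arithmetic and
    geometric means, weighted by ratios of \<open>s\<close>.\<close>
  define \<alpha> where "\<alpha> k = 1 / p k - s (Suc k) / (s k * q k)" for k
  define \<beta> where "\<beta> k = 1 / p (k - 1) - s (k - 1) / (s k * q k)" for k
  have Npos: "real N > 0" using N by simp
  have spos: "s k > 0" if "1 \<le> k" "k < N" for k
  proof -
    have "pi * real k < pi * real N" using that by simp
    then have "pi * real k / N < pi" using Npos by (simp add: field_simps)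
    then show ?thesis unfolding s_def using that Npos by (intro sin_gt_zero) auto
  qed
  have s0: "s 0 = 0" and sN: "s N = 0" using Npos by (auto simp: s_def)
  have qpos: "q k > 0" if "1 \<le> k" "k < N" for k
    using that pos[of k] pos[of "k-1"] by (simp add: q_def)
  have edge: "(F (Suc k) - F k)\<^sup>2 / p k \<ge> (F k)\<^sup>2 * \<alpha> k + (F (Suc k))\<^sup>2 * \<beta> (Suc k)"
    if k: "k < N" for k
  proof (cases "k = 0 \<or> Suc k = N")
    \<comment> \<open>At the two end edges both \<open>F\<close> and the sine vanish at the outer
      vertex, so the bound is an equality.\<close>
    case True
    then show ?thesis
      using F0 FN s0 sN by (auto simp: \<alpha>_def \<beta>_def)
  next
    case False
    then have k1: "1 \<le> k" and k2: "Suc k < N" using k by auto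
    define x y where "x = F k" and "y = F (Suc k)"
    have sk: "s k > 0" "s (Suc k) > 0" "q k > 0" "q (Suc k) > 0" "p k > 0"
      using k1 k2 spos qpos pos by auto
    \<comment> \<open>Log-concavity enters here: q k q (k + 1) \<le> (p k)^2 is exactly the
      condition under which the two square terms absorb the cross term 2 x y / p k.\<close>
    have "(p (k-1) * p k) * (p k * p (Suc k)) = (p (k-1) * p (Suc k)) * (p k)\<^sup>2"
      by (simp add: power2_eq_square)
    also have "\<dots> \<le> (p k)\<^sup>2 * (p k)\<^sup>2"
      using lc[of "k-1"] k1 k2 by (intro mult_right_mono) (auto simp: numeral_2_eq_2)
    finally have "sqrt ((p (k-1) * p k) * (p k * p (Suc k))) \<le> (p k)\<^sup>2"
      by (intro real_le_lsqrt) (auto simp: power2_eq_square)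
    then have qq: "q k * q (Suc k) \<le> (p k)\<^sup>2"
      by (simp add: q_def real_sqrt_mult)
    have "2 * x * y * (1 / p k) \<le> (s (Suc k) / (s k * q k)) * x\<^sup>2 + (s k / (s (Suc k) * q (Suc k))) * y\<^sup>2"
      using sk qq by (intro weighted_sum_squares_ge)
         (auto simp: power_divide field_simps)
    then have "(y - x)\<^sup>2 / p k \<ge> x\<^sup>2 * \<alpha> k + y\<^sup>2 * \<beta> (Suc k)"
      by (simp add: \<alpha>_def \<beta>_def power2_diff diff_divide_distrib add_divide_distrib algebra_simps)
    then show ?thesis by (simp add: x_def y_def)
  qed
  have node: "\<alpha> k + \<beta> k \<ge> 4 * (sin (pi / (2 * N)))\<^sup>2 / q k" if k: "1 \<le> k" "k < N" for k
  proof -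
    have sk: "s k > 0" "q k > 0" "p k > 0" "p (k-1) > 0"
      using k spos qpos pos by auto
    define t where "t = pi / N"
    have e1: "pi * real (Suc k) / N = pi * real k / N + t" by (simp add: t_def distrib_left add_divide_distrib)
    have e2: "pi * real (k - 1) / N = pi * real k / N - t" using k by (simp add: t_def of_nat_diff right_diff_distrib diff_divide_distrib)
    have ss: "s (Suc k) + s (k - 1) = 2 * cos t * s k"
      unfolding s_def e1 e2 by (simp add: sin_add sin_diff)
    have hc: "2 - 2 * cos t = 4 * (sin (pi / (2 * N)))\<^sup>2"
    proof -
      have "cos t = cos (2 * (pi / (2 * N)))" by (simp add: t_def)
      then show ?thesis unfolding cos_double_sin by linarith
    qed
    have "2 * 1 * 1 * (1 / q k) \<le> (1 / p k) * 1\<^sup>2 + (1 / p (k-1)) * 1\<^sup>2"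
      using sk by (intro weighted_sum_squares_ge) (auto simp: q_def field_simps)
    moreover have "s (Suc k) / (s k * q k) + s (k - 1) / (s k * q k) = 2 * cos t / q k"
      unfolding add_divide_distrib[symmetric] ss using sk by simp
    ultimately have "\<alpha> k + \<beta> k \<ge> 2 / q k - 2 * cos t / q k" by (simp add: \<alpha>_def \<beta>_def)
    also have "2 / q k - 2 * cos t / q k = 4 * (sin (pi / (2 * N)))\<^sup>2 / q k"
      using hc by (simp add: diff_divide_distrib[symmetric])
    finally show ?thesis .
  qed
  have eqs: "{..<N} = insert 0 {1..<N}" using N by auto
  have A: "(\<Sum>k<N. (F k)\<^sup>2 * \<alpha> k) = (\<Sum>k=1..<N. (F k)\<^sup>2 * \<alpha> k)"
    unfolding eqs by (simp add: F0)
  have B: "(\<Sum>k<N. (F (Suc k))\<^sup>2 * \<beta> (Suc k)) = (\<Sum>k=1..<N. (F k)\<^sup>2 * \<beta> k)"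
  proof -
    have "(\<Sum>k<N. (F (Suc k))\<^sup>2 * \<beta> (Suc k)) = (\<Sum>k=1..<Suc N. (F k)\<^sup>2 * \<beta> k)"
      unfolding lessThan_atLeast0 One_nat_def sum.shift_bounds_Suc_ivl ..
    also have "\<dots> = (\<Sum>k=1..<N. (F k)\<^sup>2 * \<beta> k)"
      using N by (simp add: FN)
    finally show ?thesis .
  qed
  have "4 * (sin (pi / (2 * N)))\<^sup>2 * (\<Sum>k=1..<N. (F k)\<^sup>2 / q k)
      = (\<Sum>k=1..<N. (F k)\<^sup>2 * (4 * (sin (pi / (2 * N)))\<^sup>2 / q k))"
    by (simp add: sum_distrib_left mult_ac)
  also have "\<dots> \<le> (\<Sum>k=1..<N. (F k)\<^sup>2 * (\<alpha> k + \<beta> k))"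
    using node by (intro sum_mono mult_left_mono) auto
  also have "\<dots> = (\<Sum>k<N. (F k)\<^sup>2 * \<alpha> k + (F (Suc k))\<^sup>2 * \<beta> (Suc k))"
    by (simp only: sum.distrib A B distrib_left)
  also have "\<dots> \<le> (\<Sum>k<N. (F (Suc k) - F k)\<^sup>2 / p k)"
    using edge by (intro sum_mono) auto
  finally show ?thesis by (simp add: q_def)
qed

text \<open>The partial sums \<open>F\<close> of the terms p k v k vanish at both ends, at N because
  of \<open>mean\<close>. Passing from \<open>v\<close> to this flux turns a Neumann problem into
  the Dirichlet problem just solved; summation by parts leads back to the differences of
  \<open>v\<close>.\<close>

lemma discrete_weighted_poincare:
  fixes p v :: "nat \<Rightarrow> real"
  assumes N: "N \<ge> 2" and pos: "\<And>k. k < N \<Longrightarrow> p k > 0"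
    and lc: "\<And>k. k + 2 < N \<Longrightarrow> p k * p (k + 2) \<le> (p (k + 1))\<^sup>2"
    and mean: "(\<Sum>k<N. p k * v k) = 0"
  shows "4 * (sin (pi / (2 * N)))\<^sup>2 * (\<Sum>k<N. p k * (v k)\<^sup>2)
     \<le> (\<Sum>k=1..<N. sqrt (p (k - 1) * p k) * (v k - v (k - 1))\<^sup>2)"
proof -
  define F where "F k = (\<Sum>j<k. p j * v j)" for k
  define q where "q k = sqrt (p (k - 1) * p k)" for k
  define c where "c = 4 * (sin (pi / (2 * N)))\<^sup>2"
  define S where "S = (\<Sum>k<N. p k * (v k)\<^sup>2)"
  define T where "T = (\<Sum>k=1..<N. q k * (v k - v (k - 1))\<^sup>2)"
  have cpos: "c > 0"
  proof -
    have "sin (pi / (2 * N)) > 0"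
      using N by (intro sin_gt_zero) (auto simp: field_simps)
    then show ?thesis by (simp add: c_def)
  qed
  have qpos: "q k > 0" if "1 \<le> k" "k < N" for k
    using that pos[of k] pos[of "k-1"] by (simp add: q_def)
  have "c * (\<Sum>k=1..<N. (F k)\<^sup>2 / q k) \<le> (\<Sum>k<N. (F (Suc k) - F k)\<^sup>2 / p k)"
    unfolding c_def q_def
    by (rule discrete_dirichlet_wirtinger) (use N pos lc mean in \<open>auto simp: F_def\<close>)
  also have "\<dots> = S"
    unfolding S_def using pos by (intro sum.cong) (auto simp: F_def power_mult_distrib power2_eq_square)
  finally have 1: "c * (\<Sum>k=1..<N. (F k)\<^sup>2 / q k) \<le> S" .
  have abel: "(\<Sum>k<Suc n. p k * (v k)\<^sup>2) = F (Suc n) * v n - (\<Sum>k=1..<Suc n. F k * (v k - v (k-1)))" for n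
    by (induction n) (auto simp: F_def algebra_simps power2_eq_square)
  obtain n where n: "N = Suc n" using N by (cases N) auto
  have "S = - (\<Sum>k=1..<N. F k * (v k - v (k-1)))"
    using abel[of n] mean unfolding S_def n F_def by simp
  also have "\<dots> = (\<Sum>k=1..<N. - (F k * (v k - v (k-1))))" by (simp add: sum_negf)
  \<comment> \<open>Young's inequality with weight c / q k. By fact \<open>1\<close> the flux terms
    sum to at most S, so after halving they are absorbed on the left.\<close>
  also have "\<dots> \<le> (\<Sum>k=1..<N. (c * ((F k)\<^sup>2 / q k) + q k * (v k - v (k-1))\<^sup>2 / c) / 2)"
  proof (intro sum_mono)
    fix k assume k: "k \<in> {1..<N}"
    have "2 * (- F k) * (v k - v (k-1)) * 1 \<le> (c / q k) * (- F k)\<^sup>2 + (q k / c) * (v k - v (k-1))\<^sup>2"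
      using k cpos qpos[of k] by (intro weighted_sum_squares_ge) auto
    then show "- (F k * (v k - v (k-1))) \<le> (c * ((F k)\<^sup>2 / q k) + q k * (v k - v (k-1))\<^sup>2 / c) / 2"
      by simp
  qed
  also have "\<dots> = (c * (\<Sum>k=1..<N. (F k)\<^sup>2 / q k) + T / c) / 2"
    by (simp add: T_def sum.distrib sum_distrib_left sum_divide_distrib add_divide_distrib)
  also have "\<dots> \<le> (S + T / c) / 2" using 1 by simp
  finally have "S \<le> T / c" by simp
  then have "c * S \<le> T" using cpos by (simp add: field_simps)
  then show ?thesis unfolding c_def S_def T_def q_def .
qed

section \<open>Brunn--Minkowski inequality for midpoints\<close>

lemma null_sets_lborel_hyperplane:
  fixes a :: "'a::euclidean_space"
  assumes "a \<noteq> 0"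
  shows "{x. a \<bullet> x = c} \<in> null_sets lborel"
proof -
  have "{x. a \<bullet> x = c} \<in> sets lborel" by (simp add: borel_closed closed_hyperplane)
  moreover have "{x. a \<bullet> x = c} \<in> null_sets lebesgue"
    using negligible_hyperplane[of a c] assms by (simp add: negligible_iff_null_sets)
  ultimately show ?thesis by (simp add: null_sets_def)
qed

text \<open>Off the limiting hyperplane, which is null as its normal is nonzero, the indicators are
  eventually constant, so dominated convergence applies. The intermediate value theorem then finds
  cuts, both for translated and for rotated hyperplanes.\<close>

lemma continuous_on_halfspace_integral:
  fixes h :: "'a::euclidean_space \<Rightarrow> real" and a :: "real \<Rightarrow> 'a" and c :: "real \<Rightarrow> real"
  assumes h: "integrable lborel h"
    and a: "continuous_on UNIV a" and c: "continuous_on UNIV c" and a0: "\<And>t. a t \<noteq> 0"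
  shows "continuous_on UNIV (\<lambda>t. LINT x|lborel. indicator {x. a t \<bullet> x \<le> c t} x * h x)"
  unfolding continuous_on_sequentially comp_def
proof (intro allI ballI impI)
  fix X t assume "(\<forall>n. X n \<in> UNIV) \<and> X \<longlonglongrightarrow> (t::real)"
  then have X: "X \<longlonglongrightarrow> t" by auto
  have hm[measurable]: "h \<in> borel_measurable borel" using h by auto
  have [measurable]: "{x. a s \<bullet> x \<le> c s} \<in> sets borel" for s
    by (simp add: borel_closed closed_halfspace_le)
  show "(\<lambda>n. LINT x|lborel. indicator {x. a (X n) \<bullet> x \<le> c (X n)} x * h x)
    \<longlonglongrightarrow> (LINT x|lborel. indicator {x. a t \<bullet> x \<le> c t} x * h x)"
  proof (rule integral_dominated_convergence[where w = "\<lambda>x. \<bar>h x\<bar>"])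
    show "integrable lborel (\<lambda>x. \<bar>h x\<bar>)" using h by simp
    show "AE x in lborel. norm (indicator {x. a (X n) \<bullet> x \<le> c (X n)} x * h x) \<le> \<bar>h x\<bar>" for n
      by (auto simp: indicator_def)
    have aX: "(\<lambda>n. a (X n)) \<longlonglongrightarrow> a t" and cX: "(\<lambda>n. c (X n)) \<longlonglongrightarrow> c t"
      using a c X by (auto simp: continuous_on_sequentially comp_def)
    have "AE x in lborel. x \<notin> {x. a t \<bullet> x = c t}"
      using null_sets_lborel_hyperplane[OF a0, of t "c t"] by (rule AE_not_in)
    then show "AE x in lborel. (\<lambda>n. indicator {x. a (X n) \<bullet> x \<le> c (X n)} x * h x)
         \<longlonglongrightarrow> indicator {x. a t \<bullet> x \<le> c t} x * h x"
    proof (eventually_elim, intro tendsto_mult tendsto_const)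
      fix x assume "x \<notin> {x. a t \<bullet> x = c t}"
      then consider "a t \<bullet> x - c t < 0" | "a t \<bullet> x - c t > 0" by fastforce
      then show "(\<lambda>n. indicator {x. a (X n) \<bullet> x \<le> c (X n)} x) \<longlonglongrightarrow> (indicator {x. a t \<bullet> x \<le> c t} x :: real)"
      proof cases
        case 1
        have "(\<lambda>n. a (X n) \<bullet> x - c (X n)) \<longlonglongrightarrow> a t \<bullet> x - c t" by (intro tendsto_intros aX cX)
        then have "eventually (\<lambda>n. a (X n) \<bullet> x - c (X n) < 0) sequentially"
          using 1 by (rule order_tendstoD(2))
        then show ?thesis using 1 by (intro tendsto_eventually) (auto elim!: eventually_mono simp: indicator_def)
      next
        case 2
        have "(\<lambda>n. a (X n) \<bullet> x - c (X n)) \<longlonglongrightarrow> a t \<bullet> x - c t" by (intro tendsto_intros aX cX)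
        then have "eventually (\<lambda>n. a (X n) \<bullet> x - c (X n) > 0) sequentially"
          using 2 by (rule order_tendstoD(1))
        then show ?thesis using 2 by (intro tendsto_eventually) (auto elim!: eventually_mono simp: indicator_def)
      qed
    qed
  qed auto
qed

lemma integral_halfspace_split:
  fixes h :: "'a::euclidean_space \<Rightarrow> real"
  assumes h: "integrable lborel h" and a: "a \<noteq> 0"
  shows "(LINT x|lborel. h x) = (LINT x|lborel. indicator {x. a \<bullet> x \<le> c} x * h x)
       + (LINT x|lborel. indicator {x. a \<bullet> x \<ge> c} x * h x)"
proof -
  have [measurable]: "{x. a \<bullet> x \<le> c} \<in> sets borel" "{x. a \<bullet> x \<ge> c} \<in> sets borel"
    by (simp_all add: borel_closed closed_halfspace_le closed_halfspace_ge)
  have i: "integrable lborel (\<lambda>x. indicator {x. a \<bullet> x \<le> c} x * h x)"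
     "integrable lborel (\<lambda>x. indicator {x. a \<bullet> x \<ge> c} x * h x)"
    using h by (auto intro!: integrable_real_mult_indicator simp: mult.commute)
  have "AE x in lborel. x \<notin> {x. a \<bullet> x = c}"
    using null_sets_lborel_hyperplane[OF a, of c] by (rule AE_not_in)
  then have "AE x in lborel. h x = indicator {x. a \<bullet> x \<le> c} x * h x + indicator {x. a \<bullet> x \<ge> c} x * h x"
    by eventually_elim (auto simp: indicator_def)
  then have "(LINT x|lborel. h x) = (LINT x|lborel. indicator {x. a \<bullet> x \<le> c} x * h x + indicator {x. a \<bullet> x \<ge> c} x * h x)"
    using h i by (intro integral_cong_AE) auto
  then show ?thesis using i by simp
qed

lemma measure_halfspace_split:
  fixes C :: "'a::euclidean_space set"
  assumes C: "C \<in> fmeasurable lborel" and a: "a \<noteq> 0"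
  shows "measure lborel C = measure lborel (C \<inter> {x. a \<bullet> x \<le> c}) + measure lborel (C \<inter> {x. a \<bullet> x \<ge> c})"
proof -
  have "integrable lborel (indicator C :: 'a \<Rightarrow> real)"
    using C by (simp add: fmeasurable_def)
  from integral_halfspace_split[OF this a, of c] show ?thesis
    using C by (simp add: indicator_inter_arith[symmetric] Int_commute fmeasurable_def)
qed

lemma halfspace_proportion_exists:
  fixes B :: "'a::euclidean_space set"
  assumes B: "compact B" and a: "a \<noteq> 0" and p: "0 \<le> p" "p \<le> 1"
  obtains c where "measure lborel (B \<inter> {x. a \<bullet> x \<le> c}) = p * measure lborel B"
proof -
  have Bf: "B \<in> fmeasurable lborel" using B by (simp add: fmeasurable_compact)
  define \<phi> where "\<phi> c = measure lborel (B \<inter> {x. a \<bullet> x \<le> c})" for c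
  have \<phi>: "\<phi> c = (LINT x|lborel. indicator {x. a \<bullet> x \<le> c} x * indicator B x)" for c
    using Bf by (simp add: \<phi>_def indicator_inter_arith[symmetric] Int_commute fmeasurable_def)
  have cont: "continuous_on UNIV \<phi>"
    unfolding \<phi> using Bf a by (intro continuous_on_halfspace_integral) (auto simp: fmeasurable_def)
  have "bounded ((\<bullet>) a ` B)" using B by (intro compact_imp_bounded compact_continuous_image continuous_intros)
  then obtain D where D: "D > 0" "\<And>x. x \<in> B \<Longrightarrow> \<bar>a \<bullet> x\<bar> \<le> D"
    by (auto simp: bounded_pos)
  \<comment> \<open>The lower level is -(D + 1) because the closed half space at level -D could
    still touch B.\<close>
  have "B \<inter> {x. a \<bullet> x \<le> - (D + 1)} = {}" "B \<inter> {x. a \<bullet> x \<le> D} = B"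
    using D(2) D(1) by force+
  then have e: "\<phi> (- (D+1)) = 0" "\<phi> D = measure lborel B" unfolding \<phi>_def by auto
  have "\<exists>c\<ge>- (D+1). c \<le> D \<and> \<phi> c = p * measure lborel B"
    using p e D(1) by (intro IVT') (auto intro!: mult_left_le_one_le continuous_on_subset[OF cont])
  then show thesis using that unfolding \<phi>_def by blast
qed

text \<open>Boxes may be degenerate, so that the class is closed under cutting by half spaces.\<close>
definition box_union :: "nat \<Rightarrow> 'a::euclidean_space set \<Rightarrow> bool" where
  "box_union n A \<longleftrightarrow> (\<exists>\<D>. finite \<D> \<and> card \<D> \<le> n \<and> A = \<Union>\<D> \<and> (\<forall>Q\<in>\<D>. \<exists>a b. Q = cbox a b)
     \<and> pairwise (\<lambda>P Q. interior P \<inter> interior Q = {}) \<D>)"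

lemma box_union_compact: "box_union n A \<Longrightarrow> compact A"
  unfolding box_union_def by (auto intro!: compact_Union)

lemma cbox_Int_halfspace:
  fixes i :: "'a::euclidean_space"
  assumes i: "i \<in> Basis"
  shows "\<exists>a' b'. cbox a b \<inter> {x. i \<bullet> x \<le> c} = cbox a' b'"
    and "\<exists>a' b'. cbox a b \<inter> {x. i \<bullet> x \<ge> c} = cbox a' b'"
  by (simp_all only: inner_commute[of i] interval_split[OF i]) blast+

lemma box_union_Int:
  assumes \<D>: "finite \<D>" "card \<D> \<le> n" "\<forall>Q\<in>\<D>. \<exists>a b. Q = cbox a b"
    "pairwise (\<lambda>P Q. interior P \<inter> interior Q = {}) \<D>"
    and H: "\<And>a b. \<exists>a' b'. cbox a b \<inter> H = cbox a' b'"
  shows "box_union n (\<Union>\<D> \<inter> H)"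
  unfolding box_union_def
proof (rule exI[of _ "(\<lambda>Q. Q \<inter> H) ` \<D>"], intro conjI ballI)
  show "finite ((\<lambda>Q. Q \<inter> H) ` \<D>)" using \<D> by simp
  show "card ((\<lambda>Q. Q \<inter> H) ` \<D>) \<le> n" by (rule order_trans[OF card_image_le \<D>(2)]) (rule \<D>(1))
  show "\<exists>a b. Q = cbox a b" if Q: "Q \<in> (\<lambda>Q. Q \<inter> H) ` \<D>" for Q
  proof -
    obtain P where P: "P \<in> \<D>" "Q = P \<inter> H" using Q by blast
    then obtain a b where "P = cbox a b" using \<D>(3) by blast
    then show ?thesis using P(2) H by simp
  qed
  show "pairwise (\<lambda>P Q. interior P \<inter> interior Q = {}) ((\<lambda>Q. Q \<inter> H) ` \<D>)"
    using \<D>(4) unfolding pairwise_def by (auto simp: interior_Int)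
qed auto

lemma box_union_Int_halfspace:
  assumes A: "box_union n A" and i: "i \<in> Basis"
  shows "box_union n (A \<inter> {x. i \<bullet> x \<le> c})" "box_union n (A \<inter> {x. i \<bullet> x \<ge> c})"
proof -
  obtain \<D> where \<D>: "finite \<D>" "card \<D> \<le> n" "A = \<Union>\<D>" "\<forall>Q\<in>\<D>. \<exists>a b. Q = cbox a b"
     "pairwise (\<lambda>P Q. interior P \<inter> interior Q = {}) \<D>"
    using A unfolding box_union_def by blast
  show "box_union n (A \<inter> {x. i \<bullet> x \<le> c})" "box_union n (A \<inter> {x. i \<bullet> x \<ge> c})"
    unfolding \<D>(3)
    by (rule box_union_Int[OF \<D>(1,2,4,5)], rule cbox_Int_halfspace[OF i])+
qed

text \<open>This feeds the induction on the number of boxes: either a box of volume zero is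
  discarded, or a coordinate hyperplane separates two boxes S and T. In the second case each side
  can omit the box lying on the other side, which loses only a part of the null hyperplane; hence
  both pieces have a box less.\<close>

lemma box_union_cut:
  assumes A: "box_union (Suc (Suc n)) A"
  shows "(\<exists>A'. box_union (Suc n) A' \<and> A' \<subseteq> A \<and> measure lborel A \<le> measure lborel A') \<or>
    (\<exists>i\<in>Basis. \<exists>c A1 A2. box_union (Suc n) A1 \<and> box_union (Suc n) A2 
        \<and> A1 \<subseteq> A \<inter> {x. i \<bullet> x \<le> c} \<and> A2 \<subseteq> A \<inter> {x. i \<bullet> x \<ge> c}
        \<and> measure lborel A \<le> measure lborel A1 + measure lborel A2)"
proof -
  obtain \<D> where \<D>: "finite \<D>" "card \<D> \<le> Suc (Suc n)" "A = \<Union>\<D>" "\<forall>Q\<in>\<D>. \<exists>a b. Q = cbox a b"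
     "pairwise (\<lambda>P Q. interior P \<inter> interior Q = {}) \<D>"
    using A unfolding box_union_def by blast
  have sub: "finite (\<D> - {Q})" "card (\<D> - {Q}) \<le> Suc n" "\<forall>P\<in>\<D> - {Q}. \<exists>a b. P = cbox a b"
     "pairwise (\<lambda>P Q. interior P \<inter> interior Q = {}) (\<D> - {Q})" if "Q \<in> \<D>" for Q
    using \<D> that by (auto simp: card_Diff_singleton pairwise_def)
  have fm: "Q \<in> fmeasurable lborel" if "compact Q" for Q :: "'a set"
    using that by (simp add: fmeasurable_compact)
  have Acomp: "compact A" using A by (rule box_union_compact)
  consider (small) "card \<D> \<le> Suc n" | (large) "card \<D> = Suc (Suc n)" using \<D>(2) by linarith
  then show ?thesis
  proof cases
    case small
    then have "box_union (Suc n) A" unfolding box_union_def using \<D> by blast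
    then show ?thesis by blast
  next
    case large
    then obtain P Q where PQ: "P \<in> \<D>" "Q \<in> \<D>" "P \<noteq> Q"
      by (metis card_le_Suc0_iff_eq \<D>(1) not_less_eq_eq Suc_le_mono le0 le_refl)
    obtain a b where P: "P = cbox a b" using \<D>(4) PQ by blast
    obtain c d where Q: "Q = cbox c d" using \<D>(4) PQ by blast
    have degenerate: ?thesis if "S \<in> \<D>" "measure lborel S = 0" for S
    proof -
      have bu: "box_union (Suc n) (\<Union>(\<D> - {S}))"
        using sub[OF that(1)] unfolding box_union_def by blast
      have "compact S" using \<D>(4) that by auto
      have "A \<subseteq> S \<union> \<Union>(\<D> - {S})" using \<D>(3) by auto
      then have "measure lborel A \<le> measure lborel (S \<union> \<Union>(\<D> - {S}))"
        using fm[OF \<open>compact S\<close>] fm[OF box_union_compact[OF bu]] fm[OF Acomp]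
        by (intro measure_mono_fmeasurable) (auto simp: fmeasurableD)
      also have "\<dots> \<le> measure lborel S + measure lborel (\<Union>(\<D> - {S}))"
        using fm[OF \<open>compact S\<close>] fm[OF box_union_compact[OF bu]] by (intro measure_Un_le) (auto simp: fmeasurableD)
      finally show ?thesis using bu that(2) \<D>(3) by (metis add_0 Union_mono Diff_subset)
    qed
    have cut: ?thesis if i: "i \<in> Basis" and S: "S \<in> \<D>" "S \<subseteq> {x. i \<bullet> x \<le> t}"
       and T: "T \<in> \<D>" "T \<subseteq> {x. i \<bullet> x \<ge> t}" for i t S T
    proof -
      define A1 where "A1 = \<Union>(\<D> - {T}) \<inter> {x. i \<bullet> x \<le> t}"
      define A2 where "A2 = \<Union>(\<D> - {S}) \<inter> {x. i \<bullet> x \<ge> t}"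
      have i0: "i \<noteq> 0" using i by auto
      have b: "box_union (Suc n) A1" "box_union (Suc n) A2"
        unfolding A1_def A2_def using sub[OF S(1)] sub[OF T(1)] i
        by (auto intro!: box_union_Int cbox_Int_halfspace)
      have null: "{x. i \<bullet> x = t} \<in> null_sets lborel" using null_sets_lborel_hyperplane i0 by blast
      have "A \<subseteq> (A1 \<union> A2) \<union> {x. i \<bullet> x = t}"
        unfolding A1_def A2_def \<D>(3) using S T by fastforce
      moreover have fa: "A1 \<union> A2 \<in> fmeasurable lborel"
        using b by (intro fm compact_Un box_union_compact)
      moreover have fn: "{x. i \<bullet> x = t} \<in> fmeasurable lborel" using null by (rule fmeasurableI_null_sets)
      ultimately have "measure lborel A \<le> measure lborel ((A1 \<union> A2) \<union> {x. i \<bullet> x = t})"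
        using fm[OF Acomp] by (intro measure_mono_fmeasurable) (auto simp: fmeasurableD)
      also have "\<dots> = measure lborel (A1 \<union> A2)"
        using fa null by (intro measure_Un_null_set fmeasurableD)
      also have "\<dots> \<le> measure lborel A1 + measure lborel A2"
        using b by (intro measure_Un_le fmeasurableD fm box_union_compact)
      finally have "measure lborel A \<le> measure lborel A1 + measure lborel A2" .
      moreover have "A1 \<subseteq> A \<inter> {x. i \<bullet> x \<le> t}" "A2 \<subseteq> A \<inter> {x. i \<bullet> x \<ge> t}"
        unfolding A1_def A2_def \<D>(3) by auto
      ultimately show ?thesis using b i by blast
    qed
    have "box a b \<inter> box c d = {}"
      using pairwiseD[OF \<D>(5) PQ] unfolding P Q by simp
    \<comment> \<open>Two boxes with disjoint interiors have a coordinate that separates them or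
      shows that one of them has volume zero.\<close>
    then obtain i where i: "i \<in> Basis" and alt: "b \<bullet> i \<le> a \<bullet> i \<or> d \<bullet> i \<le> c \<bullet> i \<or> b \<bullet> i \<le> c \<bullet> i \<or> d \<bullet> i \<le> a \<bullet> i"
      unfolding disjoint_interval(4) by blast
    have deg0: "measure lborel (cbox x y) = 0" if "y \<bullet> i \<le> x \<bullet> i" for x y :: 'a
    proof -
      have "y \<bullet> i = x \<bullet> i" if "\<forall>j\<in>Basis. x \<bullet> j \<le> y \<bullet> j"
        using that i \<open>y \<bullet> i \<le> x \<bullet> i\<close> by force
      then show ?thesis using i by (auto simp: measure_lborel_cbox_eq inner_diff_left intro!: prod_zero)
    qed
    have up: "cbox x y \<subseteq> {z. i \<bullet> z \<le> t}" if "y \<bullet> i \<le> t" for x y t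
      using i that order_trans by (fastforce simp: mem_box inner_commute[of i])
    have low: "cbox x y \<subseteq> {z. i \<bullet> z \<ge> t}" if "t \<le> x \<bullet> i" for x y t
      using i that order_trans by (fastforce simp: mem_box inner_commute[of i])
    from alt consider "b \<bullet> i \<le> a \<bullet> i" | "d \<bullet> i \<le> c \<bullet> i" | "b \<bullet> i \<le> c \<bullet> i" | "d \<bullet> i \<le> a \<bullet> i" by blast
    then show ?thesis
    proof cases
      case 1 then show ?thesis using degenerate[of P] deg0 PQ P by blast
    next
      case 2 then show ?thesis using degenerate[of Q] deg0 PQ Q by blast
    next
      case 3
      have "P \<subseteq> {x. i \<bullet> x \<le> c \<bullet> i}" "Q \<subseteq> {x. i \<bullet> x \<ge> c \<bullet> i}"
        using 3 up low unfolding P Q by auto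
      then show ?thesis using cut[OF i] PQ by blast
    next
      case 4
      have "Q \<subseteq> {x. i \<bullet> x \<le> a \<bullet> i}" "P \<subseteq> {x. i \<bullet> x \<ge> a \<bullet> i}"
        using 4 up low unfolding P Q by auto
      then show ?thesis using cut[OF i] PQ by blast
    qed
  qed
qed

lemma box_union_one:
  assumes "box_union 1 A" obtains a b where "A = cbox a b"
proof -
  obtain \<D> where \<D>: "finite \<D>" "card \<D> \<le> 1" "A = \<Union>\<D>" "\<forall>Q\<in>\<D>. \<exists>a b. Q = cbox a b"
    using assms unfolding box_union_def by blast
  show thesis
  proof (cases "\<D> = {}")
    case True
    then have "A = cbox One (0 :: 'a)" using \<D>(3) empty_as_interval by simp
    then show thesis using that by blast
  next
    case False
    then have "card \<D> = 1" using \<D> by (metis One_nat_def card_0_eq le_Suc_eq le_zero_eq)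
    then obtain Q where "\<D> = {Q}" by (auto simp: card_1_singleton_iff)
    then show thesis using that \<D> by auto
  qed
qed

text \<open>In the multiplicative form the inequality splits into one arithmetic-geometric mean
  inequality per coordinate. Admitting any measurable \<open>C\<close> that contains the midpoints
  avoids the question whether the set of midpoints is itself measurable.\<close>

lemma brunn_minkowski_boxes:
  fixes a b c d :: "'a::euclidean_space"
  assumes C: "C \<in> fmeasurable lborel"
    and mid: "\<And>x y. x \<in> cbox a b \<Longrightarrow> y \<in> cbox c d \<Longrightarrow> midpoint x y \<in> C"
  shows "measure lborel (cbox a b) * measure lborel (cbox c d) \<le> (measure lborel C)\<^sup>2"
proof (cases "cbox a b = {} \<or> cbox c d = {}")
  case False
  then have le: "\<And>i. i \<in> Basis \<Longrightarrow> a \<bullet> i \<le> b \<bullet> i" "\<And>i. i \<in> Basis \<Longrightarrow> c \<bullet> i \<le> d \<bullet> i"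
    by (auto simp: box_ne_empty)
  define m where "m = cbox (midpoint a c) (midpoint b d)"
  have "m \<subseteq> C"
  proof
    fix z assume z: "z \<in> m"
    \<comment> \<open>The relative position of z along side i of the midpoint box; taking the same
      position in both given boxes produces points with midpoint z. A side of length zero gets
      position 0.\<close>
    define w where "w i = (if b \<bullet> i + d \<bullet> i - a \<bullet> i - c \<bullet> i = 0 then 0 else (2 * (z \<bullet> i) - a \<bullet> i - c \<bullet> i) / (b \<bullet> i + d \<bullet> i - a \<bullet> i - c \<bullet> i))" for i
    define x where "x = (\<Sum>i\<in>Basis. (a \<bullet> i + w i * (b \<bullet> i - a \<bullet> i)) *\<^sub>R i)"
    define y where "y = (\<Sum>i\<in>Basis. (c \<bullet> i + w i * (d \<bullet> i - c \<bullet> i)) *\<^sub>R i)"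
    have zi: "a \<bullet> i + c \<bullet> i \<le> 2 * (z \<bullet> i)" "2 * (z \<bullet> i) \<le> b \<bullet> i + d \<bullet> i" if "i \<in> Basis" for i
      using z that unfolding m_def by (force simp: mem_box midpoint_def inner_add_left inner_diff_left)+
    have wi: "0 \<le> w i" "w i \<le> 1" "w i * (b \<bullet> i + d \<bullet> i - a \<bullet> i - c \<bullet> i) = 2 * (z \<bullet> i) - a \<bullet> i - c \<bullet> i" if "i \<in> Basis" for i
      using zi[OF that] le[OF that] unfolding w_def by (auto simp: divide_simps)
    have "x \<in> cbox a b" "y \<in> cbox c d"
      unfolding x_def y_def using wi le
      by (auto simp: mem_box inner_sum_left_Basis mult_left_le_one_le)
         (smt (verit) mult_left_le_one_le diff_ge_0_iff_ge)+
    moreover have "midpoint x y = z"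
    proof (rule euclidean_eqI)
      fix i :: 'a assume i: "i \<in> Basis"
      have "2 * (midpoint x y \<bullet> i) = x \<bullet> i + y \<bullet> i" by (simp add: midpoint_def inner_add_left)
      also have "\<dots> = a \<bullet> i + c \<bullet> i + w i * (b \<bullet> i + d \<bullet> i - a \<bullet> i - c \<bullet> i)"
        using i unfolding x_def y_def inner_sum_left_Basis[OF i] by (simp add: algebra_simps)
      finally show "midpoint x y \<bullet> i = z \<bullet> i" using wi(3)[OF i] by simp
    qed
    ultimately show "z \<in> C" using mid by metis
  qed
  then have mC: "measure lborel m \<le> measure lborel C"
    unfolding m_def using C by (intro measure_mono_fmeasurable) auto
  have mle: "\<And>i. i \<in> Basis \<Longrightarrow> midpoint a c \<bullet> i \<le> midpoint b d \<bullet> i"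
    using le by (auto simp: midpoint_def inner_add_left add_mono)
  have "measure lborel (cbox a b) * measure lborel (cbox c d) = (\<Prod>i\<in>Basis. ((b - a) \<bullet> i) * ((d - c) \<bullet> i))"
    using le by (simp add: measure_lborel_cbox_eq prod.distrib)
  also have "\<dots> \<le> (\<Prod>i\<in>Basis. ((midpoint b d - midpoint a c) \<bullet> i)\<^sup>2)"
  proof (rule prod_mono)
    fix i :: 'a assume i: "i \<in> Basis"
    define p q where "p = (b - a) \<bullet> i" and "q = (d - c) \<bullet> i"
    have pq: "p \<ge> 0" "q \<ge> 0" using le[OF i] by (auto simp: p_def q_def inner_diff_left)
    have mid: "(midpoint b d - midpoint a c) \<bullet> i = (p + q) / 2"
      by (simp add: midpoint_def p_def q_def inner_add_left inner_diff_left field_simps)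
    have "p * q \<le> ((p + q) / 2)\<^sup>2"
      using sum_squares_ge_zero[of "p - q" 0] by (simp add: power2_eq_square field_simps)
    then show "0 \<le> ((b - a) \<bullet> i) * ((d - c) \<bullet> i) \<and> ((b - a) \<bullet> i) * ((d - c) \<bullet> i) \<le> ((midpoint b d - midpoint a c) \<bullet> i)\<^sup>2"
      using pq unfolding mid p_def[symmetric] q_def[symmetric] by simp
  qed
  also have "\<dots> = (measure lborel m)\<^sup>2"
    unfolding m_def using mle by (simp add: measure_lborel_cbox_eq prod_power_distrib)
  also have "\<dots> \<le> (measure lborel C)\<^sup>2" using mC by (intro power_mono) auto
  finally show ?thesis .
qed auto

text \<open>The Hadwiger--Ohmann step: cut \<open>B\<close> in the same proportion as \<open>A\<close>; the midpoints of the two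
  pairs of pieces are separated by a hyperplane.\<close>
lemma brunn_minkowski_combine:
  fixes A B :: "'a::euclidean_space set"
  assumes C: "C \<in> fmeasurable lborel" and B: "compact B" and i: "i \<noteq> 0"
    and mid: "\<And>x y. x \<in> A \<Longrightarrow> y \<in> B \<Longrightarrow> midpoint x y \<in> C"
    and A1: "A1 \<subseteq> A \<inter> {x. i \<bullet> x \<le> c}" and A2: "A2 \<subseteq> A \<inter> {x. i \<bullet> x \<ge> c}"
    and A12: "measure lborel A \<le> measure lborel A1 + measure lborel A2"
    and IH1: "\<And>c' C'. C' \<in> fmeasurable lborel \<Longrightarrow> (\<And>x y. x \<in> A1 \<Longrightarrow> y \<in> B \<inter> {x. i \<bullet> x \<le> c'} \<Longrightarrow> midpoint x y \<in> C')
       \<Longrightarrow> measure lborel A1 * measure lborel (B \<inter> {x. i \<bullet> x \<le> c'}) \<le> (measure lborel C')\<^sup>2"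
    and IH2: "\<And>c' C'. C' \<in> fmeasurable lborel \<Longrightarrow> (\<And>x y. x \<in> A2 \<Longrightarrow> y \<in> B \<inter> {x. i \<bullet> x \<ge> c'} \<Longrightarrow> midpoint x y \<in> C')
       \<Longrightarrow> measure lborel A2 * measure lborel (B \<inter> {x. i \<bullet> x \<ge> c'}) \<le> (measure lborel C')\<^sup>2"
  shows "measure lborel A * measure lborel B \<le> (measure lborel C)\<^sup>2"
proof -
  define s where "s = measure lborel A1 + measure lborel A2"
  show ?thesis
  proof (cases "s = 0")
    case True
    then have "measure lborel A = 0" using A12 measure_nonneg[of lborel A] unfolding s_def by linarith
    then show ?thesis by simp
  next
    case False
    then have s: "s > 0" unfolding s_def by (metis add_nonneg_nonneg measure_nonneg order_le_less)
    define p where "p = measure lborel A1 / s"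
    have p: "0 \<le> p" "p \<le> 1" using s unfolding p_def by (auto simp: s_def field_simps)
    have pA: "measure lborel A1 = p * s" "measure lborel A2 = (1 - p) * s"
      using s by (auto simp: p_def field_simps s_def)
    obtain c' where c': "measure lborel (B \<inter> {x. i \<bullet> x \<le> c'}) = p * measure lborel B"
      using halfspace_proportion_exists[OF B i p] by blast
    then have c'': "measure lborel (B \<inter> {x. i \<bullet> x \<ge> c'}) = (1 - p) * measure lborel B"
      using measure_halfspace_split[OF fmeasurable_compact[OF B] i, of c'] by (simp add: algebra_simps)
    \<comment> \<open>Midpoints of the two lower pieces lie below the average of the two cutting
      levels, those of the upper pieces above it.\<close>
    define C1 C2 where "C1 = C \<inter> {x. i \<bullet> x \<le> (c + c') / 2}" and "C2 = C \<inter> {x. i \<bullet> x \<ge> (c + c') / 2}"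
    have meas: "{x. i \<bullet> x \<le> (c + c') / 2} \<in> sets lborel" "{x. i \<bullet> x \<ge> (c + c') / 2} \<in> sets lborel"
      by (simp_all add: borel_closed closed_halfspace_le closed_halfspace_ge)
    have Cf: "C1 \<in> fmeasurable lborel" "C2 \<in> fmeasurable lborel"
      unfolding C1_def C2_def using C meas by (auto intro: fmeasurable_Int_fmeasurable)
    have midi: "i \<bullet> midpoint x y = (i \<bullet> x + i \<bullet> y) / 2" for x y
      by (simp add: midpoint_def inner_add_right)
    have 1: "(p * s) * (p * measure lborel B) \<le> (measure lborel C1)\<^sup>2"
      unfolding pA(1)[symmetric] c'[symmetric]
      by (rule IH1[OF Cf(1)]) (use A1 mid in \<open>force simp: C1_def midi\<close>)
    have 2: "((1 - p) * s) * ((1 - p) * measure lborel B) \<le> (measure lborel C2)\<^sup>2"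
      unfolding pA(2)[symmetric] c''[symmetric]
      by (rule IH2[OF Cf(2)]) (use A2 mid in \<open>force simp: C2_def midi\<close>)
    \<comment> \<open>Since both sets are cut in the proportion p, the two induction hypotheses
      bound the pieces of \<open>C\<close> below by p r and (1 - p) r, which add up to r.\<close>
    define r where "r = sqrt (s * measure lborel B)"
    have r2: "r\<^sup>2 = s * measure lborel B" using s by (simp add: r_def)
    have "(p * r)\<^sup>2 \<le> (measure lborel C1)\<^sup>2"
      using 1 unfolding power_mult_distrib r2 by (simp add: power2_eq_square mult_ac)
    then have "p * r \<le> measure lborel C1" by (rule power2_le_imp_le) simp
    moreover have "((1 - p) * r)\<^sup>2 \<le> (measure lborel C2)\<^sup>2"
      using 2 unfolding power_mult_distrib r2 by (simp add: power2_eq_square mult_ac)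
    then have "(1 - p) * r \<le> measure lborel C2" by (rule power2_le_imp_le) simp
    ultimately have "r \<le> measure lborel C"
      using measure_halfspace_split[OF C i, of "(c + c') / 2"] unfolding C1_def C2_def by (simp add: algebra_simps)
    have "measure lborel A * measure lborel B \<le> s * measure lborel B"
      using A12 by (intro mult_right_mono) (auto simp: s_def)
    also have "\<dots> = r\<^sup>2" by (simp add: r2)
    also have "\<dots> \<le> (measure lborel C)\<^sup>2"
      using \<open>r \<le> measure lborel C\<close> s by (intro power_mono) (auto simp: r_def)
    finally show ?thesis .
  qed
qed

text \<open>Induction on the total number of boxes: a cut lowers the number for the set that is
  separated, while intersecting the other set with a half space does not raise its number. The base
  case is a pair of single boxes.\<close>

lemma brunn_minkowski_box_union:
  fixes A B :: "'a::euclidean_space set"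
  assumes "box_union (Suc n) A" "box_union (Suc m) B" "C \<in> fmeasurable lborel"
    and "\<And>x y. x \<in> A \<Longrightarrow> y \<in> B \<Longrightarrow> midpoint x y \<in> C"
  shows "measure lborel A * measure lborel B \<le> (measure lborel C)\<^sup>2"
  using assms
proof (induction "n + m" arbitrary: n m A B C rule: less_induct)
  case less
  \<comment> \<open>Taking the induction hypothesis as a premise lets the same argument serve when
    \<open>B\<close> is the set to be cut, with the roles exchanged.\<close>
  have step: "measure lborel A * measure lborel B \<le> (measure lborel C)\<^sup>2"
    if less_IH: "\<And>A' B' C' :: 'a set. box_union (Suc n') A' \<Longrightarrow> box_union (Suc m') B' \<Longrightarrow> C' \<in> fmeasurable lborel \<Longrightarrow>
       (\<And>x y. x \<in> A' \<Longrightarrow> y \<in> B' \<Longrightarrow> midpoint x y \<in> C') \<Longrightarrow> measure lborel A' * measure lborel B' \<le> (measure lborel C')\<^sup>2"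
    and A: "box_union (Suc (Suc n')) A" and B: "box_union (Suc m') B" and C: "C \<in> fmeasurable lborel"
    and mid: "\<And>x y. x \<in> A \<Longrightarrow> y \<in> B \<Longrightarrow> midpoint x y \<in> C"
    for A B C :: "'a set" and n' m'
    using box_union_cut[OF A]
  proof (elim disjE exE bexE conjE)
    fix A' assume A': "box_union (Suc n') A'" "A' \<subseteq> A" "measure lborel A \<le> measure lborel A'"
    have "measure lborel A * measure lborel B \<le> measure lborel A' * measure lborel B"
      using A'(3) by (intro mult_right_mono) auto
    also have "\<dots> \<le> (measure lborel C)\<^sup>2" using A' mid B C by (intro less_IH) auto
    finally show ?thesis .
  next
    fix i c A1 A2 assume i: "i \<in> Basis" and A': "box_union (Suc n') A1" "box_union (Suc n') A2"
       "A1 \<subseteq> A \<inter> {x. i \<bullet> x \<le> c}" "A2 \<subseteq> A \<inter> {x. i \<bullet> x \<ge> c}"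
       "measure lborel A \<le> measure lborel A1 + measure lborel A2"
    show ?thesis
    proof (rule brunn_minkowski_combine[OF C box_union_compact[OF B] _ mid A'(3-5)])
      show "i \<noteq> 0" using i by auto
    qed (assumption, assumption, erule less_IH[OF A'(1) box_union_Int_halfspace(1)[OF B i]], blast,
         erule less_IH[OF A'(2) box_union_Int_halfspace(2)[OF B i]], blast)
  qed
  consider (a) n' where "n = Suc n'" | (b) m' where "m = Suc m'" | (c) "n = 0" "m = 0"
    by (cases n; cases m) auto
  then show ?case
  proof cases
    case a
    show ?thesis
      by (rule step[of n' m], rule less.hyps[of n' m]) (use less.prems a in auto)
  next
    case b
    have "measure lborel B * measure lborel A \<le> (measure lborel C)\<^sup>2"
      by (rule step[of m' n], subst mult.commute, rule less.hyps[of n m'])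
         (use less.prems b in \<open>auto, (subst midpoint_sym, blast)+\<close>)
    then show ?thesis by (simp add: mult.commute)
  next
    case c
    then obtain a b p q where "A = cbox a b" "B = cbox p q"
      using less.prems by (metis One_nat_def box_union_one)
    then show ?thesis using brunn_minkowski_boxes[of C a b p q] less.prems by blast
  qed
qed

lemma open_box_union_approx:
  fixes S :: "'a::euclidean_space set"
  assumes "open S" "bounded S"
  obtains A where "\<And>n. box_union (Suc n) (A n)" "\<And>n. A n \<subseteq> S"
    "(\<lambda>n. measure lborel (A n)) \<longlonglongrightarrow> measure lborel S"
proof (cases "S = {}")
  case True
  have "box_union (Suc n) ({}::'a set)" for n
    unfolding box_union_def by (rule exI[of _ "{}"]) auto
  then show thesis using that[of "\<lambda>_. {}"] True by auto
next
  case False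
  obtain a where a: "S \<subseteq> cbox (-a) a" using bounded_subset_cbox_symmetric[OF assms(2)] by blast
  have h1: "box (- a - One) (a + One) \<noteq> {}"
  proof -
    obtain x where "x \<in> S" using False by blast
    then have "x \<in> box (- a - One) (a + One)" using a by (force simp: mem_box algebra_simps)
    then show ?thesis by blast
  qed
  have h2: "S \<subseteq> cbox (- a - One) (a + One)"
    using a by (force simp: mem_box algebra_simps)
  \<comment> \<open>Every box of the covering lemma has a tag in S, and at such a tag the gauge is S
    itself, so all boxes stay inside S.\<close>
  have h3: "gauge (\<lambda>x. if x \<in> S then S else UNIV)" using assms(1) by (auto simp: gauge_def)
  obtain \<D> where \<D>: "countable \<D>" "\<And>K. K \<in> \<D> \<Longrightarrow> interior K \<noteq> {} \<and> (\<exists>c d. K = cbox c d)"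
    "pairwise (\<lambda>A B. interior A \<inter> interior B = {}) \<D>"
    "\<And>K. K \<in> \<D> \<Longrightarrow> \<exists>x \<in> S \<inter> K. K \<subseteq> (if x \<in> S then S else UNIV)" "S \<subseteq> \<Union>\<D>"
    by (rule covering_lemma[OF h2 h1 h3]) blast
  have S: "S = \<Union>\<D>" using \<D>(4,5) by (fastforce split: if_splits)
  have ne: "\<D> \<noteq> {}" using False S by auto
  define A where "A n = \<Union>(from_nat_into \<D> ` {..n})" for n
  have sub: "from_nat_into \<D> ` {..n} \<subseteq> \<D>" for n using from_nat_into[OF ne] by auto
  have bu: "box_union (Suc n) (A n)" for n
    unfolding box_union_def
  proof (rule exI[of _ "from_nat_into \<D> ` {..n}"], intro conjI ballI)
    show "card (from_nat_into \<D> ` {..n}) \<le> Suc n"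
      using card_image_le[of "{..n}" "from_nat_into \<D>"] by simp
    show "pairwise (\<lambda>P Q. interior P \<inter> interior Q = {}) (from_nat_into \<D> ` {..n})"
      by (rule pairwise_subset[OF \<D>(3) sub])
    show "\<exists>a b. Q = cbox a b" if "Q \<in> from_nat_into \<D> ` {..n}" for Q
      using that sub \<D>(2) by blast
  qed (auto simp: A_def)
  have US: "(\<Union>n. A n) = S"
  proof -
    have "(\<Union>n. A n) = \<Union>(range (from_nat_into \<D>))" by (auto simp: A_def)
    then show ?thesis using S ne \<D>(1) by (simp add: range_from_nat_into)
  qed
  have "(\<lambda>n. measure lborel (A n)) \<longlonglongrightarrow> measure lborel (\<Union>n. A n)"
  proof (rule Lim_measure_incseq)
    show "range A \<subseteq> sets lborel" using bu box_union_compact by (auto intro: borel_compact)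
    show "incseq A" by (force simp: incseq_def A_def)
    show "emeasure lborel (\<Union>n. A n) \<noteq> \<infinity>" unfolding US
      using emeasure_bounded_finite[OF assms(2)] by auto
  qed
  then show thesis using that[of A] bu US by blast
qed

text \<open>The interiors are exhausted from inside by unions of boxes, so midpoints remain in
  \<open>C\<close>. Convexity makes the frontiers null, and no volume is lost in passing to the
  interiors.\<close>

theorem brunn_minkowski_midpoint:
  fixes A B :: "'a::euclidean_space set"
  assumes A: "compact A" "convex A" and B: "compact B" "convex B" and C: "C \<in> fmeasurable lborel"
    and mid: "\<And>x y. x \<in> A \<Longrightarrow> y \<in> B \<Longrightarrow> midpoint x y \<in> C"
  shows "measure lborel A * measure lborel B \<le> (measure lborel C)\<^sup>2"
proof -
  have int: "measure lborel (interior S) = measure lborel S" if "compact S" "convex S" for S :: "'a set"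
  proof -
    have "measure lebesgue (interior S) = measure lebesgue S"
      using that by (intro measure_interior negligible_convex_frontier compact_imp_bounded)
    then show ?thesis using that by (simp add: measure_completion borel_compact)
  qed
  obtain A' where A': "\<And>n. box_union (Suc n) (A' n)" "\<And>n. A' n \<subseteq> interior A"
    "(\<lambda>n. measure lborel (A' n)) \<longlonglongrightarrow> measure lborel (interior A)"
    using open_box_union_approx[of "interior A"] A
    by (metis bounded_subset compact_imp_bounded interior_subset open_interior)
  obtain B' where B': "\<And>n. box_union (Suc n) (B' n)" "\<And>n. B' n \<subseteq> interior B"
    "(\<lambda>n. measure lborel (B' n)) \<longlonglongrightarrow> measure lborel (interior B)"
    using open_box_union_approx[of "interior B"] B
    by (metis bounded_subset compact_imp_bounded interior_subset open_interior)
  have "(\<lambda>n. measure lborel (A' n) * measure lborel (B' n)) \<longlonglongrightarrow> measure lborel A * measure lborel B"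
    using tendsto_mult[OF A'(3) B'(3)] int[OF A] int[OF B] by simp
  moreover have "measure lborel (A' n) * measure lborel (B' n) \<le> (measure lborel C)\<^sup>2" for n
  proof (rule brunn_minkowski_box_union[OF A'(1) B'(1) C])
    show "midpoint x y \<in> C" if "x \<in> A' n" "y \<in> B' n" for x y
      using that mid A'(2) B'(2) interior_subset by blast
  qed
  ultimately show ?thesis by (intro LIMSEQ_le_const2) auto
qed

section \<open>Localization of convex bodies\<close>

definition convex_body :: "'a::euclidean_space set \<Rightarrow> bool" where
  "convex_body K \<longleftrightarrow> compact K \<and> convex K \<and> interior K \<noteq> {}"

lemma integrable_indicator_mult:
  fixes h :: "'a::euclidean_space \<Rightarrow> real"
  assumes "integrable lborel h" "compact K"
  shows "integrable lborel (\<lambda>x. indicator K x * h x)"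
  using assms by (auto intro!: integrable_real_mult_indicator borel_compact simp: mult.commute)

text \<open>The cutting hyperplane is found by rotating one about the flat \<open>x\<^sub>i = r\<close>, \<open>x\<^sub>j = s\<close>.\<close>
lemma bisect_through_flat:
  fixes f g :: "'a::euclidean_space \<Rightarrow> real"
  assumes f: "integrable lborel f" and g: "integrable lborel g" and K: "convex_body K"
    and f0: "(LINT x|lborel. indicator K x * f x) = 0" and g0: "(LINT x|lborel. indicator K x * g x) > 0"
    and ij: "i \<in> Basis" "j \<in> Basis" "i \<noteq> j" and q: "q \<in> interior K"
  obtains K' where "convex_body K'" "K' \<subseteq> K" "(LINT x|lborel. indicator K' x * f x) = 0"
    "(LINT x|lborel. indicator K' x * g x) > 0"
    "\<And>x. x \<in> interior K' \<Longrightarrow> (x \<bullet> i, x \<bullet> j) \<noteq> (q \<bullet> i, q \<bullet> j)"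
proof -
  define a where "a t = cos t *\<^sub>R i + sin t *\<^sub>R j" for t
  define c where "c t = a t \<bullet> q" for t
  have inn: "i \<bullet> i = 1" "j \<bullet> j = 1" "i \<bullet> j = 0" "j \<bullet> i = 0" using ij by (auto simp: inner_Basis)
  have a1: "a t \<bullet> a t = 1" for t
    by (simp add: a_def inner_add_left inner_add_right inn power2_eq_square[symmetric])
  have a0: "a t \<noteq> 0" for t using a1[of t] by auto
  have comp: "compact K" "convex K" using K by (auto simp: convex_body_def)
  have fi: "integrable lborel (\<lambda>x. indicator K x * f x)" and gi: "integrable lborel (\<lambda>x. indicator K x * g x)"
    using f g comp by (auto intro: integrable_indicator_mult)
  define \<Phi> where "\<Phi> t = (LINT x|lborel. indicator {x. a t \<bullet> x \<le> c t} x * (indicator K x * f x))" for t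
  have cont: "continuous_on UNIV \<Phi>"
    unfolding \<Phi>_def by (rule continuous_on_halfspace_integral[OF fi _ _ a0])
       (auto simp: a_def c_def intro!: continuous_intros)
  \<comment> \<open>A half turn exchanges the two half spaces, so \<Phi> takes opposite values at 0
    and pi and has a zero between them.\<close>
  have "{x. a pi \<bullet> x \<le> c pi} = {x. a 0 \<bullet> x \<ge> c 0}" by (auto simp: a_def c_def)
  then have "\<Phi> 0 + \<Phi> pi = 0"
    using integral_halfspace_split[OF fi a0, of 0 "c 0"] f0 by (simp add: \<Phi>_def)
  then obtain t where t: "\<Phi> t = 0"
  proof (cases "\<Phi> 0 \<le> 0")
    case True
    then show thesis using that IVT'[of \<Phi> 0 0 pi] \<open>\<Phi> 0 + \<Phi> pi = 0\<close> continuous_on_subset[OF cont] by auto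
  next
    case False
    then show thesis using that IVT2'[of \<Phi> pi 0 0] \<open>\<Phi> 0 + \<Phi> pi = 0\<close> continuous_on_subset[OF cont] by auto
  qed
  define K1 K2 where "K1 = K \<inter> {x. a t \<bullet> x \<le> c t}" and "K2 = K \<inter> {x. a t \<bullet> x \<ge> c t}"
  have ind: "indicator {x. a t \<bullet> x \<le> c t} x * (indicator K x * h x) = indicator K1 x * h x"
     "indicator {x. a t \<bullet> x \<ge> c t} x * (indicator K x * h x) = indicator K2 x * h x" for x and h :: "'a \<Rightarrow> real"
    unfolding K1_def K2_def by (auto simp: indicator_def)
  have f1: "(LINT x|lborel. indicator K1 x * f x) = 0" using t by (simp add: \<Phi>_def ind)
  have f2: "(LINT x|lborel. indicator K2 x * f x) = 0"
    using integral_halfspace_split[OF fi a0, of t "c t"] f0 f1 by (simp add: ind)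
  have g12: "(LINT x|lborel. indicator K1 x * g x) > 0 \<or> (LINT x|lborel. indicator K2 x * g x) > 0"
    using integral_halfspace_split[OF gi a0, of t "c t"] g0 by (simp add: ind) linarith
  have int1: "interior K1 = interior K \<inter> {x. a t \<bullet> x < c t}"
    and int2: "interior K2 = interior K \<inter> {x. a t \<bullet> x > c t}"
    unfolding K1_def K2_def by (simp_all add: a0)
  obtain e where e: "e > 0" "cball q e \<subseteq> interior K"
    using q open_contains_cball open_interior by blast
  have na: "norm (a t) = 1" using a1[of t] by (simp add: norm_eq_1)
  have "q - e *\<^sub>R a t \<in> interior K1" "q + e *\<^sub>R a t \<in> interior K2"
    unfolding int1 int2 using e na a1[of t]
    by (auto simp: c_def inner_diff_right inner_add_right dist_norm subset_iff)
  then have "interior K1 \<noteq> {}" "interior K2 \<noteq> {}" by blast+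
  then have b: "convex_body K1" "convex_body K2"
    using comp unfolding convex_body_def K1_def K2_def
    by (auto intro!: compact_Int_closed convex_Int closed_halfspace_le closed_halfspace_ge convex_halfspace_le convex_halfspace_ge)
  have ne: "(x \<bullet> i, x \<bullet> j) \<noteq> (q \<bullet> i, q \<bullet> j)" if "x \<in> interior K1 \<union> interior K2" for x
    using that unfolding int1 int2
    by (auto simp: a_def c_def inner_add_left inner_commute[of i] inner_commute[of j])
  show thesis
    using g12
  proof
    assume "(LINT x|lborel. indicator K1 x * g x) > 0"
    then show thesis using that[of K1] b f1 ne by (auto simp: K1_def)
  next
    assume "(LINT x|lborel. indicator K2 x * g x) > 0"
    then show thesis using that[of K2] b f2 ne by (auto simp: K2_def)
  qed
qed

lemma open_real_prod_rational:
  fixes U :: "(real \<times> real) set"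
  assumes "open U" "U \<noteq> {}"
  obtains r s where "r \<in> \<rat>" "s \<in> \<rat>" "(r, s) \<in> U"
proof -
  obtain x y where xy: "(x, y) \<in> U" using assms(2) by auto
  obtain A B where AB: "open A" "open B" "x \<in> A" "y \<in> B" "A \<times> B \<subseteq> U"
    by (rule open_prod_elim[OF assms(1) xy]) auto
  have rat: "\<exists>r\<in>\<rat>. r \<in> A" if A: "open A" "x \<in> A" for A and x :: real
  proof -
    obtain e where e: "e > 0" "ball x e \<subseteq> A" using A open_contains_ball by blast
    obtain r where r: "r \<in> \<rat>" "x < r" "r < x + e" using Rats_dense_in_real[of x "x + e"] e(1) by auto
    then have "r \<in> ball x e" by (simp add: dist_real_def)
    then show ?thesis using r e by blast
  qed
  show thesis using rat[OF AB(1,3)] rat[OF AB(2,4)] AB(5) that by blast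
qed

text \<open>A convex planar set with empty interior lies on a line. Hence all 2 by 2 minors of any
  two difference vectors of S vanish, and all differences are parallel to one vector.\<close>

lemma collinear_if_planar_projections_thin:
  fixes S :: "'a::euclidean_space set"
  assumes S: "convex S"
    and thin: "\<And>i j. i \<in> Basis \<Longrightarrow> j \<in> Basis \<Longrightarrow> i \<noteq> j \<Longrightarrow> interior ((\<lambda>x. (x \<bullet> i, x \<bullet> j)) ` S) = {}"
  shows "collinear S"
proof -
  have par: "(d \<bullet> i) * (e \<bullet> j) = (d \<bullet> j) * (e \<bullet> i)"
    if ij: "i \<in> Basis" "j \<in> Basis" and d: "d = x - y" "x \<in> S" "y \<in> S" and e: "e = z - w" "z \<in> S" "w \<in> S"
    for i j d e x y z w
  proof (cases "i = j")
    case False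
    have lin: "linear (\<lambda>x. (x \<bullet> i, x \<bullet> j))"
      by (rule linearI) (auto simp: inner_add_left)
    obtain p b where p: "p \<noteq> 0" "(\<lambda>x. (x \<bullet> i, x \<bullet> j)) ` S \<subseteq> {x. p \<bullet> x = b}"
      using empty_interior_subset_hyperplane[OF convex_linear_image[OF lin S] thin[OF ij False]] by blast
    obtain \<alpha> \<beta> where ab: "p = (\<alpha>, \<beta>)" by force
    have on: "\<alpha> * (v \<bullet> i) + \<beta> * (v \<bullet> j) = b" if "v \<in> S" for v
      using p(2) that by (auto simp: ab)
    have d0: "\<alpha> * (d \<bullet> i) + \<beta> * (d \<bullet> j) = 0" and e0: "\<alpha> * (e \<bullet> i) + \<beta> * (e \<bullet> j) = 0"
      using on[of x] on[of y] on[of z] on[of w] d e by (auto simp: inner_diff_left algebra_simps)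
    \<comment> \<open>Both projected differences are orthogonal to the nonzero vector (\<alpha>,
      \<beta>), so their determinant is zero.\<close>
    have "\<alpha> * ((d \<bullet> i) * (e \<bullet> j) - (d \<bullet> j) * (e \<bullet> i)) = 0" "\<beta> * ((d \<bullet> i) * (e \<bullet> j) - (d \<bullet> j) * (e \<bullet> i)) = 0"
      using d0 e0 by algebra+
    then show ?thesis using p(1) ab by (auto simp: zero_prod_def)
  qed simp
  show ?thesis
  proof (cases "\<exists>x\<in>S. \<exists>y\<in>S. x \<noteq> y")
    case True
    then obtain x y where xy: "x \<in> S" "y \<in> S" "x \<noteq> y" by blast
    define u where "u = x - y"
    have "u \<noteq> 0" using xy by (simp add: u_def)
    then obtain i where i: "i \<in> Basis" "u \<bullet> i \<noteq> 0" using euclidean_all_zero_iff by blast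
    have "z - w = (((z - w) \<bullet> i) / (u \<bullet> i)) *\<^sub>R u" if "z \<in> S" "w \<in> S" for z w
    proof (rule euclidean_eqI)
      fix j :: 'a assume j: "j \<in> Basis"
      show "(z - w) \<bullet> j = ((((z - w) \<bullet> i) / (u \<bullet> i)) *\<^sub>R u) \<bullet> j"
        using par[OF i(1) j u_def xy(1,2) refl that] i(2) by (simp add: field_simps)
    qed
    then show ?thesis unfolding collinear_def by blast
  next
    case False
    then show ?thesis unfolding collinear_def by (metis diff_self scaleR_zero_left)
  qed
qed

text \<open>Cut successively through all flats \<open>x\<^sub>i = r\<close>, \<open>x\<^sub>j = s\<close> with rational \<open>r\<close>, \<open>s\<close>. Such a flat
  meets no interior point of the later bodies, so every planar coordinate projection of the
  intersection of the bodies has empty interior.\<close>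
theorem localization_to_segment:
  fixes f g :: "'a::euclidean_space \<Rightarrow> real"
  assumes f: "integrable lborel f" and g: "integrable lborel g" and K: "convex_body K"
    and f0: "(LINT x|lborel. indicator K x * f x) = 0" and g0: "(LINT x|lborel. indicator K x * g x) > 0"
    and e: "e > 0"
  obtains K' P Q where "convex_body K'" "K' \<subseteq> K" "(LINT x|lborel. indicator K' x * f x) = 0"
    "(LINT x|lborel. indicator K' x * g x) > 0"
    "\<And>x. x \<in> K' \<Longrightarrow> \<exists>z\<in>closed_segment P Q. dist x z < e"
proof -
  define T :: "('a \<times> 'a \<times> real \<times> real) set" where "T = Basis \<times> Basis \<times> \<rat> \<times> \<rat>"
  have T: "countable T" "T \<noteq> {}" unfolding T_def
    by (auto intro!: countable_SIGMA countable_rat simp: countable_finite)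
  define \<tau> where "\<tau> = from_nat_into T"
  define body where "body L \<longleftrightarrow> convex_body L \<and> L \<subseteq> K \<and> (LINT x|lborel. indicator L x * f x) = 0
     \<and> (LINT x|lborel. indicator L x * g x) > 0" for L
  define avoids where "avoids n L \<longleftrightarrow> (case \<tau> n of (i, j, r, s) \<Rightarrow> i \<noteq> j \<longrightarrow> (\<forall>x\<in>interior L. (x \<bullet> i, x \<bullet> j) \<noteq> (r, s)))" for n L
  have step: "\<exists>L'. body L' \<and> (L' \<subseteq> L \<and> avoids n L')" if L: "body L" for L n
  proof -
    obtain i j r s where n: "\<tau> n = (i, j, r, s)" by (metis surj_pair)
    have "\<tau> n \<in> T" unfolding \<tau>_def using T(2) by (rule from_nat_into)
    then have ij: "i \<in> Basis" "j \<in> Basis" by (auto simp: n T_def)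
    show ?thesis
    proof (cases "avoids n L")
      case True
      then show ?thesis using L by blast
    next
      case False
      then obtain q where q: "q \<in> interior L" "q \<bullet> i = r" "q \<bullet> j = s" "i \<noteq> j"
        by (auto simp: avoids_def n)
      obtain L' where "convex_body L'" "L' \<subseteq> L" "(LINT x|lborel. indicator L' x * f x) = 0"
        "(LINT x|lborel. indicator L' x * g x) > 0"
        "\<And>x. x \<in> interior L' \<Longrightarrow> (x \<bullet> i, x \<bullet> j) \<noteq> (q \<bullet> i, q \<bullet> j)"
        using bisect_through_flat[OF f g _ _ _ ij q(4,1)] L unfolding body_def by metis
      then have "body L' \<and> (L' \<subseteq> L \<and> avoids n L')"
        using L q by (auto simp: body_def avoids_def n)
      then show ?thesis by blast
    qed
  qed
  have "body K" using K f0 g0 by (simp add: body_def)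
  then have "\<exists>F. \<forall>n. body (F n) \<and> (F (Suc n) \<subseteq> F n \<and> avoids n (F (Suc n)))"
    by (intro dependent_nat_choice[of "\<lambda>_. body"] step) blast+
  then obtain F where F: "\<And>n. body (F n)" "\<And>n. F (Suc n) \<subseteq> F n" "\<And>n. avoids n (F (Suc n))" by blast
  have mono: "F n \<subseteq> F m" if "m \<le> n" for m n using F(2) that by (rule lift_Suc_antimono_le)
  have Fc: "compact (F n)" "convex (F n)" "F n \<noteq> {}" for n
    using F(1)[of n] interior_subset[of "F n"] by (auto simp: body_def convex_body_def)
  define S where "S = (\<Inter>n. F n)"
  have S: "S \<noteq> {}" "compact S" "convex S"
    unfolding S_def using compact_nest[of F] Fc mono by (auto intro!: compact_Inter convex_INT)
  have SF: "S \<subseteq> F n" for n unfolding S_def by blast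
  have "collinear S"
  proof (rule collinear_if_planar_projections_thin[OF S(3)], rule ccontr)
    fix i j :: 'a assume ij: "i \<in> Basis" "j \<in> Basis" "i \<noteq> j"
      and ne: "interior ((\<lambda>x. (x \<bullet> i, x \<bullet> j)) ` S) \<noteq> {}"
    let ?\<pi> = "\<lambda>x. (x \<bullet> i, x \<bullet> j)"
    have lin: "linear ?\<pi>" by (rule linearI) (auto simp: inner_add_left)
    obtain r s where rs: "r \<in> \<rat>" "s \<in> \<rat>" "(r, s) \<in> interior (?\<pi> ` S)"
      using open_real_prod_rational[OF open_interior ne] by blast
    then have "(i, j, r, s) \<in> T" using ij by (simp add: T_def)
    then obtain n where n: "\<tau> n = (i, j, r, s)" unfolding \<tau>_def
      using from_nat_into_surj[OF T(1)] by blast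
    let ?L = "F (Suc n)"
    have in_int: "(r, s) \<in> interior (?\<pi> ` ?L)"
      using rs(3) interior_mono[OF image_mono[OF SF]] by blast
    \<comment> \<open>Relative interiors of convex sets commute with linear maps, and here they are
      true interiors on both sides. So a point interior to the projection lifts to an interior point
      of the body, which \<open>avoids\<close> forbids.\<close>
    then have "interior (?\<pi> ` ?L) = ?\<pi> ` interior ?L"
      using rel_interior_nonempty_interior[of "?\<pi> ` ?L"] rel_interior_nonempty_interior[of ?L]
        rel_interior_convex_linear_image[OF lin Fc(2)[of "Suc n"]] F(1)[of "Suc n"]
      unfolding body_def convex_body_def by auto
    then obtain x where "x \<in> interior ?L" "?\<pi> x = (r, s)" using in_int by auto
    then show False using F(3)[of n] ij(3) by (auto simp: avoids_def n)
  qed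
  then obtain P Q where PQ: "S = closed_segment P Q"
    using compact_convex_collinear_segment[OF S] by blast
  define U where "U = (\<Union>z\<in>S. ball z e)"
  have "open U" unfolding U_def by auto
  \<comment> \<open>Compactness: otherwise the nested compact sets F n - U would have a common
    point, which would lie in S but outside a neighbourhood of S.\<close>
  have "\<exists>n. F n \<subseteq> U"
  proof (rule ccontr)
    assume none: "\<not> (\<exists>n. F n \<subseteq> U)"
    have "\<Inter>(range (\<lambda>n. F n - U)) \<noteq> {}"
    proof (rule compact_nest)
      show "compact (F n - U)" for n using Fc(1) \<open>open U\<close> by (rule compact_diff)
      show "F n - U \<noteq> {}" for n using none by blast
      show "F n - U \<subseteq> F m - U" if "m \<le> n" for m n using mono[OF that] by blast
    qed
    then have "S - U \<noteq> {}" unfolding S_def by auto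
    then show False using e by (auto simp: U_def)
  qed
  then obtain n where n: "F n \<subseteq> U" by blast
  show thesis
  proof (rule that[of "F n" P Q])
    show "\<exists>z\<in>closed_segment P Q. dist x z < e" if x: "x \<in> F n" for x
    proof -
      obtain z where "z \<in> S" "dist z x < e" using x n by (auto simp: U_def)
      then show ?thesis unfolding PQ by (metis dist_commute)
    qed
  qed (use F(1)[of n] in \<open>auto simp: body_def\<close>)
qed

section \<open>Payne--Weinberger inequality\<close>

abbreviation lint :: "'a::euclidean_space set \<Rightarrow> ('a \<Rightarrow> real) \<Rightarrow> real" where
  "lint K \<phi> \<equiv> LINT x|lborel. indicator K x * \<phi> x"

lemma integrable_indicator_continuous:
  fixes \<phi> :: "'a::euclidean_space \<Rightarrow> real"
  assumes "compact K" "continuous_on K \<phi>"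
  shows "integrable lborel (\<lambda>x. indicator K x * \<phi> x)"
  using borel_integrable_compact[OF assms] by simp

lemma integrable_indicator_subset:
  fixes \<phi> :: "'a::euclidean_space \<Rightarrow> real"
  assumes "integrable lborel (\<lambda>x. indicator K x * \<phi> x)" "compact L" "L \<subseteq> K"
  shows "integrable lborel (\<lambda>x. indicator L x * \<phi> x)"
proof -
  have "(\<lambda>x. indicator L x * (indicator K x * \<phi> x)) = (\<lambda>x. indicator L x * \<phi> x)"
    using assms(3) by (auto simp: fun_eq_iff indicator_def)
  with integrable_indicator_mult[OF assms(1,2)] show ?thesis by metis
qed

lemma lint_mono:
  fixes \<phi> \<psi> :: "'a::euclidean_space \<Rightarrow> real"
  assumes "integrable lborel (\<lambda>x. indicator K x * \<phi> x)" "integrable lborel (\<lambda>x. indicator K x * \<psi> x)"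
    and "\<And>x. x \<in> K \<Longrightarrow> \<phi> x \<le> \<psi> x"
  shows "lint K \<phi> \<le> lint K \<psi>"
  using assms by (intro integral_mono) (auto simp: indicator_def)

lemma lint_const:
  assumes "compact K"
  shows "lint K (\<lambda>_. c) = c * measure lborel K"
proof -
  have "K \<in> fmeasurable lborel" using assms by (rule fmeasurable_compact)
  then show ?thesis by (simp add: fmeasurable_def)
qed

lemma lint_bounds:
  fixes \<phi> :: "'a::euclidean_space \<Rightarrow> real"
  assumes "integrable lborel (\<lambda>x. indicator K x * \<phi> x)" "compact K"
  shows "(\<And>x. x \<in> K \<Longrightarrow> \<phi> x \<le> c) \<Longrightarrow> lint K \<phi> \<le> c * measure lborel K"
    and "(\<And>x. x \<in> K \<Longrightarrow> c \<le> \<phi> x) \<Longrightarrow> c * measure lborel K \<le> lint K \<phi>"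
proof -
  have i: "integrable lborel (\<lambda>x. indicator K x * c)"
    by (rule integrable_indicator_continuous) (use assms(2) in auto)
  show "(\<And>x. x \<in> K \<Longrightarrow> \<phi> x \<le> c) \<Longrightarrow> lint K \<phi> \<le> c * measure lborel K"
    "(\<And>x. x \<in> K \<Longrightarrow> c \<le> \<phi> x) \<Longrightarrow> c * measure lborel K \<le> lint K \<phi>"
    unfolding lint_const[OF assms(2), symmetric] using assms(1) i by (intro lint_mono; simp)+
qed

lemma measure_pos_of_open_subset:
  fixes S :: "'a::euclidean_space set"
  assumes "compact S" "open U" "U \<noteq> {}" "U \<subseteq> S"
  shows "measure lborel S > 0"
proof (rule ccontr)
  assume "\<not> measure lborel S > 0"
  then have "measure lborel S = 0" using measure_nonneg[of lborel S] by linarith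
  moreover have "S \<in> fmeasurable lborel" using assms(1) by (rule fmeasurable_compact)
  ultimately have "S \<in> null_sets lborel"
    by (auto simp: null_sets_def emeasure_eq_measure2 fmeasurableD)
  then have "negligible S"
    by (simp add: negligible_iff_null_sets null_sets_completionI)
  then show False using assms open_not_negligible negligible_subset by blast
qed

lemma lint_slabs:
  fixes \<phi> :: "'a::euclidean_space \<Rightarrow> real" and c :: "nat \<Rightarrow> real"
  assumes K: "compact K" and int: "integrable lborel (\<lambda>x. indicator K x * \<phi> x)" and w: "w \<noteq> 0"
    and c: "incseq c" and K0: "\<And>x. x \<in> K \<Longrightarrow> c 0 \<le> w \<bullet> x" and KN: "\<And>x. x \<in> K \<Longrightarrow> w \<bullet> x \<le> c N"
  shows "lint K \<phi> = (\<Sum>k<N. lint (K \<inter> {x. c k \<le> w \<bullet> x} \<inter> {x. w \<bullet> x \<le> c (Suc k)}) \<phi>)"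
proof -
  have "lint (K \<inter> {x. w \<bullet> x \<le> c n}) \<phi> = (\<Sum>k<n. lint (K \<inter> {x. c k \<le> w \<bullet> x} \<inter> {x. w \<bullet> x \<le> c (Suc k)}) \<phi>)" for n
  proof (induction n)
    case 0
    have "AE x in lborel. x \<notin> {x. w \<bullet> x = c 0}"
      using null_sets_lborel_hyperplane[OF w] by (rule AE_not_in)
    then have "AE x in lborel. indicator (K \<inter> {x. w \<bullet> x \<le> c 0}) x * \<phi> x = 0"
      by eventually_elim (use K0 in \<open>force simp: indicator_def\<close>)
    then show ?case by (simp add: integral_eq_zero_AE)
  next
    case (Suc n)
    let ?h = "\<lambda>x. indicator (K \<inter> {x. w \<bullet> x \<le> c (Suc n)}) x * \<phi> x"
    have i: "integrable lborel ?h"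
      by (rule integrable_indicator_subset[OF int]) (auto intro!: compact_Int_closed K closed_halfspace_le)
    have cn: "c n \<le> c (Suc n)" using c by (simp add: incseq_SucD)
    have e: "indicator {x. w \<bullet> x \<le> c n} x * ?h x = indicator (K \<inter> {x. w \<bullet> x \<le> c n}) x * \<phi> x"
      "indicator {x. w \<bullet> x \<ge> c n} x * ?h x
         = indicator (K \<inter> {x. c n \<le> w \<bullet> x} \<inter> {x. w \<bullet> x \<le> c (Suc n)}) x * \<phi> x" for x
      using cn by (auto simp: indicator_def)
    show ?case
      using integral_halfspace_split[OF i w, of "c n"] unfolding e by (simp add: Suc)
  qed
  from this[of N] show ?thesis using KN by (simp add: Int_absorb2 subset_iff)
qed

text \<open>The vector \<open>w\<close> points along the segment, so that one coordinate measures
  distances on it exactly. If the segment is a point, any unit vector serves.\<close>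

lemma thin_body_direction:
  fixes P Q :: "'a::euclidean_space"
  obtains w where "norm w = 1"
    "\<And>s t. s \<in> closed_segment P Q \<Longrightarrow> t \<in> closed_segment P Q \<Longrightarrow> dist s t = \<bar>w \<bullet> (s - t)\<bar>"
proof (cases "P = Q")
  case True
  obtain b :: 'a where "b \<in> Basis" using nonempty_Basis by blast
  then show thesis using that[of b] True by auto
next
  case False
  define w where "w = (Q - P) /\<^sub>R norm (Q - P)"
  have w: "norm w = 1" "Q - P = norm (Q - P) *\<^sub>R w" using False by (auto simp: w_def)
  have "dist s t = \<bar>w \<bullet> (s - t)\<bar>" if st: "s \<in> closed_segment P Q" "t \<in> closed_segment P Q" for s t
  proof -
    obtain a b where ab: "s = (1 - a) *\<^sub>R P + a *\<^sub>R Q" "t = (1 - b) *\<^sub>R P + b *\<^sub>R Q"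
      using st by (auto simp: in_segment)
    have "s - t = (a - b) *\<^sub>R (Q - P)" unfolding ab by (simp add: algebra_simps)
    also have "\<dots> = ((a - b) * norm (Q - P)) *\<^sub>R w" by (subst w(2)) simp
    finally obtain r where "s - t = r *\<^sub>R w" by blast
    then show ?thesis using w(1) by (simp add: dist_norm norm_eq_1)
  qed
  then show thesis using that w(1) by blast
qed

text \<open>Quantitative Payne--Weinberger near a segment. \<open>f\<close> is replaced by its
  values at one point per slab and \<open>discrete_weighted_poincare\<close> is applied with the
  slab volumes as weights. The oscillation \<eta> of the squared gradient and the Lipschitz error of
  order D / N are the only losses; both are made small later by the choice of N.\<close>

lemma thin_body_variance:
  fixes f :: "'a::euclidean_space \<Rightarrow> real" and G :: "'a \<Rightarrow> 'a" and N :: nat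
  assumes K: "convex_body K" and diam: "\<And>x y. x \<in> K \<Longrightarrow> y \<in> K \<Longrightarrow> dist x y \<le> D" and N: "N \<ge> 2"
    and thin: "\<And>x. x \<in> K \<Longrightarrow> \<exists>z\<in>closed_segment P Q. dist x z < e" and e: "4 * e \<le> D / N"
    and der: "\<And>x. x \<in> K \<Longrightarrow> (f has_derivative (\<lambda>h. G x \<bullet> h)) (at x)" and Gc: "continuous_on K G"
    and \<Lambda>: "\<And>x. x \<in> K \<Longrightarrow> norm (G x) \<le> \<Lambda>" and Fb: "\<And>x. x \<in> K \<Longrightarrow> \<bar>f x\<bar> \<le> Fb"
    and osc: "\<And>x y. x \<in> K \<Longrightarrow> y \<in> K \<Longrightarrow> dist x y \<le> 3 * D / N \<Longrightarrow> (norm (G y))\<^sup>2 \<le> (norm (G x))\<^sup>2 + \<eta>"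
    and mean: "lint K f = 0"
  shows "4 * (sin (pi / (2 * N)))\<^sup>2 * lint K (\<lambda>x. (f x)\<^sup>2)
     \<le> (D / N)\<^sup>2 * (lint K (\<lambda>x. (norm (G x))\<^sup>2) + \<eta> * measure lborel K)
       + 4 * (sin (pi / (2 * N)))\<^sup>2 * (12 * Fb * \<Lambda> * D / N * measure lborel K)"
proof -
  have comp: "compact K" "convex K" "interior K \<noteq> {}" using K by (auto simp: convex_body_def)
  then have K0: "K \<noteq> {}" using interior_subset by blast
  have Npos: "real N > 0" using N by simp
  obtain x0 where x0: "x0 \<in> K" using K0 by blast
  have \<Lambda>0: "\<Lambda> \<ge> 0" using \<Lambda>[OF x0] norm_ge_zero order_trans by blast
  have Fb0: "Fb \<ge> 0" using Fb[OF x0] by linarith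
  have D0: "D \<ge> 0" using diam[OF x0 x0] by simp
  have \<eta>0: "\<eta> \<ge> 0" using osc[OF x0 x0] D0 Npos by simp
  have fc: "continuous_on K f"
    using der by (meson continuous_at_imp_continuous_on has_derivative_continuous)
  obtain w where w1: "norm w = 1" and wd: "\<And>s t. s \<in> closed_segment P Q \<Longrightarrow> t \<in> closed_segment P Q \<Longrightarrow> dist s t = \<bar>w \<bullet> (s - t)\<bar>"
    using thin_body_direction[of P Q] by blast
  have w0: "w \<noteq> 0" using w1 by auto
  have wle: "\<bar>w \<bullet> x\<bar> \<le> norm x" for x using Cauchy_Schwarz_ineq2[of w x] w1 by simp
  have wc: "continuous_on K (\<lambda>x. w \<bullet> x)" by (intro continuous_intros)
  obtain a where a: "a \<in> K" "\<And>x. x \<in> K \<Longrightarrow> w \<bullet> a \<le> w \<bullet> x"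
    using continuous_attains_inf[OF comp(1) K0 wc] by blast
  obtain b where b: "b \<in> K" "\<And>x. x \<in> K \<Longrightarrow> w \<bullet> x \<le> w \<bullet> b"
    using continuous_attains_sup[OF comp(1) K0 wc] by blast
  have ab: "w \<bullet> a < w \<bullet> b"
  proof (rule ccontr)
    assume "\<not> w \<bullet> a < w \<bullet> b"
    then have "K \<subseteq> {x. w \<bullet> x = w \<bullet> a}" using a b by force
    then have "interior K \<subseteq> interior {x. w \<bullet> x = w \<bullet> a}" by (rule interior_mono)
    then show False using comp(3) w0 by simp
  qed
  define h where "h = (w \<bullet> b - w \<bullet> a) / N"
  have hpos: "h > 0" using ab Npos by (simp add: h_def)
  define c where "c k = w \<bullet> a + real k * h" for k
  have cS: "c (Suc k) = c k + h" for k by (simp add: c_def algebra_simps)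
  have c0: "c 0 = w \<bullet> a" and cN: "c N = w \<bullet> b" using Npos by (auto simp: c_def h_def)
  have cinc: "incseq c" by (rule incseq_SucI) (use cS hpos in auto)
  define S where "S k = K \<inter> {x. c k \<le> w \<bullet> x} \<inter> {x. w \<bullet> x \<le> c (Suc k)}" for k
  have SK: "S k \<subseteq> K" for k by (auto simp: S_def)
  have Sc: "compact (S k)" "convex (S k)" for k
    unfolding S_def using comp
    by (auto intro!: compact_Int_closed convex_Int closed_halfspace_le closed_halfspace_ge convex_halfspace_le convex_halfspace_ge)
  \<comment> \<open>The samples are equally spaced on the chord between two extreme points of K in
    direction \<open>w\<close>, each halfway between the bounding hyperplanes of its slab.\<close>
  define z where "z k = a + ((real k + 1/2) / N) *\<^sub>R (b - a)" for k
  have zK: "z k \<in> K" if "k < N" for k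
  proof -
    have "z k = (1 - (real k + 1/2) / N) *\<^sub>R a + ((real k + 1/2) / N) *\<^sub>R b"
      by (simp add: z_def algebra_simps)
    moreover have "real k + 1 / 2 \<le> N" using that by linarith
    then have "(real k + 1/2) / N \<le> 1" using Npos by simp
    ultimately show ?thesis using comp(2) a(1) b(1) by (simp add: convexD_alt)
  qed
  have wz: "w \<bullet> z k = c k + h / 2" for k
    using Npos by (simp add: z_def c_def h_def inner_add_right inner_diff_right field_simps)
  have zS: "z k \<in> S k" if "k < N" for k
    using zK[OF that] hpos by (simp add: S_def wz cS)
  have hD: "h \<le> D / N"
  proof -
    have "w \<bullet> b - w \<bullet> a \<le> norm (b - a)" using wle[of "b - a"] by (simp add: inner_diff_right)
    also have "\<dots> \<le> D" using diam[OF b(1) a(1)] by (simp add: dist_norm)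
    finally show ?thesis using Npos by (simp add: h_def divide_right_mono)
  qed
  \<comment> \<open>One D / N bounds the slab width h, the other the four deviations e: two between
    points of K and the segment, two more when these are projected to direction
    \<open>w\<close>.\<close>
  define \<tau> where "\<tau> = 2 * D / N"
  have \<tau>0: "\<tau> \<ge> 0" using D0 by (simp add: \<tau>_def)
  have xz: "dist x (z k) \<le> \<tau>" if k: "k < N" and x: "x \<in> S k" for k x
  proof -
    obtain s where s: "s \<in> closed_segment P Q" "dist x s < e" using thin x SK by blast
    obtain t where t: "t \<in> closed_segment P Q" "dist (z k) t < e" using thin zK[OF k] by blast
    have xzh: "\<bar>w \<bullet> (x - z k)\<bar> \<le> h"
      using x hpos wz[of k] by (auto simp: S_def cS inner_diff_right)
    have "w \<bullet> (s - t) = w \<bullet> (s - x) + w \<bullet> (x - z k) + w \<bullet> (z k - t)"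
      by (simp add: inner_diff_right)
    then have "\<bar>w \<bullet> (s - t)\<bar> \<le> \<bar>w \<bullet> (s - x)\<bar> + \<bar>w \<bullet> (x - z k)\<bar> + \<bar>w \<bullet> (z k - t)\<bar>" by linarith
    moreover have "\<bar>w \<bullet> (s - x)\<bar> \<le> e" "\<bar>w \<bullet> (z k - t)\<bar> \<le> e"
      using wle[of "s - x"] wle[of "z k - t"] s(2) t(2) by (auto simp: dist_norm norm_minus_commute)
    ultimately have "dist s t \<le> h + 2 * e" using wd[OF s(1) t(1)] xzh by linarith
    moreover have "dist x (z k) \<le> dist x s + dist s t + dist (z k) t"
      using dist_triangle[of x "z k" s] dist_triangle[of s "z k" t] by (simp add: dist_commute)
    ultimately have "dist x (z k) \<le> h + 4 * e" using s(2) t(2) by linarith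
    also have "\<dots> \<le> \<tau>" using hD e unfolding \<tau>_def by simp
    finally show ?thesis .
  qed
  \<comment> \<open>This bound must be exactly D / N, since its square becomes the constant of the
    gradient term; the cruder \<tau> would destroy sharpness. It is available because the samples
    lie on a chord of length at most D.\<close>
  have zz: "dist (z k) (z (k - 1)) \<le> D / N" if "1 \<le> k" for k
  proof -
    have "z k - z (k - 1) = (1 / N) *\<^sub>R (b - a)"
      using that by (simp add: z_def of_nat_diff scaleR_left_diff_distrib[symmetric] diff_divide_distrib[symmetric])
    then have "dist (z k) (z (k - 1)) = dist b a / N" using Npos by (simp add: dist_norm)
    then show ?thesis using diam[OF b(1) a(1)] Npos by (simp add: divide_right_mono)
  qed
  have onorm: "onorm (\<lambda>h. G x \<bullet> h) \<le> norm (G x)" for x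
    by (rule onorm_le) (simp add: Cauchy_Schwarz_ineq2)
  have lip: "\<bar>f x - f y\<bar> \<le> \<Lambda> * dist x y" if xy: "x \<in> K" "y \<in> K" for x y
  proof -
    have "norm (f x - f y) \<le> \<Lambda> * norm (x - y)"
    proof (rule differentiable_bound[OF comp(2)])
      show "(f has_derivative (\<lambda>h. G t \<bullet> h)) (at t within K)" if "t \<in> K" for t
        using der[OF that] by (rule has_derivative_at_withinI)
      show "onorm (\<lambda>h. G t \<bullet> h) \<le> \<Lambda>" if "t \<in> K" for t
        using onorm \<Lambda>[OF that] by (rule order_trans)
    qed (use xy in auto)
    then show ?thesis by (simp add: dist_norm)
  qed
  define p where "p k = measure lborel (S k)" for k
  define m where "m = measure lborel K"
  define v where "v k = f (z k)" for k
  \<comment> \<open>The samples need not have weighted mean zero. Their mean \<open>vb\<close> is of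
    order \<Lambda> \<tau> because f itself has mean zero, and it is subtracted to satisfy the
    discrete inequality.\<close>
  define vb where "vb = (\<Sum>k<N. p k * v k) / m"
  define u where "u k = v k - vb" for k
  have ppos: "p k > 0" if k: "k < N" for k
  proof -
    let ?U = "interior K \<inter> {x. c k < w \<bullet> x} \<inter> {x. w \<bullet> x < c (Suc k)}"
    have op: "open ({x. c k < w \<bullet> x} \<inter> {x. w \<bullet> x < c (Suc k)})"
      by (intro open_Int open_halfspace_lt open_halfspace_gt)
    \<comment> \<open>The chord may run in the boundary of K, so \<open>z k\<close> need not be
      interior; but it is a limit of interior points, and nearby ones lie strictly inside the
      slab.\<close>
    have "z k \<in> closure (interior K)"
      using convex_closure_interior[OF comp(2,3)] zK[OF k] comp(1) by (simp add: compact_imp_closed)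
    moreover have "z k \<in> {x. c k < w \<bullet> x} \<inter> {x. w \<bullet> x < c (Suc k)}" using hpos by (simp add: wz cS)
    ultimately have "({x. c k < w \<bullet> x} \<inter> {x. w \<bullet> x < c (Suc k)}) \<inter> closure (interior K) \<noteq> {}"
      by blast
    then have "({x. c k < w \<bullet> x} \<inter> {x. w \<bullet> x < c (Suc k)}) \<inter> interior K \<noteq> {}"
      using open_Int_closure_eq_empty[OF op] by metis
    then have "?U \<noteq> {}" by blast
    moreover have "open ?U" using op by (simp add: Int_assoc open_Int)
    moreover have "?U \<subseteq> S k" using interior_subset[of K] by (auto simp: S_def)
    ultimately show ?thesis unfolding p_def using Sc measure_pos_of_open_subset by blast
  qed
  have slabs: "lint K \<phi> = (\<Sum>k<N. lint (S k) \<phi>)" if "integrable lborel (\<lambda>x. indicator K x * \<phi> x)" for \<phi>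
    unfolding S_def by (rule lint_slabs[OF comp(1) that w0 cinc]) (use a b c0 cN in auto)
  have slab_int: "integrable lborel (\<lambda>x. indicator (S k) x * \<phi> x)" if "continuous_on K \<phi>" for \<phi> :: "'a \<Rightarrow> real" and k
    by (intro integrable_indicator_continuous Sc continuous_on_subset[OF that SK])
  have ints: "integrable lborel (\<lambda>x. indicator K x * \<phi> x)" if "continuous_on K \<phi>" for \<phi> :: "'a \<Rightarrow> real"
    using that comp by (intro integrable_indicator_continuous)
  have msum: "m = (\<Sum>k<N. p k)"
    using slabs[of "\<lambda>_. 1"] ints[of "\<lambda>_. 1"] lint_const[OF comp(1), of 1] lint_const[OF Sc(1), of _ 1]
    by (simp add: m_def p_def)
  have mpos: "m > 0" unfolding msum using ppos N by (intro sum_pos) (auto simp: lessThan_empty_iff)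
  have fv: "\<bar>f x - v k\<bar> \<le> \<Lambda> * \<tau>" if "k < N" "x \<in> S k" for k x
  proof -
    have "x \<in> K" using that SK by blast
    then have "\<bar>f x - v k\<bar> \<le> \<Lambda> * dist x (z k)" using lip zK[OF that(1)] unfolding v_def by blast
    also have "\<dots> \<le> \<Lambda> * \<tau>" using xz[OF that] \<Lambda>0 by (rule mult_left_mono)
    finally show ?thesis .
  qed
  have "\<bar>\<Sum>k<N. p k * v k\<bar> \<le> \<Lambda> * \<tau> * m"
  proof -
    have "(\<Sum>k<N. (v k - \<Lambda> * \<tau>) * p k) \<le> lint K f"
      unfolding slabs[OF ints[OF fc]] p_def
      by (intro sum_mono lint_bounds(2) slab_int fc Sc) (use fv in \<open>force simp: abs_le_iff\<close>)
    moreover have "lint K f \<le> (\<Sum>k<N. (v k + \<Lambda> * \<tau>) * p k)"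
      unfolding slabs[OF ints[OF fc]] p_def
      by (intro sum_mono lint_bounds(1) slab_int fc Sc) (use fv in \<open>force simp: abs_le_iff\<close>)
    moreover have "(\<Sum>k<N. (v k - \<Lambda> * \<tau>) * p k) = (\<Sum>k<N. p k * v k) - \<Lambda> * \<tau> * m"
      "(\<Sum>k<N. (v k + \<Lambda> * \<tau>) * p k) = (\<Sum>k<N. p k * v k) + \<Lambda> * \<tau> * m"
      unfolding msum by (simp_all add: algebra_simps sum.distrib sum_subtractf sum_distrib_left)
    ultimately show ?thesis using mean by linarith
  qed
  then have vb: "\<bar>vb\<bar> \<le> \<Lambda> * \<tau>" using mpos by (simp add: vb_def abs_divide field_simps)
  have vb2: "\<bar>vb\<bar> \<le> Fb"
  proof -
    have "\<bar>\<Sum>k<N. p k * v k\<bar> \<le> (\<Sum>k<N. p k * Fb)"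
      using ppos Fb zK by (intro order_trans[OF sum_abs] sum_mono) (auto simp: abs_mult v_def less_imp_le)
    also have "\<dots> = Fb * m" by (simp add: msum sum_distrib_left mult.commute)
    finally show ?thesis using mpos by (simp add: vb_def abs_divide field_simps)
  qed
  have usum: "(\<Sum>k<N. p k * u k) = 0"
  proof -
    have "(\<Sum>k<N. p k * u k) = (\<Sum>k<N. p k * v k) - m * vb"
      unfolding msum by (simp add: u_def right_diff_distrib sum_subtractf sum_distrib_right)
    also have "\<dots> = 0" using mpos by (simp add: vb_def)
    finally show ?thesis .
  qed
  \<comment> \<open>Midpoints between slabs k and k + 2 lie in slab k + 1, by convexity of K and
    equality of the widths.\<close>
  have lc: "p k * p (k + 2) \<le> (p (k + 1))\<^sup>2" for k
    unfolding p_def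
  proof (rule brunn_minkowski_midpoint[OF Sc Sc fmeasurable_compact[OF Sc(1)]])
    fix x y assume xy: "x \<in> S k" "y \<in> S (k + 2)"
    have "midpoint x y \<in> K" using xy SK comp(2) by (metis convex_contains_segment midpoint_in_closed_segment subsetD)
    moreover have "w \<bullet> midpoint x y = (w \<bullet> x + w \<bullet> y) / 2" by (simp add: midpoint_def inner_add_right)
    ultimately show "midpoint x y \<in> S (k + 1)" using xy by (auto simp: S_def cS)
  qed
  define s where "s = 4 * (sin (pi / (2 * N)))\<^sup>2"
  have s0: "s \<ge> 0" by (simp add: s_def)
  have disc: "s * (\<Sum>k<N. p k * (u k)\<^sup>2) \<le> (\<Sum>k=1..<N. sqrt (p (k - 1) * p k) * (u k - u (k - 1))\<^sup>2)"
    unfolding s_def by (rule discrete_weighted_poincare[OF N ppos lc usum])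
  have G2c: "continuous_on K (\<lambda>x. (norm (G x))\<^sup>2)" by (intro continuous_intros Gc)
  have f2c: "continuous_on K (\<lambda>x. (f x)\<^sup>2)" by (intro continuous_intros fc)
  define g where "g k = lint (S k) (\<lambda>x. (norm (G x))\<^sup>2) + \<eta> * p k" for k
  have g_alt: "g k = lint (S k) (\<lambda>x. (norm (G x))\<^sup>2 + \<eta>)" for k
  proof -
    have "lint (S k) (\<lambda>x. (norm (G x))\<^sup>2 + \<eta>) = lint (S k) (\<lambda>x. (norm (G x))\<^sup>2) + lint (S k) (\<lambda>_. \<eta>)"
      using slab_int[OF G2c, of k] slab_int[of "\<lambda>_. \<eta>" k] by (simp add: distrib_left)
    then show ?thesis by (simp only: g_def p_def lint_const[OF Sc(1)])
  qed
  \<comment> \<open>Seen from any x in an adjacent slab, the segment between two samples stays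
    within \<tau> + D / N = 3 D / N, the range of \<open>osc\<close>. Thus the squared difference is
    bounded by the squared gradient at x plus \<eta>, and integration over x brings in the slab
    volume.\<close>
  have step: "p l * (u k - u (k - 1))\<^sup>2 \<le> (D / N)\<^sup>2 * g l" if k: "1 \<le> k" "k < N" and l: "l = k \<or> l = k - 1" for k l
  proof -
    have zs: "z k \<in> K" "z (k - 1) \<in> K" "z l \<in> {z k, z (k - 1)}" "l < N" using k l zK by auto
    have segK: "closed_segment (z (k - 1)) (z k) \<subseteq> K" using zs comp(2) closed_segment_subset by blast
    have pt: "(u k - u (k - 1))\<^sup>2 \<le> (D / N)\<^sup>2 * ((norm (G x))\<^sup>2 + \<eta>)" if x: "x \<in> S l" for x
    proof -
      have xK: "x \<in> K" using x SK by blast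
      define B where "B = sqrt ((norm (G x))\<^sup>2 + \<eta>)"
      have B: "B \<ge> 0" "B\<^sup>2 = (norm (G x))\<^sup>2 + \<eta>" using \<eta>0 by (auto simp: B_def)
      have GB: "norm (G y) \<le> B" if y: "y \<in> closed_segment (z (k - 1)) (z k)" for y
      proof -
        have "dist (z l) y \<le> dist (z k) (z (k - 1))"
          using y zs(3) dist_in_closed_segment[of y "z (k-1)" "z k"] by (auto simp: dist_commute)
        then have "dist x y \<le> \<tau> + D / N"
          using dist_triangle[of x y "z l"] xz[OF zs(4) x] zz[OF k(1)] by linarith
        then have "dist x y \<le> 3 * D / N" by (simp add: \<tau>_def)
        then have "(norm (G y))\<^sup>2 \<le> B\<^sup>2" unfolding B(2) using osc[OF xK] y segK by blast
        then show ?thesis using B(1) by (rule power2_le_imp_le)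
      qed
      have "norm (f (z k) - f (z (k - 1))) \<le> B * norm (z k - z (k - 1))"
      proof (rule differentiable_bound[OF convex_closed_segment])
        show "(f has_derivative (\<lambda>h. G t \<bullet> h)) (at t within closed_segment (z (k - 1)) (z k))"
          if "t \<in> closed_segment (z (k - 1)) (z k)" for t
          using der segK that by (blast intro: has_derivative_at_withinI)
        show "onorm (\<lambda>h. G t \<bullet> h) \<le> B" if "t \<in> closed_segment (z (k - 1)) (z k)" for t
          using onorm GB[OF that] by (rule order_trans)
      qed auto
      also have "\<dots> \<le> B * (D / N)" using zz[OF k(1)] B(1) by (intro mult_left_mono) (auto simp: dist_norm)
      finally have "\<bar>u k - u (k - 1)\<bar> \<le> B * (D / N)" by (simp add: u_def v_def)
      then have "\<bar>u k - u (k - 1)\<bar>\<^sup>2 \<le> (B * (D / N))\<^sup>2" by (intro power_mono) auto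
      then show ?thesis unfolding power_mult_distrib B(2) power2_abs by (simp only: mult.commute)
    qed
    have "(u k - u (k - 1))\<^sup>2 * p l \<le> lint (S l) (\<lambda>x. (D / N)\<^sup>2 * ((norm (G x))\<^sup>2 + \<eta>))"
      unfolding p_def using pt by (intro lint_bounds(2) slab_int Sc continuous_intros Gc)
    also have "\<dots> = (D / N)\<^sup>2 * g l"
      unfolding g_alt by (simp only: mult.left_commute[of "indicator _ _"] integral_mult_right_zero)
    finally show ?thesis by (simp add: mult.commute)
  qed
  have g0: "g k \<ge> 0" for k
    unfolding g_alt by (intro Bochner_Integration.integral_nonneg) (use \<eta>0 in auto)
  \<comment> \<open>The geometric mean of neighbouring volumes is at most their average, so each
    slab is charged at most twice, each time by one half.\<close>
  have "(\<Sum>k=1..<N. sqrt (p (k - 1) * p k) * (u k - u (k - 1))\<^sup>2) \<le> (\<Sum>k=1..<N. (D / N)\<^sup>2 * (g (k - 1) + g k) / 2)"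
  proof (intro sum_mono)
    fix k assume "k \<in> {1..<N}"
    then have k: "1 \<le> k" "k < N" by auto
    then have "sqrt (p (k - 1) * p k) \<le> (p (k - 1) + p k) / 2"
      by (intro arith_geo_mean_sqrt) (auto simp: p_def)
    then have "sqrt (p (k - 1) * p k) * (u k - u (k - 1))\<^sup>2 \<le> (p (k - 1) + p k) / 2 * (u k - u (k - 1))\<^sup>2"
      by (intro mult_right_mono) auto
    also have "\<dots> \<le> (D / N)\<^sup>2 * (g (k - 1) + g k) / 2"
      using step[OF k, of k] step[OF k, of "k - 1"] by (simp add: distrib_left distrib_right)
    finally show "sqrt (p (k - 1) * p k) * (u k - u (k - 1))\<^sup>2 \<le> (D / N)\<^sup>2 * (g (k - 1) + g k) / 2" .
  qed
  also have "\<dots> = (D / N)\<^sup>2 / 2 * ((\<Sum>k=1..<N. g (k - 1)) + (\<Sum>k=1..<N. g k))"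
    by (simp add: sum.distrib[symmetric] sum_distrib_left)
  also have "\<dots> \<le> (D / N)\<^sup>2 / 2 * ((\<Sum>k<N. g k) + (\<Sum>k<N. g k))"
  proof (intro mult_left_mono add_mono)
    show "(\<Sum>k=1..<N. g k) \<le> (\<Sum>k<N. g k)" using g0 by (intro sum_mono2) auto
    have "(\<Sum>k=1..<N. g (k - 1)) = (\<Sum>k\<in>(\<lambda>k. k - 1) ` {1..<N}. g k)"
      by (subst sum.reindex) (auto simp: inj_on_def)
    also have "\<dots> \<le> (\<Sum>k<N. g k)" using g0 by (intro sum_mono2) auto
    finally show "(\<Sum>k=1..<N. g (k - 1)) \<le> (\<Sum>k<N. g k)" .
  qed auto
  also have "\<dots> = (D / N)\<^sup>2 * (\<Sum>k<N. g k)" by simp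
  also have "(\<Sum>k<N. g k) = lint K (\<lambda>x. (norm (G x))\<^sup>2) + \<eta> * m"
    unfolding slabs[OF ints[OF G2c]] msum by (simp add: g_def sum.distrib sum_distrib_left)
  finally have main: "s * (\<Sum>k<N. p k * (u k)\<^sup>2) \<le> (D / N)\<^sup>2 * (lint K (\<lambda>x. (norm (G x))\<^sup>2) + \<eta> * m)"
    using disc by linarith
  \<comment> \<open>The error is a product: |f x - u k| \<le> 2 \<Lambda> \<tau>, from sampling and
    from \<open>vb\<close>, and |f x + u k| \<le> 3 Fb, from f, the sample and
    \<open>vb\<close>.\<close>
  have "lint K (\<lambda>x. (f x)\<^sup>2) \<le> (\<Sum>k<N. ((u k)\<^sup>2 + 6 * Fb * \<Lambda> * \<tau>) * p k)"
    unfolding slabs[OF ints[OF f2c]] p_def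
  proof (intro sum_mono lint_bounds(1) slab_int f2c Sc)
    fix k x assume "k \<in> {..<N}" and x: "x \<in> S k"
    then have k: "k < N" by simp
    have 1: "\<bar>f x - u k\<bar> \<le> 2 * \<Lambda> * \<tau>" using fv[OF k x] vb unfolding u_def by linarith
    have "\<bar>f x\<bar> \<le> Fb" "\<bar>v k\<bar> \<le> Fb" using Fb x SK zK[OF k] by (auto simp: v_def)
    then have 2: "\<bar>f x + u k\<bar> \<le> 3 * Fb" using vb2 unfolding u_def by linarith
    have "(f x)\<^sup>2 - (u k)\<^sup>2 = (f x - u k) * (f x + u k)" by (simp add: power2_eq_square algebra_simps)
    also have "\<dots> \<le> \<bar>f x - u k\<bar> * \<bar>f x + u k\<bar>" by (metis abs_ge_self abs_mult)
    also have "\<dots> \<le> (2 * \<Lambda> * \<tau>) * (3 * Fb)" using 1 2 by (intro mult_mono) auto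
    finally show "(f x)\<^sup>2 \<le> (u k)\<^sup>2 + 6 * Fb * \<Lambda> * \<tau>" by (simp add: mult_ac)
  qed
  also have "\<dots> = (\<Sum>k<N. p k * (u k)\<^sup>2) + 6 * Fb * \<Lambda> * \<tau> * m"
    unfolding msum sum_distrib_left distrib_right sum.distrib by (simp add: mult.commute)
  finally have "s * lint K (\<lambda>x. (f x)\<^sup>2) \<le> s * ((\<Sum>k<N. p k * (u k)\<^sup>2) + 6 * Fb * \<Lambda> * \<tau> * m)"
    using s0 by (rule mult_left_mono)
  then have "s * lint K (\<lambda>x. (f x)\<^sup>2) \<le> (D / N)\<^sup>2 * (lint K (\<lambda>x. (norm (G x))\<^sup>2) + \<eta> * m) + s * (6 * Fb * \<Lambda> * \<tau> * m)"
    using main by (simp add: distrib_left)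
  moreover have "6 * Fb * \<Lambda> * \<tau> * m = 12 * Fb * \<Lambda> * D / N * m" by (simp add: \<tau>_def)
  ultimately show ?thesis unfolding s_def m_def by simp
qed

text \<open>With x = pi / (2 N) this is sin x / x \<rightarrow> 1; here the pi of the sharp constant
  appears.\<close>

lemma discrete_wirtinger_constant_limit:
  fixes D :: real
  shows "(\<lambda>N::nat. (D / real N)\<^sup>2 / (4 * (sin (pi / real (2 * N)))\<^sup>2)) \<longlonglongrightarrow> (D / pi)\<^sup>2"
proof -
  have "((\<lambda>x::real. sin x / x) \<longlongrightarrow> 1) (at 0)"
    using DERIV_sin[of 0] by (simp add: has_field_derivative_iff)
  moreover have "filterlim (\<lambda>N::nat. pi / real (2 * N)) (at 0) sequentially"
  proof (rule filterlim_atI)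
    have "(\<lambda>N::nat. (pi / 2) * inverse (real N)) \<longlonglongrightarrow> (pi / 2) * 0"
      by (intro tendsto_intros lim_inverse_n)
    then show "(\<lambda>N::nat. pi / real (2 * N)) \<longlonglongrightarrow> 0" by (simp add: field_simps)
    show "\<forall>\<^sub>F N in sequentially. pi / real (2 * N) \<noteq> 0"
      using eventually_gt_at_top[of 0] by eventually_elim auto
  qed
  ultimately have "(\<lambda>N::nat. sin (pi / real (2 * N)) / (pi / real (2 * N))) \<longlonglongrightarrow> 1"
    by (rule filterlim_compose)
  then have "(\<lambda>N::nat. (D / pi)\<^sup>2 / (sin (pi / real (2 * N)) / (pi / real (2 * N)))\<^sup>2) \<longlonglongrightarrow> (D / pi)\<^sup>2 / 1\<^sup>2"
    by (intro tendsto_intros) auto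
  moreover have "(D / pi)\<^sup>2 / (sin (pi / real (2 * N)) / (pi / real (2 * N)))\<^sup>2 = (D / real N)\<^sup>2 / (4 * (sin (pi / real (2 * N)))\<^sup>2)" for N :: nat
    by (simp add: power_divide power_mult_distrib)
  ultimately show ?thesis by simp
qed

lemma convex_body_diameter_pos:
  assumes "convex_body K" shows "diameter K > 0"
proof (rule ccontr)
  assume "\<not> diameter K > 0"
  have b: "bounded K" using assms by (auto simp: convex_body_def compact_imp_bounded)
  obtain x where x: "x \<in> interior K" using assms by (auto simp: convex_body_def)
  have "K \<subseteq> {x}"
  proof
    fix y assume "y \<in> K"
    then have "dist x y \<le> diameter K" using diameter_bounded_bound[OF b] x interior_subset by blast
    then have "dist x y \<le> 0" using \<open>\<not> diameter K > 0\<close> by linarith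
    then show "y \<in> {x}" by simp
  qed
  then have "interior K \<subseteq> interior {x}" by (rule interior_mono)
  then show False using x by simp
qed

text \<open>If the inequality failed, then by localization it would fail by a definite margin on convex
  bodies arbitrarily close to a segment.\<close>
theorem payne_weinberger_mean_zero:
  fixes f :: "'a::euclidean_space \<Rightarrow> real" and G :: "'a \<Rightarrow> 'a"
  assumes K: "convex_body K"
    and der: "\<And>x. x \<in> K \<Longrightarrow> (f has_derivative (\<lambda>h. G x \<bullet> h)) (at x)" and Gc: "continuous_on K G"
    and mean: "lint K f = 0"
  shows "lint K (\<lambda>x. (f x)\<^sup>2) \<le> (diameter K / pi)\<^sup>2 * lint K (\<lambda>x. (norm (G x))\<^sup>2)"
proof (rule ccontr)
  define D where "D = diameter K"
  define c where "c = (D / pi)\<^sup>2"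
  assume "\<not> ?thesis"
  then have neg: "lint K (\<lambda>x. (f x)\<^sup>2) - c * lint K (\<lambda>x. (norm (G x))\<^sup>2) > 0" by (simp add: c_def D_def)
  have comp: "compact K" "convex K" "interior K \<noteq> {}" using K by (auto simp: convex_body_def)
  have D: "D > 0" unfolding D_def using K by (rule convex_body_diameter_pos)
  have fc: "continuous_on K f"
    using der by (meson continuous_at_imp_continuous_on has_derivative_continuous)
  have G2c: "continuous_on K (\<lambda>x. (norm (G x))\<^sup>2)" by (intro continuous_intros Gc)
  have f2c: "continuous_on K (\<lambda>x. (f x)\<^sup>2)" by (intro continuous_intros fc)
  have mpos: "measure lborel L > 0" if "convex_body L" for L :: "'a set"
    using that measure_pos_of_open_subset[of L "interior L"] interior_subset by (auto simp: convex_body_def)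
  \<comment> \<open>Half of the average excess over K: subtracting \<epsilon> keeps the integral of
    \<open>g\<close> positive, and positivity on a smaller body L then means an excess of more than
    \<epsilon> times the volume of L.\<close>
  define \<epsilon> where "\<epsilon> = (lint K (\<lambda>x. (f x)\<^sup>2) - c * lint K (\<lambda>x. (norm (G x))\<^sup>2)) / (2 * measure lborel K)"
  have \<epsilon>: "\<epsilon> > 0" using neg mpos[OF K] by (simp add: \<epsilon>_def)
  define g where "g x = (f x)\<^sup>2 - c * (norm (G x))\<^sup>2 - \<epsilon>" for x
  have gc: "continuous_on K g" unfolding g_def by (intro continuous_intros fc Gc)
  have ints: "integrable lborel (\<lambda>x. indicator L x * \<phi> x)" if "continuous_on K \<phi>" "compact L" "L \<subseteq> K" for L and \<phi> :: "'a \<Rightarrow> real"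
    using that by (intro integrable_indicator_continuous) (auto intro: continuous_on_subset)
  have lg: "lint L g = lint L (\<lambda>x. (f x)\<^sup>2) - c * lint L (\<lambda>x. (norm (G x))\<^sup>2) - \<epsilon> * measure lborel L"
    if L: "compact L" "L \<subseteq> K" for L
  proof -
    have "lint L g = (LINT x|lborel. indicator L x * (f x)\<^sup>2 - c * (indicator L x * (norm (G x))\<^sup>2) - indicator L x * \<epsilon>)"
      unfolding g_def by (rule Bochner_Integration.integral_cong) (auto simp: algebra_simps)
    also have "\<dots> = lint L (\<lambda>x. (f x)\<^sup>2) - c * lint L (\<lambda>x. (norm (G x))\<^sup>2) - lint L (\<lambda>_. \<epsilon>)"
      using ints[OF f2c L] ints[OF G2c L] ints[of "\<lambda>_. \<epsilon>", OF _ L] by simp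
    finally show ?thesis by (simp only: lint_const[OF L(1)])
  qed
  have gpos: "lint K g > 0"
    using mpos[OF K] neg unfolding lg[OF comp(1) order_refl] \<epsilon>_def by (simp add: field_simps)
  have "bounded (G ` K)" "bounded (f ` K)"
    using comp(1) Gc fc by (auto intro: compact_imp_bounded compact_continuous_image)
  then obtain \<Lambda> Fb where \<Lambda>: "\<And>x. x \<in> K \<Longrightarrow> norm (G x) \<le> \<Lambda>" and Fb: "\<And>x. x \<in> K \<Longrightarrow> \<bar>f x\<bar> \<le> Fb"
    by (auto simp: bounded_iff)
  \<comment> \<open>Chosen so that a N \<eta> \<le> \<epsilon> / 4 as soon as a N < c + 1.\<close>
  define \<eta> where "\<eta> = \<epsilon> / (4 * (c + 1))"
  have c0: "c \<ge> 0" by (simp add: c_def)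
  have \<eta>: "\<eta> > 0" using \<epsilon> c0 by (simp add: \<eta>_def)
  have "uniformly_continuous_on K (\<lambda>x. (norm (G x))\<^sup>2)"
    using G2c comp(1) by (rule compact_uniformly_continuous)
  then obtain d where d: "d > 0" "\<And>x y. x \<in> K \<Longrightarrow> y \<in> K \<Longrightarrow> dist x y < d \<Longrightarrow> \<bar>(norm (G x))\<^sup>2 - (norm (G y))\<^sup>2\<bar> < \<eta>"
    using \<eta> unfolding uniformly_continuous_on_def dist_real_def by metis
  define a where "a N = (D / real N)\<^sup>2 / (4 * (sin (pi / (2 * N)))\<^sup>2)" for N :: nat
  have a: "a \<longlonglongrightarrow> c" unfolding a_def c_def by (rule discrete_wirtinger_constant_limit)
  have inv0: "(\<lambda>N. C / real N) \<longlonglongrightarrow> 0" for C :: real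
    using tendsto_mult_left[OF lim_inverse_n, of C] by (simp add: divide_inverse)
  have "(\<lambda>N. (a N - c) * \<Lambda>\<^sup>2) \<longlonglongrightarrow> (c - c) * \<Lambda>\<^sup>2" by (intro tendsto_intros a)
  then have l1: "(\<lambda>N. (a N - c) * \<Lambda>\<^sup>2) \<longlonglongrightarrow> 0" by simp
  have q: "\<epsilon> / 4 > 0" "c < c + 1" using \<epsilon> by auto
  \<comment> \<open>N has to be fixed before the thin body is known, since the required thinness
    depends on it. The bounds \<Lambda>, Fb and the modulus d belong to K and hold on every subbody;
    three errors of at most \<epsilon> / 4 per volume cannot make up an excess of
    \<epsilon>.\<close>
  have "eventually (\<lambda>N. a N < c + 1 \<and> \<bar>(a N - c) * \<Lambda>\<^sup>2\<bar> < \<epsilon> / 4 \<and> 12 * Fb * \<Lambda> * D / real N < \<epsilon> / 4 \<and> 3 * D / real N < d \<and> N \<ge> 2) sequentially"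
    by (intro eventually_conj order_tendstoD(2)[OF a q(2)] order_tendstoD(2)[OF tendsto_rabs_zero[OF l1] q(1)]
        order_tendstoD(2)[OF inv0 q(1)] order_tendstoD(2)[OF inv0 d(1)] eventually_ge_at_top)
  then obtain N where N: "a N < c + 1" "\<bar>(a N - c) * \<Lambda>\<^sup>2\<bar> < \<epsilon> / 4" "12 * Fb * \<Lambda> * D / real N < \<epsilon> / 4" "3 * D / real N < d" "N \<ge> 2"
    by (auto simp: eventually_sequentially)
  define e where "e = D / N / 4"
  have e: "e > 0" using D N(5) by (simp add: e_def)
  have ind: "lint L (\<lambda>x. indicator K x * \<phi> x) = lint L \<phi>" if "L \<subseteq> K" for L and \<phi> :: "'a \<Rightarrow> real"
    by (rule Bochner_Integration.integral_cong) (use that in \<open>auto simp: indicator_def\<close>)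
  \<comment> \<open>Localization needs functions integrable on the whole space, whereas f and g are
    controlled only on K; hence the cut-offs.\<close>
  have z: "lint K (\<lambda>x. indicator K x * f x) = 0" "lint K (\<lambda>x. indicator K x * g x) > 0"
    using mean gpos unfolding ind[OF order_refl] .
  obtain L P Q where L: "convex_body L" "L \<subseteq> K" "lint L (\<lambda>x. indicator K x * f x) = 0"
    "lint L (\<lambda>x. indicator K x * g x) > 0" "\<And>x. x \<in> L \<Longrightarrow> \<exists>z\<in>closed_segment P Q. dist x z < e"
    by (rule localization_to_segment[OF ints[OF fc comp(1) order_refl] ints[OF gc comp(1) order_refl] K z e]) blast
  have Lc: "compact L" using L(1) by (simp add: convex_body_def)
  define s where "s = 4 * (sin (pi / (2 * N)))\<^sup>2"
  have s: "s > 0"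
  proof -
    have "sin (pi / (2 * N)) > 0"
      using N(5) by (intro sin_gt_zero) (auto simp: field_simps)
    then show ?thesis by (simp add: s_def)
  qed
  have divide_by_s: "x \<le> E / s * y + z" if "s * x \<le> E * y + s * z" for x y z E
  proof -
    have "s * x \<le> s * (E / s * y + z)" using that s by (simp add: distrib_left)
    then show ?thesis using s by (simp only: mult_le_cancel_left_pos)
  qed
  define m where "m = measure lborel L"
  have m: "m > 0" using mpos[OF L(1)] by (simp add: m_def)
  define X Y where "X = lint L (\<lambda>x. (f x)\<^sup>2)" and "Y = lint L (\<lambda>x. (norm (G x))\<^sup>2)"
  have "s * X \<le> (D / N)\<^sup>2 * (Y + \<eta> * m) + s * (12 * Fb * \<Lambda> * D / N * m)"
    unfolding s_def X_def Y_def m_def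
  proof (rule thin_body_variance[OF L(1) _ N(5) L(5)])
    show "dist x y \<le> D" if "x \<in> L" "y \<in> L" for x y
      using that L(2) comp(1) unfolding D_def by (intro diameter_bounded_bound) (auto simp: compact_imp_bounded)
    show "(norm (G y))\<^sup>2 \<le> (norm (G x))\<^sup>2 + \<eta>" if "x \<in> L" "y \<in> L" "dist x y \<le> 3 * D / N" for x y
      using d(2)[of x y] that L(2) N(4) by fastforce
    show "lint L f = 0" using L(3) ind[OF L(2)] by simp
    show "continuous_on L G" using Gc L(2) by (rule continuous_on_subset)
  qed (use L(2) der \<Lambda> Fb in \<open>auto simp: e_def\<close>)
  then have "X \<le> a N * (Y + \<eta> * m) + 12 * Fb * \<Lambda> * D / N * m"
    unfolding a_def s_def[symmetric] by (rule divide_by_s)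
  moreover have "X - c * Y - \<epsilon> * m > 0"
    using L(4) unfolding ind[OF L(2)] lg[OF Lc L(2)] by (simp add: X_def Y_def m_def)
  ultimately have "\<epsilon> * m < (a N - c) * Y + a N * \<eta> * m + 12 * Fb * \<Lambda> * D / N * m"
    by (simp add: algebra_simps)
  moreover have "(a N - c) * Y \<le> \<epsilon> / 4 * m"
  proof -
    have "0 \<le> Y" unfolding Y_def by (intro Bochner_Integration.integral_nonneg) auto
    have "Y \<le> \<Lambda>\<^sup>2 * m" unfolding Y_def m_def
      by (rule lint_bounds(1)[OF ints[OF G2c Lc L(2)] Lc]) (use \<Lambda> L(2) in \<open>auto intro!: power_mono\<close>)
    have "(a N - c) * Y \<le> \<bar>a N - c\<bar> * Y" using \<open>0 \<le> Y\<close> by (intro mult_right_mono) auto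
    also have "\<dots> \<le> \<bar>a N - c\<bar> * (\<Lambda>\<^sup>2 * m)" using \<open>Y \<le> \<Lambda>\<^sup>2 * m\<close> by (intro mult_left_mono) auto
    also have "\<dots> = \<bar>(a N - c) * \<Lambda>\<^sup>2\<bar> * m" by (simp add: abs_mult)
    also have "\<dots> \<le> \<epsilon> / 4 * m" using N(2) m by (intro mult_right_mono) auto
    finally show ?thesis .
  qed
  moreover have "a N * \<eta> * m \<le> \<epsilon> / 4 * m"
  proof -
    have "a N * \<eta> \<le> (c + 1) * \<eta>" using N(1) \<eta> by (intro mult_right_mono) auto
    also have "\<dots> = \<epsilon> / 4" using c0 by (simp add: \<eta>_def field_simps)
    finally show ?thesis using m by (intro mult_right_mono) auto
  qed
  moreover have "12 * Fb * \<Lambda> * D / N * m \<le> \<epsilon> / 4 * m" using N(3) m by (intro mult_right_mono) auto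
  ultimately have "\<epsilon> * m < 3 * (\<epsilon> / 4 * m)" by linarith
  then show False using \<epsilon> m by (simp add: mult_less_0_iff)
qed

section \<open>Transfer to bounded convex sets and the Poincare inequality with averages\<close>

abbreviation lint_on :: "'a::euclidean_space set \<Rightarrow> ('a \<Rightarrow> real) \<Rightarrow> real" where
  "lint_on S g \<equiv> integral\<^sup>L (lebesgue_on S) g"

lemma integrable_lebesgue_on_continuous:
  fixes g :: "'a::euclidean_space \<Rightarrow> real"
  assumes S: "S \<in> sets lebesgue" "bounded S" and g: "continuous_on UNIV g"
  shows "integrable (lebesgue_on S) g"
proof -
  obtain a where a: "S \<subseteq> cbox (-a) a" using bounded_subset_cbox_symmetric[OF S(2)] by blast
  have "integrable lborel (\<lambda>x. indicator (cbox (-a) a) x *\<^sub>R g x)"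
    using g by (intro borel_integrable_compact) (auto intro: continuous_on_subset)
  then have "integrable lebesgue (\<lambda>x. indicator (cbox (-a) a) x *\<^sub>R g x)"
    by (simp add: integrable_completion borel_measurable_integrable)
  then have "integrable lebesgue (\<lambda>x. indicator S x *\<^sub>R (indicator (cbox (-a) a) x *\<^sub>R g x))"
    by (rule integrable_mult_indicator[OF S(1)])
  also have "(\<lambda>x. indicator S x *\<^sub>R (indicator (cbox (-a) a) x *\<^sub>R g x)) = (\<lambda>x. indicator S x *\<^sub>R g x)"
    using a by (auto simp: indicator_def fun_eq_iff)
  finally show ?thesis using S(1) by (simp add: integrable_restrict_space)
qed

text \<open>The given convex sets need not be closed; their frontiers are null, so the inequality
  for compact bodies carries over from the closure.\<close>

lemma lint_on_convex:
  fixes g :: "'a::euclidean_space \<Rightarrow> real"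
  assumes K: "convex K" "bounded K" and g: "continuous_on UNIV g"
  shows "lint_on K g = lint (closure K) g"
proof -
  have Km: "K \<in> sets lebesgue" using K by (simp add: measurable_convex fmeasurableD)
  have cl: "closure K \<in> sets lborel" by simp
  have "negligible (closure K - K)"
    using negligible_convex_frontier[OF K(1)] by (rule negligible_subset) (use interior_subset[of K] in \<open>auto simp: frontier_def\<close>)
  then have ae: "AE x in lebesgue. x \<notin> closure K - K"
    by (intro AE_not_in) (simp add: negligible_iff_null_sets)
  have gm: "g \<in> borel_measurable borel" using g by (rule borel_measurable_continuous_onI)
  have "lint_on K g = (LINT x|lebesgue. indicator K x * g x)"
    using Km by (simp add: integral_restrict_space)
  also have "\<dots> = (LINT x|lebesgue. indicator (closure K) x * g x)"
  proof (rule integral_cong_AE)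
    show "AE x in lebesgue. indicator K x * g x = indicator (closure K) x * g x"
      using ae by eventually_elim (use closure_subset[of K] in \<open>auto simp: indicator_def\<close>)
    have gL: "g \<in> borel_measurable lebesgue" using gm by (simp add: measurable_completion)
    show "(\<lambda>x. indicator K x * g x) \<in> borel_measurable lebesgue"
      "(\<lambda>x. indicator (closure K) x * g x) \<in> borel_measurable lebesgue"
      using gL Km by (auto intro!: borel_measurable_times borel_measurable_indicator)
  qed
  also have "\<dots> = lint (closure K) g"
    using gm by (intro integral_completion) auto
  finally show ?thesis .
qed

lemma measure_convex_closure:
  assumes K: "convex K" "bounded K"
  shows "measure lebesgue K = measure lborel (closure K)"
  using measure_closure[OF K(2) negligible_convex_frontier[OF K(1)]] by (simp add: measure_completion)

lemma lint_on_square_shift: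
  fixes \<phi> :: "'a::euclidean_space \<Rightarrow> real"
  assumes S: "S \<in> sets lebesgue" "bounded S" and \<phi>: "continuous_on UNIV \<phi>"
  shows "lint_on S (\<lambda>x. (\<phi> x - c)\<^sup>2) = lint_on S (\<lambda>x. (\<phi> x)\<^sup>2) - 2 * c * lint_on S \<phi> + c\<^sup>2 * measure lebesgue S"
proof -
  have i: "integrable (lebesgue_on S) (\<lambda>x. (\<phi> x)\<^sup>2)" "integrable (lebesgue_on S) \<phi>" "integrable (lebesgue_on S) (\<lambda>x. c\<^sup>2)"
    by (intro integrable_lebesgue_on_continuous S continuous_intros \<phi>)+
  have "lint_on S (\<lambda>x. (\<phi> x - c)\<^sup>2) = lint_on S (\<lambda>x. (\<phi> x)\<^sup>2 - 2 * c * \<phi> x + c\<^sup>2)"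
    by (intro Bochner_Integration.integral_cong) (auto simp: power2_diff)
  also have "\<dots> = lint_on S (\<lambda>x. (\<phi> x)\<^sup>2) - 2 * c * lint_on S \<phi> + lint_on S (\<lambda>x. c\<^sup>2)"
    using i by simp
  also have "lint_on S (\<lambda>x. c\<^sup>2) = c\<^sup>2 * measure lebesgue S"
    using S(1) by (simp add: measure_restrict_space space_restrict_space mult.commute)
  finally show ?thesis .
qed

lemma convex_interior_body:
  assumes "convex K" "bounded K" "interior K \<noteq> {}"
  shows "convex_body (closure K)"
proof -
  have "interior K \<subseteq> interior (closure K)" using closure_subset by (rule interior_mono)
  then show ?thesis unfolding convex_body_def using assms by auto
qed

theorem payne_weinberger:
  fixes \<phi> :: "'a::euclidean_space \<Rightarrow> real" and G :: "'a \<Rightarrow> 'a"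
  assumes K: "convex K" "bounded K" "interior K \<noteq> {}"
    and der: "\<And>x. (\<phi> has_derivative (\<lambda>h. G x \<bullet> h)) (at x)" and G: "continuous_on UNIV G"
  shows "lint_on K (\<lambda>x. (\<phi> x - lint_on K \<phi> / measure lebesgue K)\<^sup>2) \<le> (diameter K / pi)\<^sup>2 * lint_on K (\<lambda>x. (norm (G x))\<^sup>2)"
proof -
  let ?L = "closure K"
  define c where "c = lint_on K \<phi> / measure lebesgue K"
  have body: "convex_body ?L" using K by (rule convex_interior_body)
  then have L: "compact ?L" by (simp add: convex_body_def)
  have \<phi>c: "continuous_on UNIV \<phi>"
    using der by (meson continuous_at_imp_continuous_on has_derivative_continuous)
  have "interior K \<subseteq> ?L" using interior_subset closure_subset by blast
  then have pos: "measure lborel ?L > 0"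
    by (intro measure_pos_of_open_subset[OF L open_interior K(3)])
  have "lint ?L (\<lambda>x. \<phi> x - c) = 0"
  proof -
    have i: "integrable lborel (\<lambda>x. indicator ?L x * \<phi> x)" "integrable lborel (\<lambda>x. indicator ?L x * c)"
      by (intro integrable_indicator_continuous L continuous_intros continuous_on_subset[OF \<phi>c] subset_UNIV)+
    have "lint ?L (\<lambda>x. \<phi> x - c) = lint ?L \<phi> - lint ?L (\<lambda>_. c)"
      using i by (simp add: right_diff_distrib)
    also have "lint ?L (\<lambda>_. c) = c * measure lborel ?L" by (rule lint_const[OF L])
    also have "c * measure lborel ?L = lint ?L \<phi>"
      unfolding c_def measure_convex_closure[OF K(1,2)] lint_on_convex[OF K(1,2) \<phi>c] using pos by simp
    finally show ?thesis by simp
  qed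
  moreover have "((\<lambda>x. \<phi> x - c) has_derivative (\<lambda>h. G x \<bullet> h)) (at x)" for x
    using has_derivative_diff[OF der has_derivative_const[of c]] by simp
  ultimately have "lint ?L (\<lambda>x. (\<phi> x - c)\<^sup>2) \<le> (diameter ?L / pi)\<^sup>2 * lint ?L (\<lambda>x. (norm (G x))\<^sup>2)"
    using G by (intro payne_weinberger_mean_zero[OF body]) (auto intro: continuous_on_subset)
  then show ?thesis
    unfolding c_def[symmetric] using K(2)
    by (subst lint_on_convex[OF K(1,2)], intro continuous_intros \<phi>c)
       (subst lint_on_convex[OF K(1,2)], intro continuous_intros G, simp add: diameter_closure)
qed

text \<open>The square integral is V + k a^2, where a is the mean over K and V the variance, which
  Payne--Weinberger bounds. If B = K, then a is the average over B. Otherwise the distance between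
  the two averages is itself controlled by V, at the cost of the volume ratio \<kappa>.\<close>

lemma local_poincare:
  fixes \<phi> :: "real^'n::finite \<Rightarrow> real"
  assumes K: "convex K" "bounded K" and B: "open B" "B \<noteq> {}" "B \<subseteq> K" and R: "diameter K \<le> R"
    and der: "\<And>x. (\<phi> has_derivative (\<lambda>h. G x \<bullet> h)) (at x)" and G: "continuous_on UNIV G"
    and \<eta>: "(B = K \<and> \<eta> = 1) \<or> 3 * (measure lebesgue K / measure lebesgue B) \<le> \<eta>"
  shows "1 \<le> \<eta>" and "lint_on K (\<lambda>x. (\<phi> x)\<^sup>2) \<le> \<eta> * ((R / pi)\<^sup>2 * lint_on K (\<lambda>x. (norm (G x))\<^sup>2) + measure lebesgue B * (avg B \<phi>)\<^sup>2)"
proof -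
  have \<phi>: "continuous_on UNIV \<phi>"
    using der by (meson continuous_at_imp_continuous_on has_derivative_continuous)
  have Km: "K \<in> lmeasurable" using K by (simp add: measurable_convex)
  have Bb: "bounded B" using B(3) K(2) bounded_subset by blast
  have Bm: "B \<in> lmeasurable" using B(1) Bb by (simp add: lmeasurable_open)
  note Ks = fmeasurableD[OF Km] and Bs = fmeasurableD[OF Bm]
  have "\<not> negligible B" using B open_not_negligible by blast
  then have Bpos: "measure lebesgue B > 0"
    using Bm by (metis measure_nonneg negligible_iff_measure order_le_less)
  have BK: "measure lebesgue B \<le> measure lebesgue K"
    using B(3) Bs Km by (intro measure_mono_fmeasurable) auto
  define k where "k = measure lebesgue K" define b where "b = measure lebesgue B"
  have kb: "0 < b" "b \<le> k" using Bpos BK by (auto simp: k_def b_def)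
  define \<kappa> where "\<kappa> = k / b"
  have \<kappa>: "\<kappa> \<ge> 1" "k = \<kappa> * b" using kb by (auto simp: \<kappa>_def)
  show "1 \<le> \<eta>" using \<eta> \<kappa> by (auto simp: \<kappa>_def k_def b_def)
  define A where "A = (R / pi)\<^sup>2 * lint_on K (\<lambda>x. (norm (G x))\<^sup>2)"
  define a where "a = lint_on K \<phi> / k"
  define \<beta> where "\<beta> = avg B \<phi>"
  define V where "V = lint_on K (\<lambda>x. (\<phi> x - a)\<^sup>2)"
  have iK: "interior K \<noteq> {}" using B interior_maximal[OF B(3,1)] by blast
  have "0 \<le> diameter K" using K(2) by (rule diameter_ge_0)
  then have "(diameter K / pi)\<^sup>2 \<le> (R / pi)\<^sup>2" using R by (intro power_mono divide_right_mono) auto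
  then have "(diameter K / pi)\<^sup>2 * lint_on K (\<lambda>x. (norm (G x))\<^sup>2) \<le> A"
    unfolding A_def by (intro mult_right_mono Bochner_Integration.integral_nonneg) auto
  then have VA: "V \<le> A"
    using payne_weinberger[OF K iK der G] unfolding V_def a_def k_def by linarith
  have V0: "V \<ge> 0" unfolding V_def by (intro Bochner_Integration.integral_nonneg) auto
  have Ia: "lint_on K \<phi> = a * k" using kb by (simp add: a_def)
  have Ib: "lint_on B \<phi> = \<beta> * b" using kb by (simp add: \<beta>_def avg_def b_def)
  have I2: "lint_on K (\<lambda>x. (\<phi> x)\<^sup>2) = V + k * a\<^sup>2"
    using lint_on_square_shift[OF Ks K(2) \<phi>, of a] unfolding V_def Ia k_def[symmetric]
    by (simp add: power2_eq_square algebra_simps)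
  have "lint_on K (\<lambda>x. (\<phi> x)\<^sup>2) \<le> \<eta> * (A + b * \<beta>\<^sup>2)"
    using \<eta>
  proof
    assume "B = K \<and> \<eta> = 1"
    then have "a = \<beta>" "k = b" "\<eta> = 1" by (auto simp: a_def \<beta>_def avg_def k_def b_def)
    then show ?thesis using I2 VA by simp
  next
    assume "3 * (measure lebesgue K / measure lebesgue B) \<le> \<eta>"
    then have \<eta>3: "3 * \<kappa> \<le> \<eta>" by (simp add: \<kappa>_def k_def b_def)
    \<comment> \<open>The average \<beta> minimizes the mean square deviation over B; expanding
      around \<beta> and around a shows that the gap is b (\<beta> - a)^2.\<close>
    have "0 \<le> lint_on B (\<lambda>x. (\<phi> x - \<beta>)\<^sup>2)" by (intro Bochner_Integration.integral_nonneg) auto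
    then have "b * (\<beta> - a)\<^sup>2 \<le> lint_on B (\<lambda>x. (\<phi> x - a)\<^sup>2)"
      unfolding lint_on_square_shift[OF Bs Bb \<phi>] Ib b_def[symmetric]
      by (simp add: power2_eq_square algebra_simps)
    also have "\<dots> \<le> V"
    proof -
      have i: "integrable (lebesgue_on K) (\<lambda>x. (\<phi> x - a)\<^sup>2)" "integrable (lebesgue_on B) (\<lambda>x. (\<phi> x - a)\<^sup>2)"
        by (intro integrable_lebesgue_on_continuous Ks Bs K(2) Bb continuous_intros \<phi>)+
      then have i': "integrable lebesgue (\<lambda>x. indicator K x * (\<phi> x - a)\<^sup>2)" "integrable lebesgue (\<lambda>x. indicator B x * (\<phi> x - a)\<^sup>2)"
        using Ks Bs by (simp_all add: integrable_restrict_space)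
      have "(LINT x|lebesgue. indicator B x * (\<phi> x - a)\<^sup>2) \<le> (LINT x|lebesgue. indicator K x * (\<phi> x - a)\<^sup>2)"
        using i' B(3) by (intro integral_mono) (auto simp: indicator_def)
      then show ?thesis unfolding V_def using Ks Bs by (simp add: integral_restrict_space)
    qed
    finally have bV: "b * (\<beta> - a)\<^sup>2 \<le> V" .
    \<comment> \<open>The difference of the two sides is (2 \<beta> - a)^2.\<close>
    have "a\<^sup>2 \<le> 2 * \<beta>\<^sup>2 + 2 * (\<beta> - a)\<^sup>2"
      using zero_le_power2[of "2 * \<beta> - a"] by (simp add: power2_eq_square algebra_simps)
    then have "k * a\<^sup>2 \<le> k * (2 * \<beta>\<^sup>2 + 2 * (\<beta> - a)\<^sup>2)" using kb by (intro mult_left_mono) auto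
    also have "\<dots> = 2 * \<kappa> * (b * \<beta>\<^sup>2) + 2 * \<kappa> * (b * (\<beta> - a)\<^sup>2)" by (simp add: \<kappa>(2) algebra_simps)
    also have "\<dots> \<le> 2 * \<kappa> * (b * \<beta>\<^sup>2) + 2 * \<kappa> * A"
      using bV VA \<kappa>(1) by (intro add_left_mono mult_left_mono) auto
    finally have "lint_on K (\<lambda>x. (\<phi> x)\<^sup>2) \<le> (1 + 2 * \<kappa>) * A + 2 * \<kappa> * (b * \<beta>\<^sup>2)"
      using I2 VA by (simp add: distrib_right)
    \<comment> \<open>The origin of the factor 3: 1 + 2 \<kappa> \<le> 3 \<kappa>, because B lies in
      K and so \<kappa> \<ge> 1.\<close>
    also have "\<dots> \<le> \<eta> * A + \<eta> * (b * \<beta>\<^sup>2)"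
      using \<eta>3 \<kappa>(1) V0 VA kb by (intro add_mono mult_right_mono) auto
    finally show ?thesis by (simp add: distrib_left)
  qed
  then show "lint_on K (\<lambda>x. (\<phi> x)\<^sup>2) \<le> \<eta> * ((R / pi)\<^sup>2 * lint_on K (\<lambda>x. (norm (G x))\<^sup>2) + measure lebesgue B * (avg B \<phi>)\<^sup>2)"
    by (simp add: A_def b_def \<beta>_def)
qed

section \<open>Square-integrable functions and weak derivatives\<close>

lemma L2_mult_integrable:
  assumes f: "L2 \<Omega> f" and g: "L2 \<Omega> g"
  shows "integrable (lebesgue_on \<Omega>) (\<lambda>x. f x * g x)"
proof (rule Bochner_Integration.integrable_bound)
  show "integrable (lebesgue_on \<Omega>) (\<lambda>x. (f x)\<^sup>2 + (g x)\<^sup>2)" using f g by (simp add: L2_def)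
  show "(\<lambda>x. f x * g x) \<in> borel_measurable (lebesgue_on \<Omega>)" using f g by (auto simp: L2_def)
  have "\<bar>a * b\<bar> \<le> a\<^sup>2 + b\<^sup>2" for a b :: real
  proof -
    have "2 * (\<bar>a\<bar> * \<bar>b\<bar>) \<le> a\<^sup>2 + b\<^sup>2" using sum_squares_bound[of "\<bar>a\<bar>" "\<bar>b\<bar>"] by simp
    moreover have "0 \<le> \<bar>a\<bar> * \<bar>b\<bar>" by simp
    ultimately show ?thesis unfolding abs_mult by linarith
  qed
  then show "AE x in lebesgue_on \<Omega>. norm (f x * g x) \<le> norm ((f x)\<^sup>2 + (g x)\<^sup>2)" by simp
qed

lemma L2_add: "L2 \<Omega> f \<Longrightarrow> L2 \<Omega> g \<Longrightarrow> L2 \<Omega> (\<lambda>x. f x + g x)"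
  using L2_mult_integrable[of \<Omega> f g] unfolding L2_def by (auto simp: power2_sum mult.assoc)

lemma L2_diff: "L2 \<Omega> f \<Longrightarrow> L2 \<Omega> g \<Longrightarrow> L2 \<Omega> (\<lambda>x. f x - g x)"
  using L2_mult_integrable[of \<Omega> f g] unfolding L2_def by (auto simp: power2_diff mult.assoc)

lemma L2_sum: "finite A \<Longrightarrow> (\<And>i. i \<in> A \<Longrightarrow> L2 \<Omega> (f i)) \<Longrightarrow> L2 \<Omega> (\<lambda>x. \<Sum>i\<in>A. f i x)"
proof (induction A rule: finite_induct)
  case empty
  then show ?case by (simp add: L2_def)
next
  case (insert i A)
  then show ?case by (simp add: L2_add)
qed

lemma L2_continuous:
  assumes "\<Omega> \<in> sets lebesgue" "bounded \<Omega>" "continuous_on UNIV g"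
  shows "L2 \<Omega> g"
  unfolding L2_def using assms
  by (auto intro!: borel_measurable_integrable integrable_lebesgue_on_continuous continuous_intros)

lemma L2norm_nonneg: "0 \<le> L2norm \<Omega> f"
  unfolding L2norm_def by (intro real_sqrt_ge_zero Bochner_Integration.integral_nonneg) auto

lemma L2norm_power2: "(L2norm \<Omega> f)\<^sup>2 = lint_on \<Omega> (\<lambda>x. (f x)\<^sup>2)"
  unfolding L2norm_def by (intro real_sqrt_pow2 Bochner_Integration.integral_nonneg) auto

lemma L2_Cauchy_Schwarz:
  assumes f: "L2 \<Omega> f" and g: "L2 \<Omega> g"
  shows "\<bar>lint_on \<Omega> (\<lambda>x. f x * g x)\<bar> \<le> L2norm \<Omega> f * L2norm \<Omega> g"
proof -
  define A B C where "A = (L2norm \<Omega> f)\<^sup>2" and "B = (L2norm \<Omega> g)\<^sup>2" and "C = lint_on \<Omega> (\<lambda>x. f x * g x)"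
  have q: "0 \<le> A - 2 * s * C + s\<^sup>2 * B" for s
  proof -
    have i: "integrable (lebesgue_on \<Omega>) (\<lambda>x. (f x)\<^sup>2)" "integrable (lebesgue_on \<Omega>) (\<lambda>x. (g x)\<^sup>2)"
      "integrable (lebesgue_on \<Omega>) (\<lambda>x. f x * g x)"
      using f g L2_mult_integrable[OF f g] by (auto simp: L2_def)
    have "0 \<le> lint_on \<Omega> (\<lambda>x. (f x - s * g x)\<^sup>2)" by (intro Bochner_Integration.integral_nonneg) auto
    also have "\<dots> = lint_on \<Omega> (\<lambda>x. (f x)\<^sup>2 - 2 * s * (f x * g x) + s\<^sup>2 * (g x)\<^sup>2)"
      by (intro Bochner_Integration.integral_cong) (auto simp: power2_diff power_mult_distrib)
    also have "\<dots> = A - 2 * s * C + s\<^sup>2 * B"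
      using i by (simp add: A_def B_def C_def L2norm_power2)
    finally show ?thesis .
  qed
  have "C\<^sup>2 \<le> A * B"
  proof (cases "B = 0")
    case True
    have "C = 0"
    proof (rule ccontr)
      assume "C \<noteq> 0"
      \<comment> \<open>For B = 0 the quadratic in s is affine, and this s gives it the value
        -1.\<close>
      then show False using q[of "(A + 1) / (2 * C)"] True by simp
    qed
    then show ?thesis using True by simp
  next
    case False
    then have "B > 0" by (simp add: B_def order_less_le)
    have "A - 2 * (C / B) * C + (C / B)\<^sup>2 * B = A - C\<^sup>2 / B"
      using \<open>B > 0\<close> by (simp add: power2_eq_square)
    then have "C\<^sup>2 / B \<le> A" using q[of "C / B"] by linarith
    then show ?thesis using \<open>B > 0\<close> by (simp add: pos_divide_le_eq)
  qed
  then have "\<bar>C\<bar>\<^sup>2 \<le> (L2norm \<Omega> f * L2norm \<Omega> g)\<^sup>2" by (simp add: A_def B_def power_mult_distrib)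
  then show ?thesis unfolding C_def[symmetric]
    by (rule power2_le_imp_le) (intro mult_nonneg_nonneg L2norm_nonneg)
qed

lemma L2norm_triangle:
  assumes f: "L2 \<Omega> f" and g: "L2 \<Omega> g"
  shows "L2norm \<Omega> (\<lambda>x. f x + g x) \<le> L2norm \<Omega> f + L2norm \<Omega> g"
proof (rule power2_le_imp_le)
  have i: "integrable (lebesgue_on \<Omega>) (\<lambda>x. (f x)\<^sup>2)" "integrable (lebesgue_on \<Omega>) (\<lambda>x. (g x)\<^sup>2)"
      "integrable (lebesgue_on \<Omega>) (\<lambda>x. f x * g x)"
    using f g L2_mult_integrable[OF f g] by (auto simp: L2_def)
  have "(L2norm \<Omega> (\<lambda>x. f x + g x))\<^sup>2 = lint_on \<Omega> (\<lambda>x. (f x)\<^sup>2 + (g x)\<^sup>2 + 2 * (f x * g x))"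
    unfolding L2norm_power2 by (intro Bochner_Integration.integral_cong) (auto simp: power2_sum)
  also have "\<dots> = (L2norm \<Omega> f)\<^sup>2 + (L2norm \<Omega> g)\<^sup>2 + 2 * lint_on \<Omega> (\<lambda>x. f x * g x)"
    using i by (simp add: L2norm_power2)
  also have "\<dots> \<le> (L2norm \<Omega> f + L2norm \<Omega> g)\<^sup>2"
    using L2_Cauchy_Schwarz[OF f g] unfolding power2_sum by linarith
  finally show "(L2norm \<Omega> (\<lambda>x. f x + g x))\<^sup>2 \<le> (L2norm \<Omega> f + L2norm \<Omega> g)\<^sup>2" .
qed (intro add_nonneg_nonneg L2norm_nonneg)

lemma L2norm_minus_commute: "L2norm \<Omega> (\<lambda>x. f x - g x) = L2norm \<Omega> (\<lambda>x. g x - f x)"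
  unfolding L2norm_def by (simp add: power2_commute)

lemma L2_convergence:
  assumes f: "L2 \<Omega> f" and F: "\<And>k. L2 \<Omega> (F k)" and lim: "(\<lambda>k. L2norm \<Omega> (\<lambda>x. F k x - f x)) \<longlonglongrightarrow> 0"
  shows "(\<lambda>k. L2norm \<Omega> (F k)) \<longlonglongrightarrow> L2norm \<Omega> f"
    and "L2 \<Omega> g \<Longrightarrow> (\<lambda>k. lint_on \<Omega> (\<lambda>x. g x * F k x)) \<longlonglongrightarrow> lint_on \<Omega> (\<lambda>x. g x * f x)"
proof -
  have "\<bar>L2norm \<Omega> (F k) - L2norm \<Omega> f\<bar> \<le> L2norm \<Omega> (\<lambda>x. F k x - f x)" for k
    using L2norm_triangle[OF L2_diff[OF F[of k] f] f] L2norm_triangle[OF L2_diff[OF f F[of k]] F[of k]]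
      L2norm_minus_commute[of \<Omega> "F k" f] by simp
  then have "(\<lambda>k. L2norm \<Omega> (F k) - L2norm \<Omega> f) \<longlonglongrightarrow> 0"
    by (intro Lim_null_comparison[OF _ lim]) auto
  then show "(\<lambda>k. L2norm \<Omega> (F k)) \<longlonglongrightarrow> L2norm \<Omega> f" by (simp add: LIM_zero_iff)
  assume g: "L2 \<Omega> g"
  have bound: "\<bar>lint_on \<Omega> (\<lambda>x. g x * F k x) - lint_on \<Omega> (\<lambda>x. g x * f x)\<bar> \<le> L2norm \<Omega> g * L2norm \<Omega> (\<lambda>x. F k x - f x)" for k
  proof -
    have "lint_on \<Omega> (\<lambda>x. g x * F k x) - lint_on \<Omega> (\<lambda>x. g x * f x) = lint_on \<Omega> (\<lambda>x. g x * (F k x - f x))"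
      using L2_mult_integrable[OF g F[of k]] L2_mult_integrable[OF g f] by (simp add: right_diff_distrib)
    then show ?thesis using L2_Cauchy_Schwarz[OF g L2_diff[OF F[of k] f]] by simp
  qed
  have lim_g: "(\<lambda>k. L2norm \<Omega> g * L2norm \<Omega> (\<lambda>x. F k x - f x)) \<longlonglongrightarrow> 0"
    using tendsto_mult_left[OF lim, of "L2norm \<Omega> g"] by simp
  have "(\<lambda>k. lint_on \<Omega> (\<lambda>x. g x * F k x) - lint_on \<Omega> (\<lambda>x. g x * f x)) \<longlonglongrightarrow> 0"
    by (rule Lim_null_comparison[OF _ lim_g]) (use bound in auto)
  then show "(\<lambda>k. lint_on \<Omega> (\<lambda>x. g x * F k x)) \<longlonglongrightarrow> lint_on \<Omega> (\<lambda>x. g x * f x)"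
    by (simp add: LIM_zero_iff)
qed

lemma L2norm_diff_tendsto_0:
  assumes f: "L2 \<Omega> f" and F: "\<And>k. L2 \<Omega> (F k)" and lim: "(\<lambda>k. L2norm \<Omega> (\<lambda>x. F k x - f x)) \<longlonglongrightarrow> 0"
    and f': "L2 \<Omega> f'" and F': "\<And>k. L2 \<Omega> (F' k)" and lim': "(\<lambda>k. L2norm \<Omega> (\<lambda>x. F' k x - f' x)) \<longlonglongrightarrow> 0"
  shows "(\<lambda>k. L2norm \<Omega> (\<lambda>x. (F k x - F' k x) - (f x - f' x))) \<longlonglongrightarrow> 0"
proof (rule tendsto_sandwich[OF _ _ tendsto_const])
  have "L2norm \<Omega> (\<lambda>x. (F k x - F' k x) - (f x - f' x))
      \<le> L2norm \<Omega> (\<lambda>x. F k x - f x) + L2norm \<Omega> (\<lambda>x. F' k x - f' x)" for k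
    using L2norm_triangle[OF L2_diff[OF F[of k] f] L2_diff[OF f' F'[of k]]]
    by (simp add: L2norm_minus_commute[of \<Omega> "F' k" f'] algebra_simps)
  then show "\<forall>\<^sub>F k in sequentially. L2norm \<Omega> (\<lambda>x. (F k x - F' k x) - (f x - f' x))
      \<le> L2norm \<Omega> (\<lambda>x. F k x - f x) + L2norm \<Omega> (\<lambda>x. F' k x - f' x)" by simp
  show "(\<lambda>k. L2norm \<Omega> (\<lambda>x. F k x - f x) + L2norm \<Omega> (\<lambda>x. F' k x - f' x)) \<longlonglongrightarrow> 0"
    using tendsto_add[OF lim lim'] by simp
qed (simp add: L2norm_nonneg)

section \<open>Classical gradients, test functions and Green's formula\<close>

definition grad :: "(real^'n::finite \<Rightarrow> real) \<Rightarrow> real^'n \<Rightarrow> real^'n" where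
  "grad f x = (\<chi> j. cpartial j f x)"

lemma has_derivative_grad:
  assumes "f differentiable (at x)"
  shows "(f has_derivative (\<lambda>h. grad f x \<bullet> h)) (at x)"
proof -
  have d: "(f has_derivative frechet_derivative f (at x)) (at x)"
    using assms by (simp add: frechet_derivative_works)
  then have l: "linear (frechet_derivative f (at x))" by (rule has_derivative_linear)
  have "frechet_derivative f (at x) h = grad f x \<bullet> h" for h
  proof -
    have "frechet_derivative f (at x) h = frechet_derivative f (at x) (\<Sum>j\<in>UNIV. (h $ j) *\<^sub>R axis j 1)"
      using basis_expansion[of h] by (simp add: scalar_mult_eq_scaleR)
    also have "\<dots> = (\<Sum>j\<in>UNIV. h $ j * cpartial j f x)"
      by (simp add: linear_sum[OF l] linear_scale[OF l] cpartial_def)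
    finally show ?thesis by (simp add: grad_def inner_vec_def mult.commute)
  qed
  then have "frechet_derivative f (at x) = (\<lambda>h. grad f x \<bullet> h)" by blast
  with d show ?thesis by simp
qed

lemma grad_unique:
  assumes "(f has_derivative (\<lambda>h. v \<bullet> h)) (at x)"
  shows "grad f x = v"
  unfolding grad_def cpartial_def frechet_derivative_at[OF assms, symmetric]
  by (simp add: inner_axis)

text \<open>These are the properties that let a test function enter the local inequalities on sets
  \<open>K i\<close> not contained in \<Omega>: it is C^1 on the whole space and vanishes outside
  \<Omega> together with its gradient, since its support is closed.\<close>

lemma test_fun_C1:
  assumes "test_fun \<Omega> \<phi>"
  shows "(\<phi> has_derivative (\<lambda>h. grad \<phi> x \<bullet> h)) (at x)" "continuous_on UNIV (cpartial j \<phi>)"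
    "continuous_on UNIV (grad \<phi>)" "x \<notin> \<Omega> \<Longrightarrow> \<phi> x = 0" "x \<notin> \<Omega> \<Longrightarrow> grad \<phi> x = 0"
proof -
  have sm: "(fold cpartial js \<phi>) differentiable (at x)" for js x
    using assms by (simp add: test_fun_def smooth_fun_def)
  have supp: "closure {x. \<phi> x \<noteq> 0} \<subseteq> \<Omega>" using assms by (simp add: test_fun_def)
  show "(\<phi> has_derivative (\<lambda>h. grad \<phi> x \<bullet> h)) (at x)" for x
    using sm[of "[]"] by (intro has_derivative_grad) simp
  show c: "continuous_on UNIV (cpartial j \<phi>)" for j
    using sm[of "[j]"] by (simp add: continuous_at_imp_continuous_on differentiable_imp_continuous_within)
  show "continuous_on UNIV (grad \<phi>)"
    unfolding grad_def by (intro continuous_on_vec_lambda) (use c in simp)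
  have "{x. \<phi> x \<noteq> 0} \<subseteq> \<Omega>" using closure_subset supp by (rule order_trans)
  then show "\<phi> x = 0" if "x \<notin> \<Omega>" using that by blast
  show "grad \<phi> x = 0" if "x \<notin> \<Omega>"
  proof (rule grad_unique)
    have "((\<lambda>_. 0) has_derivative (\<lambda>h. 0 \<bullet> h)) (at x)" by simp
    then show "(\<phi> has_derivative (\<lambda>h. 0 \<bullet> h)) (at x)"
    proof (rule has_derivative_transform_within_open)
      show "open (- closure {x. \<phi> x \<noteq> 0})" by (rule open_Compl[OF closed_closure])
      show "x \<in> - closure {x. \<phi> x \<noteq> 0}" using that supp by blast
      show "0 = \<phi> y" if "y \<in> - closure {x. \<phi> x \<noteq> 0}" for y
        using that closure_subset[of "{x. \<phi> x \<noteq> 0}"] by auto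
    qed
  qed
qed

lemma wpartial_L2:
  assumes "H1 \<Omega> u"
  shows "L2 \<Omega> (wpartial \<Omega> u j)" "weak_partial \<Omega> u j (wpartial \<Omega> u j)"
proof -
  have "\<exists>g. L2 \<Omega> g \<and> weak_partial \<Omega> u j g" using assms by (simp add: H1_def)
  from someI_ex[OF this] show "L2 \<Omega> (wpartial \<Omega> u j)" "weak_partial \<Omega> u j (wpartial \<Omega> u j)"
    unfolding wpartial_def by auto
qed

lemma H1_0_approx:
  assumes \<Omega>: "\<Omega> \<in> sets lebesgue" "bounded \<Omega>" and u: "H1_0 \<Omega> u"
  obtains \<phi> where "\<And>k. test_fun \<Omega> (\<phi> k)" "(\<lambda>k. L2norm \<Omega> (\<lambda>x. \<phi> k x - u x)) \<longlonglongrightarrow> 0"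
    "\<And>j. (\<lambda>k. L2norm \<Omega> (\<lambda>x. cpartial j (\<phi> k) x - wpartial \<Omega> u j x)) \<longlonglongrightarrow> 0"
    "\<And>k. L2 \<Omega> (\<phi> k)" "\<And>k j. L2 \<Omega> (cpartial j (\<phi> k))"
proof -
  obtain \<phi> where \<phi>: "\<And>k. test_fun \<Omega> (\<phi> k)" and lim: "(\<lambda>k. L2norm \<Omega> (\<lambda>x. \<phi> k x - u x) +
             (\<Sum>j\<in>UNIV. L2norm \<Omega> (\<lambda>x. cpartial j (\<phi> k) x - wpartial \<Omega> u j x))) \<longlonglongrightarrow> 0"
    using u unfolding H1_0_def by blast
  have s0: "0 \<le> (\<Sum>j\<in>UNIV. L2norm \<Omega> (\<lambda>x. cpartial j (\<phi> k) x - wpartial \<Omega> u j x))" for k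
    by (intro sum_nonneg L2norm_nonneg)
  have 1: "(\<lambda>k. L2norm \<Omega> (\<lambda>x. \<phi> k x - u x)) \<longlonglongrightarrow> 0"
    by (rule tendsto_sandwich[OF _ _ tendsto_const lim]) (use s0 in \<open>auto simp: L2norm_nonneg\<close>)
  have 2: "(\<lambda>k. L2norm \<Omega> (\<lambda>x. cpartial j (\<phi> k) x - wpartial \<Omega> u j x)) \<longlonglongrightarrow> 0" for j
  proof (rule tendsto_sandwich[OF _ _ tendsto_const lim])
    have "L2norm \<Omega> (\<lambda>x. cpartial j (\<phi> k) x - wpartial \<Omega> u j x) \<le>
      (\<Sum>j\<in>UNIV. L2norm \<Omega> (\<lambda>x. cpartial j (\<phi> k) x - wpartial \<Omega> u j x))" for k
      by (rule member_le_sum) (auto simp: L2norm_nonneg)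
    then have "L2norm \<Omega> (\<lambda>x. cpartial j (\<phi> k) x - wpartial \<Omega> u j x) \<le> L2norm \<Omega> (\<lambda>x. \<phi> k x - u x) +
      (\<Sum>j\<in>UNIV. L2norm \<Omega> (\<lambda>x. cpartial j (\<phi> k) x - wpartial \<Omega> u j x))" for k
      by (rule add_increasing[OF L2norm_nonneg])
    then show "\<forall>\<^sub>F k in sequentially. L2norm \<Omega> (\<lambda>x. cpartial j (\<phi> k) x - wpartial \<Omega> u j x) \<le> L2norm \<Omega> (\<lambda>x. \<phi> k x - u x) +
      (\<Sum>j\<in>UNIV. L2norm \<Omega> (\<lambda>x. cpartial j (\<phi> k) x - wpartial \<Omega> u j x))" by simp
  qed (simp add: L2norm_nonneg)
  have "continuous_on UNIV (\<phi> k)" for k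
    using test_fun_C1(1)[OF \<phi>] by (meson continuous_at_imp_continuous_on has_derivative_continuous)
  then have 3: "L2 \<Omega> (\<phi> k)" for k using \<Omega> by (intro L2_continuous)
  have 4: "L2 \<Omega> (cpartial j (\<phi> k))" for j k
    using \<Omega> test_fun_C1(2)[OF \<phi>] by (intro L2_continuous)
  show thesis using that \<phi> 1 2 3 4 by blast
qed

text \<open>Testing the weak derivative of \<open>wpartial \<Omega> u j\<close> with functions approximating \<open>w\<close>.\<close>
lemma H2_green:
  assumes \<Omega>: "\<Omega> \<in> sets lebesgue" "bounded \<Omega>" and u: "H2 \<Omega> u" and w: "H1_0 \<Omega> w"
  shows "dirichlet \<Omega> u w = - lint_on \<Omega> (\<lambda>x. wlaplacian \<Omega> u x * w x)"
proof -
  have Hu: "H1 \<Omega> u" "H1 \<Omega> (wpartial \<Omega> u j)" for j using u by (auto simp: H2_def)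
  have Hw: "H1 \<Omega> w" "L2 \<Omega> w" using w by (auto simp: H1_0_def H1_def)
  obtain \<phi> where \<phi>: "\<And>k. test_fun \<Omega> (\<phi> k)" "(\<lambda>k. L2norm \<Omega> (\<lambda>x. \<phi> k x - w x)) \<longlonglongrightarrow> 0"
    "\<And>j. (\<lambda>k. L2norm \<Omega> (\<lambda>x. cpartial j (\<phi> k) x - wpartial \<Omega> w j x)) \<longlonglongrightarrow> 0"
    "\<And>k. L2 \<Omega> (\<phi> k)" "\<And>k j. L2 \<Omega> (cpartial j (\<phi> k))"
    using H1_0_approx[OF \<Omega> w] by blast
  define W where "W j = wpartial \<Omega> (wpartial \<Omega> u j) j" for j
  have W: "L2 \<Omega> (W j)" "weak_partial \<Omega> (wpartial \<Omega> u j) j (W j)" for j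
    unfolding W_def using wpartial_L2[OF Hu(2)] by auto
  have part: "lint_on \<Omega> (\<lambda>x. wpartial \<Omega> u j x * wpartial \<Omega> w j x) = - lint_on \<Omega> (\<lambda>x. W j x * w x)" for j
  proof (rule LIMSEQ_unique)
    show "(\<lambda>k. lint_on \<Omega> (\<lambda>x. wpartial \<Omega> u j x * cpartial j (\<phi> k) x))
      \<longlonglongrightarrow> lint_on \<Omega> (\<lambda>x. wpartial \<Omega> u j x * wpartial \<Omega> w j x)"
      by (intro L2_convergence(2)[OF wpartial_L2(1)[OF Hw(1)] \<phi>(5) \<phi>(3)] wpartial_L2(1)[OF Hu(1)])
    have "lint_on \<Omega> (\<lambda>x. wpartial \<Omega> u j x * cpartial j (\<phi> k) x) = - lint_on \<Omega> (\<lambda>x. W j x * \<phi> k x)" for k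
      using W(2)[of j] \<phi>(1)[of k] by (simp add: weak_partial_def)
    then show "(\<lambda>k. lint_on \<Omega> (\<lambda>x. wpartial \<Omega> u j x * cpartial j (\<phi> k) x))
      \<longlonglongrightarrow> - lint_on \<Omega> (\<lambda>x. W j x * w x)"
      using tendsto_minus[OF L2_convergence(2)[OF Hw(2) \<phi>(4,2) W(1)[of j]]] by simp
  qed
  have "dirichlet \<Omega> u w = (\<Sum>j\<in>UNIV. lint_on \<Omega> (\<lambda>x. wpartial \<Omega> u j x * wpartial \<Omega> w j x))"
    unfolding dirichlet_def
    by (intro Bochner_Integration.integral_sum L2_mult_integrable wpartial_L2(1) Hu Hw)
  also have "\<dots> = - (\<Sum>j\<in>UNIV. lint_on \<Omega> (\<lambda>x. W j x * w x))" by (simp add: part sum_negf)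
  also have "(\<Sum>j\<in>UNIV. lint_on \<Omega> (\<lambda>x. W j x * w x)) = lint_on \<Omega> (\<lambda>x. wlaplacian \<Omega> u x * w x)"
    unfolding wlaplacian_def W_def[symmetric] sum_distrib_right
    by (intro Bochner_Integration.integral_sum[symmetric] L2_mult_integrable W Hw)
  finally show ?thesis .
qed

section \<open>Error estimate\<close>

lemma lint_on_indicator:
  assumes "B \<in> sets lebesgue" "\<Omega> \<in> sets lebesgue" "B \<subseteq> \<Omega>"
  shows "lint_on B v = lint_on \<Omega> (\<lambda>x. indicator B x * v x)"
proof -
  have "(\<lambda>x. indicator \<Omega> x * (indicator B x * v x)) = (\<lambda>x. indicator B x * v x)"
    using assms(3) by (auto simp: indicator_def fun_eq_iff)
  then show ?thesis using assms by (simp add: integral_restrict_space)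
qed

lemma L2_indicator:
  assumes B: "B \<in> lmeasurable" and \<Omega>: "\<Omega> \<in> sets lebesgue" "B \<subseteq> \<Omega>"
  shows "L2 \<Omega> (indicator B)"
proof -
  have eq: "(\<lambda>x. indicator \<Omega> x *\<^sub>R (indicator B x)\<^sup>2) = (indicator B :: _ \<Rightarrow> real)"
    using \<Omega>(2) by (auto simp: indicator_def fun_eq_iff)
  have "integrable lebesgue (indicator B :: _ \<Rightarrow> real)" using B by (auto simp: fmeasurable_def intro: integrable_real_indicator)
  then have "integrable (lebesgue_on \<Omega>) (\<lambda>x. (indicator B x)\<^sup>2 :: real)"
    using \<Omega>(1) eq by (simp add: integrable_restrict_space)
  moreover have "(indicator B :: _ \<Rightarrow> real) \<in> borel_measurable (lebesgue_on \<Omega>)"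
    using fmeasurableD[OF B] by (intro measurable_restrict_space1 borel_measurable_indicator)
  ultimately show ?thesis by (simp add: L2_def)
qed

text \<open>All three facts come from writing the integral over B as the pairing of the function
  with the indicator of B, which lies in \<open>L2\<close>.\<close>

lemma avg_L2:
  assumes B: "B \<in> lmeasurable" and \<Omega>: "\<Omega> \<in> sets lebesgue" "B \<subseteq> \<Omega>"
  shows "L2 \<Omega> v \<Longrightarrow> L2 \<Omega> w \<Longrightarrow> avg B (\<lambda>x. v x - w x) = avg B v - avg B w"
    and "L2 \<Omega> v \<Longrightarrow> \<bar>measure lebesgue B * avg B v\<bar> \<le> L2norm \<Omega> (indicator B) * L2norm \<Omega> v"
    and "L2 \<Omega> v \<Longrightarrow> (\<And>k. L2 \<Omega> (F k)) \<Longrightarrow> (\<lambda>k. L2norm \<Omega> (\<lambda>x. F k x - v x)) \<longlonglongrightarrow> 0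
      \<Longrightarrow> (\<lambda>k. avg B (F k)) \<longlonglongrightarrow> avg B v"
proof -
  note ind = L2_indicator[OF B \<Omega>] and on = lint_on_indicator[OF fmeasurableD[OF B] \<Omega>]
  show "avg B (\<lambda>x. v x - w x) = avg B v - avg B w" if "L2 \<Omega> v" "L2 \<Omega> w"
    using L2_mult_integrable[OF ind that(1)] L2_mult_integrable[OF ind that(2)]
    by (simp add: avg_def on right_diff_distrib diff_divide_distrib)
  show "\<bar>measure lebesgue B * avg B v\<bar> \<le> L2norm \<Omega> (indicator B) * L2norm \<Omega> v" if "L2 \<Omega> v"
  proof (cases "measure lebesgue B = 0")
    case True
    then show ?thesis by (simp add: L2norm_nonneg)
  next
    case False
    then show ?thesis using L2_Cauchy_Schwarz[OF ind that] by (simp add: avg_def on)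
  qed
  show "(\<lambda>k. avg B (F k)) \<longlonglongrightarrow> avg B v"
    if "L2 \<Omega> v" "\<And>k. L2 \<Omega> (F k)" "(\<lambda>k. L2norm \<Omega> (\<lambda>x. F k x - v x)) \<longlonglongrightarrow> 0"
    unfolding avg_def on using L2_convergence(2)[OF that ind] by (simp add: divide_inverse tendsto_mult_right)
qed

lemma sum_lint_on:
  fixes g :: "'a::euclidean_space \<Rightarrow> real"
  assumes K: "\<And>i. i < m \<Longrightarrow> K i \<in> sets lebesgue \<and> bounded (K i)" and g: "continuous_on UNIV g"
  shows "(\<Sum>i<m. lint_on (K i) g) = (LINT x|lebesgue. (\<Sum>i<m. indicator (K i) x) * g x)"
    and "integrable lebesgue (\<lambda>x. (\<Sum>i<(m::nat). indicator (K i) x) * g x)"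
proof -
  have i: "integrable lebesgue (\<lambda>x. indicator (K i) x * g x)" if "i < m" for i
    using integrable_lebesgue_on_continuous[of "K i" g] K[OF that] g by (simp add: integrable_restrict_space)
  have "(\<Sum>i<m. lint_on (K i) g) = (\<Sum>i<m. LINT x|lebesgue. indicator (K i) x * g x)"
    using K by (intro sum.cong) (auto simp: integral_restrict_space)
  also have "\<dots> = (LINT x|lebesgue. (\<Sum>i<m. indicator (K i) x * g x))"
    using i by (intro Bochner_Integration.integral_sum[symmetric]) auto
  finally show "(\<Sum>i<m. lint_on (K i) g) = (LINT x|lebesgue. (\<Sum>i<m. indicator (K i) x) * g x)"
    by (simp add: sum_distrib_right)
  show "integrable lebesgue (\<lambda>x. (\<Sum>i<m. indicator (K i) x) * g x)"
    unfolding sum_distrib_right using i by (intro Bochner_Integration.integrable_sum) auto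
qed

text \<open>The local inequalities are added. Almost every point of \<Omega> is counted at least
  once on the left and every point at most M times on the right; outside \<Omega> the integrands are
  zero, whatever the \<open>K i\<close> do there.\<close>

lemma cover_poincare:
  fixes \<phi> :: "real^'n::finite \<Rightarrow> real" and B K :: "nat \<Rightarrow> (real^'n) set"
  assumes \<Omega>: "open \<Omega>" "bounded \<Omega>"
    and B: "\<And>i. i < m \<Longrightarrow> open (B i) \<and> B i \<noteq> {} \<and> B i \<subseteq> K i"
    and K: "\<And>i. i < m \<Longrightarrow> convex (K i) \<and> bounded (K i)" and cover: "\<Omega> \<subseteq> (\<Union>i<m. closure (K i))"
    and R: "\<And>i. i < m \<Longrightarrow> diameter (K i) \<le> R"
    and M: "\<And>x. x \<in> \<Omega> \<Longrightarrow> real (card {i. i < m \<and> x \<in> K i}) \<le> M"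
    and \<eta>: "\<And>i. i < m \<Longrightarrow> (B i = K i \<and> \<eta> = 1) \<or> 3 * (measure lebesgue (K i) / measure lebesgue (B i)) \<le> \<eta>"
    and \<eta>0: "0 \<le> \<eta>"
    and der: "\<And>x. (\<phi> has_derivative (\<lambda>h. G x \<bullet> h)) (at x)" and G: "continuous_on UNIV G"
    and out: "\<And>x. x \<notin> \<Omega> \<Longrightarrow> \<phi> x = 0 \<and> G x = 0"
  shows "lint_on \<Omega> (\<lambda>x. (\<phi> x)\<^sup>2) \<le> \<eta> * ((R / pi)\<^sup>2 * M * lint_on \<Omega> (\<lambda>x. (norm (G x))\<^sup>2) + bform m B \<phi> \<phi>)"
proof -
  have \<phi>c: "continuous_on UNIV \<phi>"
    using der by (meson continuous_at_imp_continuous_on has_derivative_continuous)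
  have c: "continuous_on UNIV (\<lambda>x. (\<phi> x)\<^sup>2)" "continuous_on UNIV (\<lambda>x. (norm (G x))\<^sup>2)"
    by (intro continuous_intros \<phi>c G)+
  have \<Omega>m: "\<Omega> \<in> sets lebesgue" using \<Omega>(1) by simp
  have Km: "K i \<in> sets lebesgue \<and> bounded (K i)" if "i < m" for i
    using K[OF that] by (simp add: measurable_convex fmeasurableD)
  have on\<Omega>: "integrable lebesgue (\<lambda>x. indicator \<Omega> x * g x)" "lint_on \<Omega> g = (LINT x|lebesgue. indicator \<Omega> x * g x)"
    if "continuous_on UNIV g" for g :: "real^'n \<Rightarrow> real"
    using integrable_lebesgue_on_continuous[OF \<Omega>m \<Omega>(2) that] \<Omega>m
    by (simp_all add: integrable_restrict_space integral_restrict_space)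
  have count: "(\<Sum>i<m. indicator (K i) x :: real) = real (card {i. i < m \<and> x \<in> K i})" for x
  proof -
    have "(\<Sum>i<m. indicator (K i) x :: real) = (\<Sum>i\<in>{i. i < m \<and> x \<in> K i}. 1)"
      by (intro sum.mono_neutral_cong_right) auto
    then show ?thesis by simp
  qed
  have sum_K: "(\<Sum>i<m. lint_on (K i) g) = (LINT x|lebesgue. (\<Sum>i<m. indicator (K i) x) * g x)"
    "integrable lebesgue (\<lambda>x. (\<Sum>i<m. indicator (K i) x) * g x)"
    if "continuous_on UNIV g" for g :: "real^'n \<Rightarrow> real"
    using Km that by (intro sum_lint_on; blast)+
  have "lint_on \<Omega> (\<lambda>x. (\<phi> x)\<^sup>2) \<le> (\<Sum>i<m. lint_on (K i) (\<lambda>x. (\<phi> x)\<^sup>2))"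
    unfolding on\<Omega>(2)[OF c(1)] sum_K(1)[OF c(1)]
  proof (rule integral_mono_AE[OF on\<Omega>(1)[OF c(1)] sum_K(2)[OF c(1)]])
    \<comment> \<open>Only the closures cover \<Omega>, but away from the null frontiers a point of
      the closure of \<open>K i\<close> belongs to \<open>K i\<close>.\<close>
    have "AE x in lebesgue. \<forall>i\<in>{..<m}. x \<notin> frontier (K i)"
    proof (rule AE_finite_allI)
      fix i assume "i \<in> {..<m}"
      then have "negligible (frontier (K i))" using K by (intro negligible_convex_frontier) auto
      then show "AE x in lebesgue. x \<notin> frontier (K i)" by (intro AE_not_in) (simp add: negligible_iff_null_sets)
    qed simp
    then show "AE x in lebesgue. indicator \<Omega> x * (\<phi> x)\<^sup>2 \<le> (\<Sum>i<m. indicator (K i) x) * (\<phi> x)\<^sup>2"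
    proof eventually_elim
      case (elim x)
      show ?case
      proof (rule mult_right_mono)
        show "indicator \<Omega> x \<le> (\<Sum>i<m. indicator (K i) x :: real)"
        proof (cases "x \<in> \<Omega>")
          case True
          then obtain i where i: "i < m" "x \<in> closure (K i)" using cover by blast
          then have "x \<in> K i" using elim interior_subset[of "K i"] by (auto simp: frontier_def)
          then have "{i. i < m \<and> x \<in> K i} \<noteq> {}" using i(1) by blast
          then have "card {i. i < m \<and> x \<in> K i} \<ge> 1" by (simp add: Suc_le_eq card_gt_0_iff)
          then show ?thesis using True unfolding count by simp
        qed (simp add: count)
      qed simp
    qed
  qed
  also have "\<dots> \<le> (\<Sum>i<m. \<eta> * ((R / pi)\<^sup>2 * lint_on (K i) (\<lambda>x. (norm (G x))\<^sup>2) + measure lebesgue (B i) * (avg (B i) \<phi>)\<^sup>2))"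
    by (intro sum_mono local_poincare(2)) (use K B R \<eta> der G in auto)
  also have "\<dots> = \<eta> * ((R / pi)\<^sup>2 * (\<Sum>i<m. lint_on (K i) (\<lambda>x. (norm (G x))\<^sup>2)) + bform m B \<phi> \<phi>)"
    by (simp add: bform_def sum_distrib_left sum.distrib distrib_left power2_eq_square mult.assoc)
  also have "\<dots> \<le> \<eta> * ((R / pi)\<^sup>2 * (M * lint_on \<Omega> (\<lambda>x. (norm (G x))\<^sup>2)) + bform m B \<phi> \<phi>)"
  proof (intro mult_left_mono add_right_mono)
    have "(\<Sum>i<m. lint_on (K i) (\<lambda>x. (norm (G x))\<^sup>2)) \<le> (LINT x|lebesgue. M * (indicator \<Omega> x * (norm (G x))\<^sup>2))"
      unfolding sum_K(1)[OF c(2)]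
    proof (rule integral_mono[OF sum_K(2)[OF c(2)]])
      show "(\<Sum>i<m. indicator (K i) x) * (norm (G x))\<^sup>2 \<le> M * (indicator \<Omega> x * (norm (G x))\<^sup>2)" for x
        using M[of x] out[of x] unfolding count by (cases "x \<in> \<Omega>") (auto intro: mult_right_mono)
    qed (use on\<Omega>(1)[OF c(2)] in auto)
    then show "(\<Sum>i<m. lint_on (K i) (\<lambda>x. (norm (G x))\<^sup>2)) \<le> M * lint_on \<Omega> (\<lambda>x. (norm (G x))\<^sup>2)"
      unfolding on\<Omega>(2)[OF c(2)] by simp
  qed (use \<eta>0 in auto)
  finally show ?thesis by (simp add: mult.assoc)
qed

text \<open>The inequality for C^1 functions is applied to differences of test functions, and both
  sides pass to the limit because norms and averages are \<open>L2\<close>-continuous. Treating v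
  and w separately yields the differences of their own weak gradients, the form in which the energy
  identity produces them.\<close>

lemma H1_0_cover_poincare:
  fixes v w :: "real^'n::finite \<Rightarrow> real"
  assumes \<Omega>: "open \<Omega>" "bounded \<Omega>" and v: "H1_0 \<Omega> v" and w: "H1_0 \<Omega> w"
    and B: "\<And>i. i < m \<Longrightarrow> open (B i) \<and> B i \<subseteq> \<Omega>"
    and C1: "\<And>\<phi> G. (\<And>x. (\<phi> has_derivative (\<lambda>h. G x \<bullet> h)) (at x)) \<Longrightarrow> continuous_on UNIV G \<Longrightarrow>
        (\<And>x. x \<notin> \<Omega> \<Longrightarrow> \<phi> x = 0 \<and> G x = 0) \<Longrightarrow>
        lint_on \<Omega> (\<lambda>x. (\<phi> x)\<^sup>2) \<le> \<eta> * (\<rho> * lint_on \<Omega> (\<lambda>x. (norm (G x))\<^sup>2) + bform m B \<phi> \<phi>)"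
  shows "(L2norm \<Omega> (\<lambda>x. v x - w x))\<^sup>2 \<le> \<eta> * (\<rho> * (\<Sum>j\<in>UNIV. (L2norm \<Omega> (\<lambda>x. wpartial \<Omega> v j x - wpartial \<Omega> w j x))\<^sup>2)
     + bform m B (\<lambda>x. v x - w x) (\<lambda>x. v x - w x))"
proof -
  have \<Omega>m: "\<Omega> \<in> sets lebesgue" using \<Omega>(1) by simp
  have Hv: "H1 \<Omega> v" "L2 \<Omega> v" and Hw: "H1 \<Omega> w" "L2 \<Omega> w" using v w by (auto simp: H1_0_def H1_def)
  obtain p where p: "\<And>k. test_fun \<Omega> (p k)" "(\<lambda>k. L2norm \<Omega> (\<lambda>x. p k x - v x)) \<longlonglongrightarrow> 0"
    "\<And>j. (\<lambda>k. L2norm \<Omega> (\<lambda>x. cpartial j (p k) x - wpartial \<Omega> v j x)) \<longlonglongrightarrow> 0"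
    "\<And>k. L2 \<Omega> (p k)" "\<And>k j. L2 \<Omega> (cpartial j (p k))"
    using H1_0_approx[OF \<Omega>m \<Omega>(2) v] by blast
  obtain q where q: "\<And>k. test_fun \<Omega> (q k)" "(\<lambda>k. L2norm \<Omega> (\<lambda>x. q k x - w x)) \<longlonglongrightarrow> 0"
    "\<And>j. (\<lambda>k. L2norm \<Omega> (\<lambda>x. cpartial j (q k) x - wpartial \<Omega> w j x)) \<longlonglongrightarrow> 0"
    "\<And>k. L2 \<Omega> (q k)" "\<And>k j. L2 \<Omega> (cpartial j (q k))"
    using H1_0_approx[OF \<Omega>m \<Omega>(2) w] by blast
  define e where "e x = v x - w x" for x
  define f where "f k x = p k x - q k x" for k x
  define E where "E j x = wpartial \<Omega> v j x - wpartial \<Omega> w j x" for j x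
  define F where "F j k x = cpartial j (p k) x - cpartial j (q k) x" for j k x
  have L2: "L2 \<Omega> e" "L2 \<Omega> (f k)" "L2 \<Omega> (E j)" "L2 \<Omega> (F j k)" for j k
    unfolding e_def f_def E_def F_def
    by (intro L2_diff wpartial_L2(1) Hv Hw p(4,5) q(4,5))+
  have fe: "(\<lambda>k. L2norm \<Omega> (\<lambda>x. f k x - e x)) \<longlonglongrightarrow> 0"
    unfolding f_def e_def by (rule L2norm_diff_tendsto_0[OF Hv(2) p(4,2) Hw(2) q(4,2)])
  have FE: "(\<lambda>k. L2norm \<Omega> (\<lambda>x. F j k x - E j x)) \<longlonglongrightarrow> 0" for j
    unfolding F_def E_def
    by (rule L2norm_diff_tendsto_0[OF wpartial_L2(1)[OF Hv(1)] p(5,3) wpartial_L2(1)[OF Hw(1)] q(5,3)])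
  have Bm: "B i \<in> lmeasurable \<and> B i \<subseteq> \<Omega>" if "i < m" for i
    using B[OF that] \<Omega>(2) bounded_subset by (blast intro: lmeasurable_open)
  have est: "(L2norm \<Omega> (f k))\<^sup>2 \<le> \<eta> * (\<rho> * (\<Sum>j\<in>UNIV. (L2norm \<Omega> (F j k))\<^sup>2) + bform m B (f k) (f k))" for k
  proof -
    let ?G = "\<lambda>x. grad (p k) x - grad (q k) x"
    have "lint_on \<Omega> (\<lambda>x. (f k x)\<^sup>2) \<le> \<eta> * (\<rho> * lint_on \<Omega> (\<lambda>x. (norm (?G x))\<^sup>2) + bform m B (f k) (f k))"
    proof (rule C1)
      show "(f k has_derivative (\<lambda>h. ?G x \<bullet> h)) (at x)" for x
        using has_derivative_diff[OF test_fun_C1(1)[OF p(1)] test_fun_C1(1)[OF q(1)]]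
        unfolding f_def inner_diff_left .
      show "continuous_on UNIV ?G"
        by (intro continuous_intros test_fun_C1(3)[OF p(1)] test_fun_C1(3)[OF q(1)])
      show "f k x = 0 \<and> ?G x = 0" if "x \<notin> \<Omega>" for x
        using that test_fun_C1(4,5)[OF p(1)] test_fun_C1(4,5)[OF q(1)] by (simp add: f_def)
    qed
    also have "lint_on \<Omega> (\<lambda>x. (norm (?G x))\<^sup>2) = lint_on \<Omega> (\<lambda>x. \<Sum>j\<in>UNIV. (F j k x)\<^sup>2)"
    proof -
      have "(norm (?G x))\<^sup>2 = (\<Sum>j\<in>UNIV. (F j k x)\<^sup>2)" for x
        unfolding power2_norm_eq_inner inner_vec_def by (simp add: grad_def F_def power2_eq_square)
      then show ?thesis by simp
    qed
    also have "\<dots> = (\<Sum>j\<in>UNIV. (L2norm \<Omega> (F j k))\<^sup>2)"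
      unfolding L2norm_power2 using L2(4) by (intro Bochner_Integration.integral_sum) (simp add: L2_def)
    finally show ?thesis unfolding L2norm_power2 .
  qed
  have avgs: "(\<lambda>k. avg (B i) (f k)) \<longlonglongrightarrow> avg (B i) e" if "i < m" for i
    using Bm[OF that] by (intro avg_L2(3)[OF _ \<Omega>m _ L2(1) L2(2) fe]) auto
  have "(\<lambda>k. bform m B (f k) (f k)) \<longlonglongrightarrow> bform m B e e"
    unfolding bform_def by (intro tendsto_intros avgs) auto
  then have "(\<lambda>k. \<eta> * (\<rho> * (\<Sum>j\<in>UNIV. (L2norm \<Omega> (F j k))\<^sup>2) + bform m B (f k) (f k)))
    \<longlonglongrightarrow> \<eta> * (\<rho> * (\<Sum>j\<in>UNIV. (L2norm \<Omega> (E j))\<^sup>2) + bform m B e e)"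
    by (intro tendsto_intros L2_convergence(1)[OF L2(3) L2(4) FE])
  moreover have "(\<lambda>k. (L2norm \<Omega> (f k))\<^sup>2) \<longlonglongrightarrow> (L2norm \<Omega> e)\<^sup>2"
    by (intro tendsto_intros L2_convergence(1)[OF L2(1) L2(2) fe])
  ultimately have "(L2norm \<Omega> e)\<^sup>2 \<le> \<eta> * (\<rho> * (\<Sum>j\<in>UNIV. (L2norm \<Omega> (E j))\<^sup>2) + bform m B e e)"
    using est by (intro LIMSEQ_le) auto
  then show ?thesis unfolding e_def E_def .
qed

text \<open>The equation is tested with \<open>ut\<close> and \<open>u\<close> separately and not with their difference, because
  \<open>wpartial\<close> is a choice that is additive only almost everywhere.\<close>
lemma energy_identity:
  fixes u ut :: "real^'n::finite \<Rightarrow> real"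
  assumes \<Omega>: "open \<Omega>" "bounded \<Omega>" and u: "H1_0 \<Omega> u" "H2 \<Omega> u" and ut: "H1_0 \<Omega> ut"
    and B: "\<And>i. i < m \<Longrightarrow> open (B i) \<and> B i \<subseteq> \<Omega>"
    and eq: "\<And>v. H1_0 \<Omega> v \<Longrightarrow> dirichlet \<Omega> ut v + c * bform m B ut v = c * bdata m B b v"
  defines "e \<equiv> \<lambda>x. ut x - u x"
  shows "(\<Sum>j\<in>UNIV. (L2norm \<Omega> (\<lambda>x. wpartial \<Omega> ut j x - wpartial \<Omega> u j x))\<^sup>2) + c * bform m B e e
    = lint_on \<Omega> (\<lambda>x. wlaplacian \<Omega> u x * e x) + c * (bdata m B b e - bform m B u e)"
proof -
  have \<Omega>m: "\<Omega> \<in> sets lebesgue" using \<Omega>(1) by simp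
  have Hu: "H1 \<Omega> u" "L2 \<Omega> u" and Ht: "H1 \<Omega> ut" "L2 \<Omega> ut" using u ut by (auto simp: H1_0_def H1_def)
  note Du = wpartial_L2(1)[OF Hu(1)] and Dt = wpartial_L2(1)[OF Ht(1)]
  have Bm: "B i \<in> lmeasurable \<and> B i \<subseteq> \<Omega>" if "i < m" for i
    using B[OF that] \<Omega>(2) bounded_subset by (blast intro: lmeasurable_open)
  have av: "avg (B i) e = avg (B i) ut - avg (B i) u" if "i < m" for i
    unfolding e_def using Bm[OF that] by (intro avg_L2(1)[OF _ \<Omega>m _ Ht(2) Hu(2)]) auto
  have bf: "bform m B z e = bform m B z ut - bform m B z u" for z
    unfolding bform_def sum_subtractf[symmetric] by (intro sum.cong) (auto simp: av right_diff_distrib)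
  have bf': "bform m B e z = bform m B ut z - bform m B u z" for z
    unfolding bform_def sum_subtractf[symmetric] by (intro sum.cong) (auto simp: av algebra_simps)
  have bd: "bdata m B b e = bdata m B b ut - bdata m B b u"
    unfolding bdata_def sum_subtractf[symmetric] by (intro sum.cong) (auto simp: av right_diff_distrib)
  have dir: "dirichlet \<Omega> y z = (\<Sum>j\<in>UNIV. lint_on \<Omega> (\<lambda>x. wpartial \<Omega> y j x * wpartial \<Omega> z j x))"
    if "H1 \<Omega> y" "H1 \<Omega> z" for y z
    unfolding dirichlet_def
    by (intro Bochner_Integration.integral_sum L2_mult_integrable wpartial_L2(1) that)
  have "(\<Sum>j\<in>UNIV. (L2norm \<Omega> (\<lambda>x. wpartial \<Omega> ut j x - wpartial \<Omega> u j x))\<^sup>2)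
    = (\<Sum>j\<in>UNIV. lint_on \<Omega> (\<lambda>x. wpartial \<Omega> ut j x * wpartial \<Omega> ut j x) - lint_on \<Omega> (\<lambda>x. wpartial \<Omega> ut j x * wpartial \<Omega> u j x)
        - lint_on \<Omega> (\<lambda>x. wpartial \<Omega> u j x * wpartial \<Omega> ut j x) + lint_on \<Omega> (\<lambda>x. wpartial \<Omega> u j x * wpartial \<Omega> u j x))"
  proof (intro sum.cong refl)
    fix j
    have "(L2norm \<Omega> (\<lambda>x. wpartial \<Omega> ut j x - wpartial \<Omega> u j x))\<^sup>2
      = lint_on \<Omega> (\<lambda>x. wpartial \<Omega> ut j x * wpartial \<Omega> ut j x - wpartial \<Omega> ut j x * wpartial \<Omega> u j x
         - wpartial \<Omega> u j x * wpartial \<Omega> ut j x + wpartial \<Omega> u j x * wpartial \<Omega> u j x)"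
      unfolding L2norm_power2
      by (intro Bochner_Integration.integral_cong) (auto simp: power2_eq_square algebra_simps)
    then show "(L2norm \<Omega> (\<lambda>x. wpartial \<Omega> ut j x - wpartial \<Omega> u j x))\<^sup>2
      = lint_on \<Omega> (\<lambda>x. wpartial \<Omega> ut j x * wpartial \<Omega> ut j x) - lint_on \<Omega> (\<lambda>x. wpartial \<Omega> ut j x * wpartial \<Omega> u j x)
        - lint_on \<Omega> (\<lambda>x. wpartial \<Omega> u j x * wpartial \<Omega> ut j x) + lint_on \<Omega> (\<lambda>x. wpartial \<Omega> u j x * wpartial \<Omega> u j x)"
      using L2_mult_integrable[OF Du[of j] Du[of j]] L2_mult_integrable[OF Du[of j] Dt[of j]]
        L2_mult_integrable[OF Dt[of j] Du[of j]] L2_mult_integrable[OF Dt[of j] Dt[of j]]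
      by (simp add: mult.commute)
  qed
  also have "\<dots> = dirichlet \<Omega> ut ut - dirichlet \<Omega> ut u - dirichlet \<Omega> u ut + dirichlet \<Omega> u u"
    by (simp add: dir Hu Ht sum.distrib sum_subtractf)
  finally have grad_sum: "(\<Sum>j\<in>UNIV. (L2norm \<Omega> (\<lambda>x. wpartial \<Omega> ut j x - wpartial \<Omega> u j x))\<^sup>2)
    = dirichlet \<Omega> ut ut - dirichlet \<Omega> ut u - dirichlet \<Omega> u ut + dirichlet \<Omega> u u" .
  have "- dirichlet \<Omega> u ut + dirichlet \<Omega> u u = lint_on \<Omega> (\<lambda>x. wlaplacian \<Omega> u x * e x)"
  proof -
    have "L2 \<Omega> (wlaplacian \<Omega> u)"
      unfolding wlaplacian_def using u(2) by (intro L2_sum wpartial_L2(1)) (auto simp: H2_def)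
    from L2_mult_integrable[OF this Ht(2)] L2_mult_integrable[OF this Hu(2)]
    show ?thesis
      unfolding H2_green[OF \<Omega>m \<Omega>(2) u(2) ut] H2_green[OF \<Omega>m \<Omega>(2) u(2) u(1)] e_def
      by (simp add: right_diff_distrib)
  qed
  \<comment> \<open>The equation tested with \<open>ut\<close> minus the equation tested with
    \<open>u\<close> supplies the terms with \<open>ut\<close> in the first slot; Green's formula
    has supplied those with \<open>u\<close> there.\<close>
  then show ?thesis
    using eq[OF ut] eq[OF u(1)] unfolding grad_sum bf bf' bd by (simp add: algebra_simps)
qed

text \<open>A real \<open>Sup\<close> dominates the members only of a set that is bounded above. The
  misfit is a finite combination of averages of v, each bounded by the \<open>L2\<close> norm of
  v.\<close>

lemma data_misfit_bounded:
  fixes u :: "real^'n::finite \<Rightarrow> real"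
  assumes \<Omega>: "open \<Omega>" "bounded \<Omega>" and B: "\<And>i. i < m \<Longrightarrow> open (B i) \<and> B i \<subseteq> \<Omega>"
  shows "bdd_above {\<bar>bdata m B b v - bform m B u v\<bar> / L2norm \<Omega> v | v. L2 \<Omega> v \<and> L2norm \<Omega> v \<noteq> 0}"
proof -
  have \<Omega>m: "\<Omega> \<in> sets lebesgue" using \<Omega>(1) by simp
  have Bm: "B i \<in> lmeasurable \<and> B i \<subseteq> \<Omega>" if "i < m" for i
    using B[OF that] \<Omega>(2) bounded_subset by (blast intro: lmeasurable_open)
  define C where "C = (\<Sum>i<m. \<bar>b i - avg (B i) u\<bar> * L2norm \<Omega> (indicator (B i)))"
  have "\<bar>bdata m B b v - bform m B u v\<bar> / L2norm \<Omega> v \<le> C" if v: "L2 \<Omega> v" "L2norm \<Omega> v \<noteq> 0" for v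
  proof -
    have "bdata m B b v - bform m B u v = (\<Sum>i<m. (b i - avg (B i) u) * (measure lebesgue (B i) * avg (B i) v))"
      by (simp add: bdata_def bform_def sum_subtractf[symmetric] algebra_simps)
    also have "\<bar>\<dots>\<bar> \<le> (\<Sum>i<m. \<bar>b i - avg (B i) u\<bar> * (L2norm \<Omega> (indicator (B i)) * L2norm \<Omega> v))"
    proof (intro order_trans[OF sum_abs] sum_mono)
      fix i assume "i \<in> {..<m}"
      then have "\<bar>measure lebesgue (B i) * avg (B i) v\<bar> \<le> L2norm \<Omega> (indicator (B i)) * L2norm \<Omega> v"
        using Bm[of i] by (intro avg_L2(2)[OF _ \<Omega>m _ v(1)]) auto
      then show "\<bar>(b i - avg (B i) u) * (measure lebesgue (B i) * avg (B i) v)\<bar>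
         \<le> \<bar>b i - avg (B i) u\<bar> * (L2norm \<Omega> (indicator (B i)) * L2norm \<Omega> v)"
        unfolding abs_mult[of "b i - avg (B i) u"] by (rule mult_left_mono) simp
    qed
    also have "\<dots> = C * L2norm \<Omega> v" by (simp add: C_def sum_distrib_right mult.assoc)
    finally show ?thesis using v(2) L2norm_nonneg[of \<Omega> v] by (simp add: pos_divide_le_eq order_less_le)
  qed
  then show ?thesis by (intro bdd_aboveI[of _ C]) auto
qed

theorem theorem3p13:
  fixes \<Omega> :: "(real^'n::finite) set"
    and u ut :: "real^'n \<Rightarrow> real"
    and m :: nat
    and B K :: "nat \<Rightarrow> (real^'n) set"
    and b :: "nat \<Rightarrow> real"
    and \<delta> \<theta> M R \<eta> :: real
  assumes dom: "lipschitz_domain \<Omega>"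
    and u_reg: "H1_0 \<Omega> u" "H2 \<Omega> u"
    and B_open: "\<forall>i<m. open (B i) \<and> B i \<noteq> {} \<and> B i \<subseteq> \<Omega>"
    and K_prop: "\<forall>i<m. B i \<subseteq> K i \<and> convex (K i) \<and> bounded (K i) \<and> lipschitz_boundary (K i)"
    and cover: "\<Omega> \<subseteq> (\<Union>i<m. closure (K i))"
    and M_def: "M = real (Max ((\<lambda>x. card {i. i < m \<and> x \<in> K i}) ` \<Omega>))"
    and R_def: "R = Max ((\<lambda>i. diameter (K i)) ` {..<m})"
    and eta_def: "\<eta> = (if (\<forall>i<m. B i = K i) then 1
                    else 3 * Max ((\<lambda>i. measure lebesgue (K i) / measure lebesgue (B i)) ` {..<m}))"
    and delta_pos: "\<delta> > 0"
    and ut_sol: "H1_0 \<Omega> ut"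
      "\<forall>v. H1_0 \<Omega> v \<longrightarrow>
         dirichlet \<Omega> ut v + (1 / \<delta>) * bform m B ut v = (1 / \<delta>) * bdata m B b v"
    and theta: "0 < \<theta>" "\<theta> \<le> 1"
    and delta_range: "\<theta> * R^2 * M / pi^2 \<le> \<delta>" "\<delta> \<le> (1 / \<theta>) * R^2 * M / pi^2"
  shows "L2norm \<Omega> (\<lambda>x. ut x - u x)
     \<le> \<eta> * (1 / \<theta>) * (R^2 * M / pi^2) * L2norm \<Omega> (wlaplacian \<Omega> u)
       + \<eta> * (1 / \<theta>) * Sup {\<bar>bdata m B b v - bform m B u v\<bar> / L2norm \<Omega> v | v. L2 \<Omega> v \<and> L2norm \<Omega> v \<noteq> 0}"
proof -
  have \<Omega>: "open \<Omega>" "bounded \<Omega>" "\<Omega> \<noteq> {}" using dom by (auto simp: lipschitz_domain_def)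
  have \<Omega>m: "\<Omega> \<in> sets lebesgue" using \<Omega>(1) by simp
  have B: "open (B i) \<and> B i \<subseteq> \<Omega>" if "i < m" for i using B_open that by blast
  have Hu: "L2 \<Omega> u" and Ht: "L2 \<Omega> ut" using u_reg ut_sol by (auto simp: H1_0_def H1_def)
  \<comment> \<open>An empty cover is excluded, so a first set with index 0 is available for the
    proof of 1 \<le> \<eta>.\<close>
  have m0: "0 < m" using \<Omega>(3) cover by (cases m) auto
  have R: "diameter (K i) \<le> R" if "i < m" for i
    unfolding R_def using that by (intro Max_ge) auto
  have \<eta>: "(B i = K i \<and> \<eta> = 1) \<or> 3 * (measure lebesgue (K i) / measure lebesgue (B i)) \<le> \<eta>" if "i < m" for i
  proof (cases "\<forall>i<m. B i = K i")
    case False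
    have "measure lebesgue (K i) / measure lebesgue (B i) \<le> Max ((\<lambda>i. measure lebesgue (K i) / measure lebesgue (B i)) ` {..<m})"
      using that by (intro Max_ge) auto
    moreover have "\<eta> = 3 * Max ((\<lambda>i. measure lebesgue (K i) / measure lebesgue (B i)) ` {..<m})"
      unfolding eta_def if_not_P[OF False] ..
    ultimately show ?thesis by simp
  qed (use that eta_def in simp)
  have M: "real (card {i. i < m \<and> x \<in> K i}) \<le> M" if "x \<in> \<Omega>" for x
  proof -
    \<comment> \<open>\<Omega> is infinite, but the counts are at most m, so the \<open>Max\<close>
      in M runs over a finite set.\<close>
    have "card {i. i < m \<and> y \<in> K i} \<le> m" for y
      using card_mono[of "{..<m}" "{i. i < m \<and> y \<in> K i}"] by auto
    then have "finite ((\<lambda>x. card {i. i < m \<and> x \<in> K i}) ` \<Omega>)"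
      by (intro finite_subset[OF _ finite_atMost[of m]]) auto
    then show ?thesis unfolding M_def of_nat_le_iff using that by (intro Max_ge) auto
  qed
  have \<eta>1: "1 \<le> \<eta>"
    by (rule local_poincare(1)[of "K 0" "B 0" R "\<lambda>_. 0" "\<lambda>_. 0"]) (use m0 B_open K_prop R \<eta> in auto)
  define \<rho> where "\<rho> = R\<^sup>2 * M / pi\<^sup>2"
  have \<rho>: "(R / pi)\<^sup>2 * M = \<rho>" by (simp add: \<rho>_def power_divide)
  have \<rho>0: "0 \<le> \<rho>" by (simp add: \<rho>_def M_def)
  have \<rho>\<delta>: "\<theta> * \<rho> \<le> \<delta>" "\<delta> \<le> \<rho> / \<theta>" using delta_range by (simp_all add: \<rho>_def mult_ac)
  define e where "e x = ut x - u x" for x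
  have Le: "L2 \<Omega> e" unfolding e_def using Ht Hu by (rule L2_diff)
  define \<Delta> where "\<Delta> = wlaplacian \<Omega> u"
  have L\<Delta>: "L2 \<Omega> \<Delta>"
    unfolding \<Delta>_def wlaplacian_def using u_reg(2) by (intro L2_sum wpartial_L2(1)) (auto simp: H2_def)
  define T where "T = (\<Sum>j\<in>UNIV. (L2norm \<Omega> (\<lambda>x. wpartial \<Omega> ut j x - wpartial \<Omega> u j x))\<^sup>2)"
  define \<beta> where "\<beta> = bform m B e e"
  have T0: "0 \<le> T" unfolding T_def by (intro sum_nonneg) auto
  have \<beta>0: "0 \<le> \<beta>" unfolding \<beta>_def bform_def by (intro sum_nonneg) (simp add: mult.assoc)
  define S where "S = {\<bar>bdata m B b v - bform m B u v\<bar> / L2norm \<Omega> v | v. L2 \<Omega> v \<and> L2norm \<Omega> v \<noteq> 0}"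
  have bdd: "bdd_above S" unfolding S_def using \<Omega>(1,2) B by (rule data_misfit_bounded)
  define X Y s where "X = L2norm \<Omega> e" and "Y = L2norm \<Omega> \<Delta>" and "s = Sup S"
  have X0: "0 \<le> X" and Y0: "0 \<le> Y" by (auto simp: X_def Y_def L2norm_nonneg)
  have s_ge: "\<bar>bdata m B b v - bform m B u v\<bar> / L2norm \<Omega> v \<le> s" if "L2 \<Omega> v" "L2norm \<Omega> v \<noteq> 0" for v
    unfolding s_def using that by (intro cSup_upper[OF _ bdd]) (auto simp: S_def)
  \<comment> \<open>The supremum is over quotients with nonzero norm, so one such v must be
    exhibited; the constant 1 qualifies, as \<Omega> has positive measure.\<close>
  have s0: "0 \<le> s"
  proof -
    have "\<not> negligible \<Omega>" using \<Omega> open_not_negligible by blast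
    then have "measure lebesgue \<Omega> \<noteq> 0"
      using \<Omega> by (metis lmeasurable_open negligible_iff_measure)
    then have "(L2norm \<Omega> (\<lambda>_. 1))\<^sup>2 \<noteq> 0"
      unfolding L2norm_power2 using \<Omega>m by (simp add: measure_restrict_space space_restrict_space)
    moreover have "L2 \<Omega> (\<lambda>_. 1)" using \<Omega>m \<Omega>(2) by (intro L2_continuous) auto
    ultimately have "\<bar>bdata m B b (\<lambda>_. 1) - bform m B u (\<lambda>_. 1)\<bar> / L2norm \<Omega> (\<lambda>_. 1) \<le> s"
      by (intro s_ge) auto
    moreover have "0 \<le> \<bar>bdata m B b (\<lambda>_. 1) - bform m B u (\<lambda>_. 1)\<bar> / L2norm \<Omega> (\<lambda>_. 1)"
      by (intro divide_nonneg_nonneg L2norm_nonneg) auto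
    ultimately show ?thesis by linarith
  qed
  have "X \<le> \<eta> * (1 / \<theta>) * \<rho> * Y + \<eta> * (1 / \<theta>) * s"
  \<comment> \<open>The bound on the misfit of e and the final division by X both need a nonzero
    norm.\<close>
  proof (cases "X = 0")
    case True
    then show ?thesis using \<eta>1 theta \<rho>0 Y0 s0 by (simp add: add_nonneg_nonneg)
  next
    case False
    then have Xpos: "X > 0" using X0 by simp
    have "\<bar>bdata m B b e - bform m B u e\<bar> \<le> s * X"
      using s_ge[OF Le] Xpos unfolding X_def[symmetric] by (simp add: pos_divide_le_eq)
    then have data: "(1 / \<delta>) * (bdata m B b e - bform m B u e) \<le> (1 / \<delta>) * (s * X)"
      using delta_pos by (intro mult_left_mono) auto
    have lap: "lint_on \<Omega> (\<lambda>x. \<Delta> x * e x) \<le> Y * X"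
      using L2_Cauchy_Schwarz[OF L\<Delta> Le] unfolding X_def Y_def by linarith
    have "T + (1 / \<delta>) * \<beta> = lint_on \<Omega> (\<lambda>x. \<Delta> x * e x) + (1 / \<delta>) * (bdata m B b e - bform m B u e)"
      unfolding T_def \<beta>_def \<Delta>_def e_def
      by (rule energy_identity[OF \<Omega>(1,2) u_reg ut_sol(1) B]) (use ut_sol(2) in auto)
    then have energy: "T + (1 / \<delta>) * \<beta> \<le> (Y + (1 / \<delta>) * s) * X"
      using data lap by (simp add: distrib_right)
    have "X\<^sup>2 \<le> \<eta> * (\<rho> * T + \<beta>)"
      unfolding X_def T_def \<beta>_def e_def
    proof (rule H1_0_cover_poincare[OF \<Omega>(1,2) ut_sol(1) u_reg(1) B])
      fix \<phi> :: "real^'n \<Rightarrow> real" and G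
      assume "\<And>x. (\<phi> has_derivative (\<lambda>h. G x \<bullet> h)) (at x)" "continuous_on UNIV G"
        "\<And>x. x \<notin> \<Omega> \<Longrightarrow> \<phi> x = 0 \<and> G x = 0"
      then show "lint_on \<Omega> (\<lambda>x. (\<phi> x)\<^sup>2) \<le> \<eta> * (\<rho> * lint_on \<Omega> (\<lambda>x. (norm (G x))\<^sup>2) + bform m B \<phi> \<phi>)"
        unfolding \<rho>[symmetric]
        by (intro cover_poincare[OF \<Omega>(1,2) _ _ cover R M \<eta>]) (use B_open K_prop \<eta>1 in auto)
    qed
    \<comment> \<open>The Poincare bound has weights \<rho> and 1, the energy 1 and 1 / \<delta>;
      the ratios of the weights are \<rho> and \<delta>, so their maximum is the comparison
      factor.\<close>
    also have "\<dots> \<le> \<eta> * (max \<rho> \<delta> * (T + (1 / \<delta>) * \<beta>))"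
    proof (intro mult_left_mono)
      have "\<rho> * T \<le> max \<rho> \<delta> * T" using T0 by (intro mult_right_mono) auto
      moreover have "\<delta> * ((1 / \<delta>) * \<beta>) \<le> max \<rho> \<delta> * ((1 / \<delta>) * \<beta>)"
        using \<beta>0 delta_pos by (intro mult_right_mono) auto
      ultimately show "\<rho> * T + \<beta> \<le> max \<rho> \<delta> * (T + (1 / \<delta>) * \<beta>)"
        using delta_pos by (simp add: distrib_left)
    qed (use \<eta>1 in simp)
    also have "\<dots> \<le> \<eta> * (max \<rho> \<delta> * ((Y + (1 / \<delta>) * s) * X))"
      using energy \<eta>1 delta_pos by (intro mult_left_mono) auto
    finally have "X * X \<le> (\<eta> * (max \<rho> \<delta> * (Y + (1 / \<delta>) * s))) * X" by (simp add: power2_eq_square mult.assoc)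
    then have "X \<le> \<eta> * (max \<rho> \<delta> * (Y + (1 / \<delta>) * s))" using Xpos by (simp only: mult_le_cancel_right_pos)
    also have "\<dots> = \<eta> * (max \<rho> \<delta> * Y + max \<rho> \<delta> / \<delta> * s)" by (simp add: algebra_simps)
    \<comment> \<open>The range of \<delta> says that \<rho> and \<delta> agree up to the factor 1 /
      \<theta>. With \<theta> \<le> 1 their maximum is therefore at most \<rho> / \<theta>, used for
      the Laplacian, and at most \<delta> / \<theta>, used for the data.\<close>
    also have "\<dots> \<le> \<eta> * (\<rho> / \<theta> * Y + 1 / \<theta> * s)"
    proof (intro mult_left_mono add_mono mult_right_mono)
      have "\<rho> \<le> \<rho> / \<theta>" using \<rho>0 theta by (simp add: pos_le_divide_eq mult_left_le)
      then show "max \<rho> \<delta> \<le> \<rho> / \<theta>" using \<rho>\<delta> by simp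
      have "\<rho> \<le> \<delta> / \<theta>" using \<rho>\<delta>(1) theta by (simp add: pos_le_divide_eq mult.commute)
      moreover have "\<delta> \<le> \<delta> / \<theta>" using delta_pos theta by (simp add: pos_le_divide_eq mult_left_le)
      ultimately have "max \<rho> \<delta> \<le> \<delta> / \<theta>" by simp
      then have "max \<rho> \<delta> / \<delta> \<le> (\<delta> / \<theta>) / \<delta>" using delta_pos by (intro divide_right_mono) auto
      then show "max \<rho> \<delta> / \<delta> \<le> 1 / \<theta>" using delta_pos by simp
    qed (use \<eta>1 Y0 s0 in auto)
    finally show ?thesis by (simp add: distrib_left mult.assoc)
  qed
  then show ?thesis unfolding X_def Y_def s_def S_def \<Delta>_def \<rho>_def e_def .
qed

end
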